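(* The operator $\Pi_{V_h^{\mathrm{pol}}}$ defined on $C(\overline\Omega)$ by $$\Pi_{V_h^{\mathrm{pol}}}v=\frac{\Pi^{\mathrm{pol}}(W\,(v\circ F))}{W}\circ F^{-1}$$ is a well-defined projector onto $V_h^{\mathrm{pol}}$, that is, $\Pi_{V_h^{\mathrm{pol}}}v\in V_h^{\mathrm{pol}}$ for all $v\in C(\overline\Omega)$ and $\Pi_{V_h^{\mathrm{pol}}}v=v$ for all $v\in V_h^{\mathrm{pol}}$.
   Context: Notation: $a\sim b$ means $C_1b\le a\le C_2b$ with positive constants $C_1,C_2$. Polar domain with corner. Let $\widehat\Omega=(0,1)^2$. The geometry is given by a NURBS map $F:\widehat\Omega\to\Omega\subset\mathbb R^2$, $F=\sum_{i} c_i\,w_i\widehat B_i/W$ with $W=\sum_i w_i\widehat B_i$, control points $c_i\in\mathbb R^2$ and weights $w_i>0$, $i=(i_1,i_2)$, where the $\widehat B_i(\zeta)=\widehat B_{i_1}(\zeta_1)\widehat B_{i_2}(\zeta_2)$ are tensor products of the B-splines of degree $1$ for the knot vector $\{0,0,1,1\}$ and the B-splines of some degree $p_2^0$ for the open knot vector with breakpoints $k/M$, $k=0,\dots,M$ ($M\in\mathbb N$), the end points $0,1$ having multiplicity $p_2^0+1$ and the interior breakpoints multiplicity $p_2^0$. One requires $c_{(1,i_2)}=P:=(0,0)^T$ and $w_{(1,i_2)}=w_{(2,i_2)}$ for all $i_2$. Hence $F(\zeta_1,\zeta_2)=\zeta_1F^{(2)}(\zeta_2)$ and $W$ depends on $\zeta_2$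 only. Standing assumptions: $F:\widehat\Omega\to\Omega$ is bijective and $\det J_F(\zeta)\sim\zeta_1$; $P$ is a corner of $\Omega$ with inner angle $\omega\in(0,2\pi]$. $C(\overline\Omega)$ denotes the functions $v$ whose pull-back $v\circ F$ is continuous on $[0,1]^2$ and constant, equal to $v(P)$, on $\{0\}\times[0,1]$ (the usual space for $\omega<2\pi$; for $\omega=2\pi$ the two sides of the slit are distinguished). Graded discretization. Let $\mu\in(0,1]$, $p_1\ge1$, $p_2\ge p_2^0$. For $N_1,N_2>1$ with $N_2-1$ a multiple of $M$, set $h_l=1/(N_l-1)$. The first knot vector is $p_1$-open (end points of multiplicity $p_1+1$) with breakpoints $\zeta_{1,j}=((j-1)h_1)^{1/\mu}$, $1\le j\le N_1$, the interior ones being simple. The second knot vector is $p_2$-open with breakpoints $\zeta_{2,j}=(j-1)h_2$, $1\le j\le N_2$, obtained from the initial one by degree elevation and knot insertion, so interior multiplicities lie between $1$ and $p_2$ and equal $p_2$ at the initial breakpoints $k/M$. Let $\widehat B_i(\zeta)=\widehat B_{i_1,p_1}(\zeta_1)\widehat B_{i_2,p_2}(\zeta_2)$, $i\in I$, be the resulting tensor-product B-splines; the weight function $W=\sum_{i\in I} w_i\widehat B_i$ is unchanged by refinement (refined weights $w_i>0$, $w_{(i_1,i_2)}$ independent of $i_1$), and $\widehat N_i=w_i\widehat B_i/W$. Put $V_h=\operatorname{span}\{\widehat N_i\circ F^{-1}: i\in I\}$ and $V_h^{\mathrm{pol}}=V_h\cap H^1(\Omega)$. Quasi-interpolant. For a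 univariate $p$-open knot vector $\{\xi_1,\dots,\xi_{n+p+1}\}$ with B-splines $\widehat B_{i,p}$, let $\lambda_{i,p}(w)=\int_{\xi_i}^{\xi_{i+p+1}}w(t)\,\psi_i^{(p+1)}(t)\,dt$ with $\psi_i(t)=g\big(\tfrac{2t-\xi_i-\xi_{i+p+1}}{\xi_{i+p+1}-\xi_i}\big)\tfrac{(t-\xi_{i+1})\cdots(t-\xi_{i+p})}{p!}$, where $g$ is Schumaker's transition function: $g(x)=\int_{-1}^xB^*(y)\,dy$ on $[-1,1]$, $B^*$ being the B-spline of degree $p$ with knots $\cos\frac{(p+1-k)\pi}{p+1}$, $k=0,\dots,p+1$, normalized by $\int B^*=1$. These functionals are dual: $\lambda_{i,p}(\widehat B_{k,p})=\delta_{ik}$. Set $\lambda^{\mathrm{pol}}_{1,p_1}(w)=w(0)$, $\lambda^{\mathrm{pol}}_{i_1,p_1}=\lambda_{i_1,p_1}$ for $i_1\ge2$, $\lambda^{\mathrm{pol}}_{i}=\lambda^{\mathrm{pol}}_{i_1,p_1}\otimes\lambda_{i_2,p_2}$, and $\Pi^{\mathrm{pol}}w=\sum_{i\in I}\lambda^{\mathrm{pol}}_i(w)\widehat B_i$ for $w\in C([0,1]^2)$. *)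

theory Defs
  imports "HOL-Analysis.Analysis"
begin

section \<open>B-splines\<close>

text \<open>A knot vector \<open>\<xi>\<^sub>1 \<le> \<dots> \<le> \<xi>\<^bsub>n+p+1\<^esub>\<close> is a list; knots and B-splines are numbered from 1.\<close>

definition knot :: "real list \<Rightarrow> nat \<Rightarrow> real" where
  "knot \<Xi> i = \<Xi> ! (i - 1)"

text \<open>Cox--de Boor recursion, with \<open>x / 0 = 0\<close> for repeated knots. The nonempty knot interval that
  ends at the last knot is closed on the right, so that the B-splines of an open knot vector are
  continuous up to that knot.\<close>

fun bspline :: "real list \<Rightarrow> nat \<Rightarrow> nat \<Rightarrow> real \<Rightarrow> real" where
  "bspline \<Xi> i 0 t =
     (if knot \<Xi> i \<le> t \<and> t < knot \<Xi> (i + 1)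
         \<or> knot \<Xi> i < t \<and> t = knot \<Xi> (i + 1) \<and> t = last \<Xi> then 1 else 0)"
| "bspline \<Xi> i (Suc p) t =
     (t - knot \<Xi> i) / (knot \<Xi> (i + p + 1) - knot \<Xi> i) * bspline \<Xi> i p t
     + (knot \<Xi> (i + p + 2) - t) / (knot \<Xi> (i + p + 2) - knot \<Xi> (i + 1)) * bspline \<Xi> (i + 1) p t"

definition num_bsplines :: "real list \<Rightarrow> nat \<Rightarrow> nat" where
  "num_bsplines \<Xi> p = length \<Xi> - p - 1"

definition tensor_index :: "real list \<Rightarrow> nat \<Rightarrow> real list \<Rightarrow> nat \<Rightarrow> (nat \<times> nat) set" where
  "tensor_index \<Xi>1 p1 \<Xi>2 p2 = {1..num_bsplines \<Xi>1 p1} \<times> {1..num_bsplines \<Xi>2 p2}"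

definition tensor_bspline ::
  "real list \<Rightarrow> nat \<Rightarrow> real list \<Rightarrow> nat \<Rightarrow> nat \<times> nat \<Rightarrow> real^2 \<Rightarrow> real" where
  "tensor_bspline \<Xi>1 p1 \<Xi>2 p2 i \<zeta> = bspline \<Xi>1 (fst i) p1 (\<zeta>$1) * bspline \<Xi>2 (snd i) p2 (\<zeta>$2)"

definition tensor_spline ::
  "real list \<Rightarrow> nat \<Rightarrow> real list \<Rightarrow> nat \<Rightarrow> (nat \<times> nat \<Rightarrow> 'a::real_vector) \<Rightarrow> real^2 \<Rightarrow> 'a" where
  "tensor_spline \<Xi>1 p1 \<Xi>2 p2 a \<zeta> =
     (\<Sum>i\<in>tensor_index \<Xi>1 p1 \<Xi>2 p2. tensor_bspline \<Xi>1 p1 \<Xi>2 p2 i \<zeta> *\<^sub>R a i)"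


section \<open>The polar parametrization\<close>

definition initial_knots :: "nat \<Rightarrow> nat \<Rightarrow> real list" where
  "initial_knots M p = replicate (p + 1) 0
     @ concat (map (\<lambda>k. replicate p (real k / real M)) [1..<M]) @ replicate (p + 1) 1"

definition initial_index :: "nat \<Rightarrow> nat \<Rightarrow> (nat \<times> nat) set" where
  "initial_index M p = tensor_index [0, 0, 1, 1] 1 (initial_knots M p) p"

definition weight_fun :: "nat \<Rightarrow> nat \<Rightarrow> (nat \<times> nat \<Rightarrow> real) \<Rightarrow> real^2 \<Rightarrow> real" where
  "weight_fun M p w = tensor_spline [0, 0, 1, 1] 1 (initial_knots M p) p w"

definition nurbs_map ::
  "nat \<Rightarrow> nat \<Rightarrow> (nat \<times> nat \<Rightarrow> real) \<Rightarrow> (nat \<times> nat \<Rightarrow> real^2) \<Rightarrow> real^2 \<Rightarrow> real^2" where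
  "nurbs_map M p w c \<zeta> =
     (1 / weight_fun M p w \<zeta>) *\<^sub>R
       tensor_spline [0, 0, 1, 1] 1 (initial_knots M p) p (\<lambda>i. w i *\<^sub>R c i) \<zeta>"

text \<open>The map is only piecewise smooth: its Jacobian is considered off the
  lines \<open>\<zeta>\<^sub>2 = k/M\<close>.\<close>

definition polar_jacobian :: "nat \<Rightarrow> (real^2 \<Rightarrow> real^2) \<Rightarrow> bool" where
  "polar_jacobian M F \<longleftrightarrow>
     (\<exists>C1>0. \<exists>C2>0. \<forall>\<zeta>\<in>box 0 1. (\<forall>k\<le>M. \<zeta>$2 \<noteq> real k / real M) \<longrightarrow>
        C1 * \<zeta>$1 \<le> det (matrix (frechet_derivative F (at \<zeta>))) \<and>
        det (matrix (frechet_derivative F (at \<zeta>))) \<le> C2 * \<zeta>$1)"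

text \<open>Since \<open>F(\<zeta>) = \<zeta>\<^sub>1 F\<^sup>(\<^sup>2\<^sup>)(\<zeta>\<^sub>2)\<close> is conical, the domain coincides with a sector near the corner;
  for \<open>\<omega> = 2\<pi>\<close> this is a disc without one radius.\<close>

definition corner_with_angle :: "(real^2) set \<Rightarrow> real^2 \<Rightarrow> real \<Rightarrow> bool" where
  "corner_with_angle \<Omega> P \<omega> \<longleftrightarrow> 0 < \<omega> \<and> \<omega> \<le> 2 * pi \<and>
     (\<exists>\<delta>>0. \<exists>\<theta>0. \<Omega> \<inter> ball P \<delta> =
        {P + r *\<^sub>R vector [cos \<theta>, sin \<theta>] | r \<theta>. 0 < r \<and> r < \<delta> \<and> \<theta>0 < \<theta> \<and> \<theta> < \<theta>0 + \<omega>})"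


section \<open>Function spaces on the physical domain\<close>

text \<open>Functions on \<open>\<Omega>\<close> are total functions whose values outside \<open>\<Omega>\<close> are irrelevant. The pull-back
  of \<open>v\<close> to the closed square is the continuous extension of \<open>v \<circ> F\<close> from the open square. Thus
  the two sides of a slit are distinguished, and \<open>v(P)\<close> is the common value on the edge \<open>\<zeta>\<^sub>1 = 0\<close>.\<close>

definition pullback :: "(real^2 \<Rightarrow> real^2) \<Rightarrow> (real^2 \<Rightarrow> real) \<Rightarrow> real^2 \<Rightarrow> real" where
  "pullback F v \<zeta> = Lim (at \<zeta> within box 0 1) (v \<circ> F)"

definition continuous_closure :: "(real^2 \<Rightarrow> real^2) \<Rightarrow> (real^2 \<Rightarrow> real) set" where
  "continuous_closure F =
     {v. \<exists>u. continuous_on (cbox 0 1) u \<and> (\<forall>\<zeta>\<in>box 0 1. u \<zeta> = v (F \<zeta>)) \<and>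
             (\<exists>vP. \<forall>t\<in>{0..1}. u (vector [0, t]) = vP)}"

definition L2 :: "(real^2) set \<Rightarrow> (real^2 \<Rightarrow> real) set" where
  "L2 \<Omega> = {v. set_borel_measurable lebesgue \<Omega> v \<and> set_integrable lebesgue \<Omega> (\<lambda>x. (v x)\<^sup>2)}"

definition partial_deriv :: "2 \<Rightarrow> (real^2 \<Rightarrow> real) \<Rightarrow> real^2 \<Rightarrow> real" where
  "partial_deriv k f x = frechet_derivative f (at x) (axis k 1)"

definition test_functions :: "(real^2) set \<Rightarrow> (real^2 \<Rightarrow> real) set" where
  "test_functions \<Omega> =
     {\<phi>. (\<forall>ks x. foldr partial_deriv ks \<phi> differentiable (at x)) \<and>
         (\<exists>K. compact K \<and> K \<subseteq> \<Omega> \<and> (\<forall>x. x \<notin> K \<longrightarrow> \<phi> x = 0))}"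

definition weak_partial_deriv ::
  "(real^2) set \<Rightarrow> 2 \<Rightarrow> (real^2 \<Rightarrow> real) \<Rightarrow> (real^2 \<Rightarrow> real) \<Rightarrow> bool" where
  "weak_partial_deriv \<Omega> k v g \<longleftrightarrow>
     (\<forall>\<phi>\<in>test_functions \<Omega>.
        (LINT x:\<Omega>|lebesgue. v x * partial_deriv k \<phi> x) = - (LINT x:\<Omega>|lebesgue. g x * \<phi> x))"

definition H1 :: "(real^2) set \<Rightarrow> (real^2 \<Rightarrow> real) set" where
  "H1 \<Omega> = {v \<in> L2 \<Omega>. \<forall>k. \<exists>g\<in>L2 \<Omega>. weak_partial_deriv \<Omega> k v g}"


section \<open>Graded NURBS spaces\<close>

definition graded_knots :: "nat \<Rightarrow> nat \<Rightarrow> real \<Rightarrow> real list" where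
  "graded_knots N p \<mu> = replicate (p + 1) 0
     @ map (\<lambda>j. (real (j - 1) * (1 / real (N - 1))) powr (1 / \<mu>)) [2..<N] @ replicate (p + 1) 1"

text \<open>The \<open>p\<close>-open knot vectors with breakpoints \<open>(j - 1)/(N - 1)\<close> that arise from
  \<^term>\<open>initial_knots M p0\<close> by elevating the degree to \<open>p\<close> and inserting knots.\<close>

definition refined_knots :: "nat \<Rightarrow> nat \<Rightarrow> nat \<Rightarrow> real list \<Rightarrow> bool" where
  "refined_knots M N p \<Xi> \<longleftrightarrow> sorted \<Xi> \<and>
     set \<Xi> = {real (j - 1) * (1 / real (N - 1)) | j. 1 \<le> j \<and> j \<le> N} \<and>
     count_list \<Xi> 0 = p + 1 \<and> count_list \<Xi> 1 = p + 1 \<and>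
     (\<forall>x\<in>set \<Xi> - {0, 1}. 1 \<le> count_list \<Xi> x \<and> count_list \<Xi> x \<le> p) \<and>
     (\<forall>k\<in>{1..<M}. count_list \<Xi> (real k / real M) = p)"

definition nurbs_basis ::
  "real list \<Rightarrow> nat \<Rightarrow> real list \<Rightarrow> nat \<Rightarrow> (real^2 \<Rightarrow> real) \<Rightarrow> (nat \<times> nat \<Rightarrow> real)
     \<Rightarrow> nat \<times> nat \<Rightarrow> real^2 \<Rightarrow> real" where
  "nurbs_basis \<Xi>1 p1 \<Xi>2 p2 W w i \<zeta> = w i * tensor_bspline \<Xi>1 p1 \<Xi>2 p2 i \<zeta> / W \<zeta>"

definition Vh ::
  "real list \<Rightarrow> nat \<Rightarrow> real list \<Rightarrow> nat \<Rightarrow> (real^2 \<Rightarrow> real) \<Rightarrow> (nat \<times> nat \<Rightarrow> real)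
     \<Rightarrow> (real^2 \<Rightarrow> real^2) \<Rightarrow> (real^2) set \<Rightarrow> (real^2 \<Rightarrow> real) set" where
  "Vh \<Xi>1 p1 \<Xi>2 p2 W w F \<Omega> =
     {v. \<exists>a. \<forall>x\<in>\<Omega>. v x = (\<Sum>i\<in>tensor_index \<Xi>1 p1 \<Xi>2 p2.
            a i * nurbs_basis \<Xi>1 p1 \<Xi>2 p2 W w i (inv_into (box 0 1) F x))}"

definition Vh_pol ::
  "real list \<Rightarrow> nat \<Rightarrow> real list \<Rightarrow> nat \<Rightarrow> (real^2 \<Rightarrow> real) \<Rightarrow> (nat \<times> nat \<Rightarrow> real)
     \<Rightarrow> (real^2 \<Rightarrow> real^2) \<Rightarrow> (real^2) set \<Rightarrow> (real^2 \<Rightarrow> real) set" where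
  "Vh_pol \<Xi>1 p1 \<Xi>2 p2 W w F \<Omega> = Vh \<Xi>1 p1 \<Xi>2 p2 W w F \<Omega> \<inter> H1 \<Omega>"


section \<open>The quasi-interpolant\<close>

definition perfect_knots :: "nat \<Rightarrow> real list" where
  "perfect_knots p = map (\<lambda>k. cos (real (p + 1 - k) * pi / real (p + 1))) [0..<p + 2]"

definition perfect_bspline :: "nat \<Rightarrow> real \<Rightarrow> real" where
  "perfect_bspline p y =
     bspline (perfect_knots p) 1 p y / integral {-1..1} (bspline (perfect_knots p) 1 p)"

definition transition_fun :: "nat \<Rightarrow> real \<Rightarrow> real" where
  "transition_fun p x = integral {-1..x} (perfect_bspline p)"

definition dual_psi :: "real list \<Rightarrow> nat \<Rightarrow> nat \<Rightarrow> real \<Rightarrow> real" where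
  "dual_psi \<Xi> p i t =
     transition_fun p ((2 * t - knot \<Xi> i - knot \<Xi> (i + p + 1)) / (knot \<Xi> (i + p + 1) - knot \<Xi> i))
     * ((\<Prod>j=1..p. t - knot \<Xi> (i + j)) / fact p)"

text \<open>The transition function is of class \<open>C\<^sup>p\<close> with piecewise continuous derivative of order
  \<open>p + 1\<close>; \<^const>\<open>deriv\<close> is unspecified at the finitely many remaining points, which do not affect
  the integral.\<close>

definition dual_integrand :: "real list \<Rightarrow> nat \<Rightarrow> nat \<Rightarrow> (real \<Rightarrow> real) \<Rightarrow> real \<Rightarrow> real" where
  "dual_integrand \<Xi> p i w t = w t * (deriv ^^ (p + 1)) (dual_psi \<Xi> p i) t"

definition dual_functional :: "real list \<Rightarrow> nat \<Rightarrow> nat \<Rightarrow> (real \<Rightarrow> real) \<Rightarrow> real" where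
  "dual_functional \<Xi> p i w = integral {knot \<Xi> i..knot \<Xi> (i + p + 1)} (dual_integrand \<Xi> p i w)"

definition dual_defined :: "real list \<Rightarrow> nat \<Rightarrow> nat \<Rightarrow> (real \<Rightarrow> real) \<Rightarrow> bool" where
  "dual_defined \<Xi> p i w \<longleftrightarrow> dual_integrand \<Xi> p i w integrable_on {knot \<Xi> i..knot \<Xi> (i + p + 1)}"

definition polar_functional :: "real list \<Rightarrow> nat \<Rightarrow> nat \<Rightarrow> (real \<Rightarrow> real) \<Rightarrow> real" where
  "polar_functional \<Xi> p i w = (if i = 1 then w 0 else dual_functional \<Xi> p i w)"

definition tensor_functional ::
  "real list \<Rightarrow> nat \<Rightarrow> real list \<Rightarrow> nat \<Rightarrow> nat \<times> nat \<Rightarrow> (real^2 \<Rightarrow> real) \<Rightarrow> real" where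
  "tensor_functional \<Xi>1 p1 \<Xi>2 p2 i w =
     polar_functional \<Xi>1 p1 (fst i) (\<lambda>s. dual_functional \<Xi>2 p2 (snd i) (\<lambda>t. w (vector [s, t])))"

text \<open>Existence of the integrals in \<^const>\<open>tensor_functional\<close>, as \<^const>\<open>integral\<close> is total.\<close>

definition tensor_defined ::
  "real list \<Rightarrow> nat \<Rightarrow> real list \<Rightarrow> nat \<Rightarrow> nat \<times> nat \<Rightarrow> (real^2 \<Rightarrow> real) \<Rightarrow> bool" where
  "tensor_defined \<Xi>1 p1 \<Xi>2 p2 i w \<longleftrightarrow>
     (\<forall>s\<in>{0..1}. dual_defined \<Xi>2 p2 (snd i) (\<lambda>t. w (vector [s, t]))) \<and>
     (fst i \<noteq> 1 \<longrightarrow>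
        dual_defined \<Xi>1 p1 (fst i) (\<lambda>s. dual_functional \<Xi>2 p2 (snd i) (\<lambda>t. w (vector [s, t]))))"

definition Pi_pol ::
  "real list \<Rightarrow> nat \<Rightarrow> real list \<Rightarrow> nat \<Rightarrow> (real^2 \<Rightarrow> real) \<Rightarrow> real^2 \<Rightarrow> real" where
  "Pi_pol \<Xi>1 p1 \<Xi>2 p2 w \<zeta> =
     (\<Sum>i\<in>tensor_index \<Xi>1 p1 \<Xi>2 p2.
        tensor_functional \<Xi>1 p1 \<Xi>2 p2 i w * tensor_bspline \<Xi>1 p1 \<Xi>2 p2 i \<zeta>)"

definition Pi_Vh_pol ::
  "real list \<Rightarrow> nat \<Rightarrow> real list \<Rightarrow> nat \<Rightarrow> (real^2 \<Rightarrow> real) \<Rightarrow> (real^2 \<Rightarrow> real^2)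
     \<Rightarrow> (real^2 \<Rightarrow> real) \<Rightarrow> real^2 \<Rightarrow> real" where
  "Pi_Vh_pol \<Xi>1 p1 \<Xi>2 p2 W F v =
     (\<lambda>\<zeta>. Pi_pol \<Xi>1 p1 \<Xi>2 p2 (\<lambda>\<eta>. W \<eta> * pullback F v \<eta>) \<zeta> / W \<zeta>) \<circ> inv_into (box 0 1) F"

end

theory Submission
  imports Defs
begin

text \<open>
  On a single knot interval the B-splines are polynomials, and the dual functional of Schumaker's
  quasi-interpolant is an integral against the \<open>(p + 1)\<close>-st derivative of \<open>g y\<^sub>i\<close>, where
  \<open>y\<^sub>i = (t - \<xi>\<^bsub>i+1\<^esub>) \<cdots> (t - \<xi>\<^bsub>i+p\<^esub>) / p!\<close>. Integration by parts leaves, at the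
  right end of the support, the de Boor--Fix pairing
  \<open>\<Sum>\<^sub>m (-1)\<^sup>m f\<^sup>(\<^sup>m\<^sup>) y\<^sub>i\<^sup>(\<^sup>p\<^sup>-\<^sup>m\<^sup>)\<close>. Marsden's identity and the linear
  independence of the \<open>y\<^sub>i\<close> of one knot interval show that this pairing is biorthogonal on every
  interval; this gives the duality, and, comparing two neighbouring intervals, also the smoothness of
  B-splines at knots.

  A NURBS function in \<open>H\<^sup>1\<close> is constant on the edge that is collapsed to the corner: the blow-up
  \<open>v (\<epsilon> x)\<close> converges to a function that is homogeneous of degree 0 and, because the Dirichlet
  integral is scale invariant in the plane, has vanishing weak derivatives. Hence \<open>V\<^sub>h \<inter> H\<^sup>1\<close> consists
  of continuous functions and the biorthogonality reproduces them. Conversely, the interpolant of a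
  continuous function is a constant plus terms vanishing linearly at the corner; in the physical
  domain it is locally Lipschitz with a uniform constant and differentiable almost everywhere, and
  difference quotients identify its weak derivatives.
\<close>

section \<open>Polynomial pieces of B-splines\<close>

text \<open>\<Omega> need not be a Lipschitz domain: close points may lie on opposite sides of a
  slit. Splines are therefore only locally Lipschitz in \<Omega>, with one constant for all points;
  this suffices since test functions have compact support. The constant comes from a match of two
  weights. A product f(\<zeta>1) r(\<zeta>2) of Lipschitz functions with f(0) = 0 changes by at most
  a multiple of |\<zeta>1 - \<eta>1| + \<zeta>1 |\<zeta>2 - \<eta>2|, and the bound det J_F \<ge> c1
  \<zeta>1 lets |F \<zeta> - F \<eta>| control exactly this quantity while \<zeta>2 and \<eta>2 are
  close. Point evaluation in the first direction is what produces such products: on the collapsed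
  edge W (v o F) is v(P) W, so the coefficients with i1 = 1 are v(P) w_i, those of the constant
  v(P), and all other B-splines vanish at \<zeta>1 = 0. In the blow-up, area scales like
  \<epsilon>^2 and a derivative like 1/\<epsilon>. Young's inequality with a free parameter \<tau>
  makes the powers of \<epsilon> cancel; what remains is the energy of v in a shrinking ball and a
  term of order 1/\<tau>.\<close>

abbreviation lin :: "real \<Rightarrow> real poly" where
  "lin c \<equiv> [:- c, 1:]"

text \<open>The polynomial that the \<open>k\<close>-th B-spline of degree \<open>p\<close> agrees with between \<open>\<xi>\<^sub>j\<close> and \<open>\<xi>\<^bsub>j+1\<^esub>\<close>.
  Indexing the knots by all integers avoids boundary cases; \<open>1 / 0 = 0\<close> serves repeated knots.\<close>

fun piece :: "(int \<Rightarrow> real) \<Rightarrow> int \<Rightarrow> nat \<Rightarrow> int \<Rightarrow> real poly" where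
  "piece \<xi> j 0 k = (if k = j then 1 else 0)"
| "piece \<xi> j (Suc p) k =
     smult (1 / (\<xi> (k + int p + 1) - \<xi> k)) (lin (\<xi> k) * piece \<xi> j p k)
     + smult (1 / (\<xi> (k + int p + 2) - \<xi> (k + 1)))
         ([:\<xi> (k + int p + 2), -1:] * piece \<xi> j p (k + 1))"

lemma piece_eq_0: "k > j \<or> k + int p < j \<Longrightarrow> piece \<xi> j p k = 0"
  by (induction p arbitrary: k) auto

lemma degree_piece: "degree (piece \<xi> j p k) \<le> p"
proof (induction p arbitrary: k)
  case (Suc p)
  have *: "degree (smult a ([:b, c:] * piece \<xi> j p m)) \<le> Suc p" for a b c m
  proof -
    have "degree (smult a ([:b, c:] * piece \<xi> j p m)) \<le> degree ([:b, c:] * piece \<xi> j p m)"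
      by (rule degree_smult_le)
    also have "\<dots> \<le> degree [:b, c:] + degree (piece \<xi> j p m)"
      by (rule degree_mult_le)
    also have "\<dots> \<le> Suc p"
      using Suc[of m] by auto
    finally show ?thesis .
  qed
  show ?case
    unfolding piece.simps by (intro degree_add_le *)
qed simp

lemma piece_nonneg:
  assumes "mono \<xi>" "\<xi> j \<le> t" "t \<le> \<xi> (j + 1)"
  shows "poly (piece \<xi> j p k) t \<ge> 0"
proof (induction p arbitrary: k)
  case (Suc p)
  have 1: "(t - \<xi> k) / (\<xi> (k + int p + 1) - \<xi> k) * poly (piece \<xi> j p k) t \<ge> 0"
  proof (cases "k \<le> j")
    case True
    have "\<xi> k \<le> \<xi> j" "\<xi> k \<le> \<xi> (k + int p + 1)"
      using True by (auto intro!: monoD[OF assms(1)])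
    then show ?thesis using assms Suc[of k] by simp
  qed (simp add: piece_eq_0)
  have 2: "(\<xi> (k + int p + 2) - t) / (\<xi> (k + int p + 2) - \<xi> (k + 1)) * poly (piece \<xi> j p (k + 1)) t \<ge> 0"
  proof (cases "j \<le> k + 1 + int p")
    case True
    have "\<xi> (j + 1) \<le> \<xi> (k + int p + 2)" "\<xi> (k + 1) \<le> \<xi> (k + int p + 2)"
      using True by (auto intro!: monoD[OF assms(1)])
    then show ?thesis using assms Suc[of "k + 1"] by simp
  qed (simp add: piece_eq_0)
  show ?case
    using add_nonneg_nonneg[OF 1 2] by (simp add: divide_inverse algebra_simps)
qed simp

text \<open>Up to a factor p!, the dual polynomial of the \<open>k\<close>-th B-spline: its roots
  are the p inner knots of the support. It is also the coefficient of that B-spline in Marsden's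
  identity.\<close>

definition knot_poly :: "(int \<Rightarrow> real) \<Rightarrow> nat \<Rightarrow> int \<Rightarrow> real poly" where
  "knot_poly \<xi> p k = (\<Prod>i = 1..p. lin (\<xi> (k + int i)))"

lemma knot_poly_Suc: "knot_poly \<xi> (Suc p) k = knot_poly \<xi> p k * lin (\<xi> (k + int p + 1))"
  by (simp add: knot_poly_def algebra_simps del: mult_pCons_right mult_pCons_left)

text \<open>Together with \<open>knot_poly_Suc\<close> this exhibits
  \<open>knot_poly \<xi> p k\<close> as a common factor of two neighbours of degree p + 1, which
  makes the recursion in Marsden's identity collapse.\<close>

lemma knot_poly_Suc': "knot_poly \<xi> (Suc p) (k - 1) = lin (\<xi> k) * knot_poly \<xi> p k"
proof -
  have "knot_poly \<xi> (Suc p) (k - 1) = (\<Prod>i = 0..p. lin (\<xi> (k - 1 + int (Suc i))))"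
    unfolding knot_poly_def
    using prod.shift_bounds_cl_Suc_ivl[of "\<lambda>i. lin (\<xi> (k - 1 + int i))" 0 p] by simp
  also have "\<dots> = lin (\<xi> k) * (\<Prod>i = Suc 0..p. lin (\<xi> (k + int i)))"
    by (subst prod.atLeast_Suc_atMost) (simp_all del: mult_pCons_right mult_pCons_left)
  finally show ?thesis by (simp add: knot_poly_def del: mult_pCons_right mult_pCons_left)
qed

lemma degree_knot_poly: "degree (knot_poly \<xi> p k) = p"
  by (simp add: knot_poly_def degree_prod_eq_sum_degree)

text \<open>Summation by parts in the Cox--de Boor recursion: shifting the index in its second term
  moves the recursion from the B-splines to the coefficients. The terms at both ends drop out
  because their pieces are zero on this interval.\<close>

lemma marsden_aux:
  fixes h :: "int \<Rightarrow> real"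
  assumes "mono \<xi>" "\<xi> j < \<xi> (j + 1)"
  shows "(\<Sum>k\<in>{j - int (Suc p)..j}. h k * poly (piece \<xi> j (Suc p) k) t)
    = (\<Sum>k\<in>{j - int p..j}. poly (piece \<xi> j p k) t / (\<xi> (k + int p + 1) - \<xi> k)
        * (h k * (t - \<xi> k) + h (k - 1) * (\<xi> (k + int p + 1) - t)))"
proof -
  define d where "d k = \<xi> (k + int p + 1) - \<xi> k" for k
  define P where "P k = poly (piece \<xi> j p k) t" for k
  have dist: "a / e * q + b / e * q = q / e * (a + b)" for a b e q :: real
    by (simp add: divide_inverse algebra_simps)
  have "(\<Sum>k\<in>{j - int (Suc p)..j}. h k * poly (piece \<xi> j (Suc p) k) t)
    = (\<Sum>k\<in>{j - int (Suc p)..j}. h k * (t - \<xi> k) / d k * P k)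
    + (\<Sum>k\<in>{j - int (Suc p)..j}. h k * (\<xi> (k + int p + 2) - t) / d (k + 1) * P (k + 1))"
    unfolding sum.distrib[symmetric] d_def P_def
    by (intro sum.cong) (simp_all add: field_simps)
  also have "(\<Sum>k\<in>{j - int (Suc p)..j}. h k * (t - \<xi> k) / d k * P k)
    = (\<Sum>k\<in>{j - int p..j}. h k * (t - \<xi> k) / d k * P k)"
    by (intro sum.mono_neutral_right) (auto simp: P_def piece_eq_0)
  also have "(\<Sum>k\<in>{j - int (Suc p)..j}. h k * (\<xi> (k + int p + 2) - t) / d (k + 1) * P (k + 1))
    = (\<Sum>k\<in>{j - int p..j + 1}. h (k - 1) * (\<xi> (k + int p + 1) - t) / d k * P k)"
    by (rule sum.reindex_bij_witness[where i = "\<lambda>k. k - 1" and j = "\<lambda>k. k + 1"])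
       (auto simp: algebra_simps)
  also have "\<dots> = (\<Sum>k\<in>{j - int p..j}. h (k - 1) * (\<xi> (k + int p + 1) - t) / d k * P k)"
    by (intro sum.mono_neutral_right) (auto simp: P_def piece_eq_0)
  finally show ?thesis
    unfolding sum.distrib[symmetric] d_def[symmetric] P_def[symmetric] dist .
qed

lemma knot_gap:
  assumes "mono \<xi>" "\<xi> j < \<xi> (j + 1)" "k \<in> {j - int p..j}"
  shows "\<xi> (k + int p + 1) - \<xi> k > (0::real)"
proof -
  have "\<xi> k \<le> \<xi> j" "\<xi> (j + 1) \<le> \<xi> (k + int p + 1)"
    using assms(3) by (auto intro!: monoD[OF assms(1)])
  then show ?thesis using assms(2) by simp
qed

text \<open>After removing the common factor, the new coefficient interpolates s - \<xi> linearly
  between the two ends of the support. At t this gives s - t, one further factor for each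
  degree.\<close>

lemma marsden_identity:
  assumes "mono \<xi>" "\<xi> j < \<xi> (j + 1)"
  shows "(\<Sum>k\<in>{j - int p..j}. poly (knot_poly \<xi> p k) s * poly (piece \<xi> j p k) t) = (s - t) ^ p"
proof (induction p)
  case 0
  then show ?case by (simp add: knot_poly_def)
next
  case (Suc p)
  have *: "poly (piece \<xi> j p k) t / (\<xi> (k + int p + 1) - \<xi> k)
        * (poly (knot_poly \<xi> (Suc p) k) s * (t - \<xi> k)
           + poly (knot_poly \<xi> (Suc p) (k - 1)) s * (\<xi> (k + int p + 1) - t))
      = (s - t) * (poly (knot_poly \<xi> p k) s * poly (piece \<xi> j p k) t)"
    if k: "k \<in> {j - int p..j}" for k
  proof -
    have "poly (knot_poly \<xi> (Suc p) k) s * (t - \<xi> k)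
           + poly (knot_poly \<xi> (Suc p) (k - 1)) s * (\<xi> (k + int p + 1) - t)
        = (s - t) * (\<xi> (k + int p + 1) - \<xi> k) * poly (knot_poly \<xi> p k) s"
      unfolding knot_poly_Suc' knot_poly_Suc[of _ _ k] poly_mult by (simp add: algebra_simps)
    moreover have "P / d * ((s - t) * d * K) = (s - t) * (K * P)" if "d > 0" for P d K :: real
      using that by simp
    ultimately show ?thesis
      using knot_gap[OF assms k] by metis
  qed
  show ?case
    unfolding marsden_aux[OF assms]
    using * Suc by (simp add: sum_distrib_left[symmetric])
qed

lemma piece_partition_of_unity:
  assumes "mono \<xi>" "\<xi> j < \<xi> (j + 1)"
  shows "(\<Sum>k\<in>{j - int p..j}. poly (piece \<xi> j p k) t) = 1"
proof (induction p)
  case (Suc p)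
  have *: "poly (piece \<xi> j p k) t / (\<xi> (k + int p + 1) - \<xi> k)
        * (1 * (t - \<xi> k) + 1 * (\<xi> (k + int p + 1) - t)) = poly (piece \<xi> j p k) t"
    if k: "k \<in> {j - int p..j}" for k
    using knot_gap[OF assms k] by (simp add: field_simps)
  have "(\<Sum>k\<in>{j - int (Suc p)..j}. 1 * poly (piece \<xi> j (Suc p) k) t) = 1"
    unfolding marsden_aux[OF assms] using * Suc by simp
  then show ?case by simp
qed simp

section \<open>The de Boor--Fix pairing\<close>

lemma smult_sum_right: "smult c (\<Sum>i\<in>A. f i) = (\<Sum>i\<in>A. smult c (f i))"
  by (induction A rule: infinite_finite_induct) (simp_all add: smult_add_right)

definition dbf :: "nat \<Rightarrow> real poly \<Rightarrow> real poly \<Rightarrow> real poly" where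
  "dbf p f g = (\<Sum>m\<le>p. smult ((-1) ^ m) ((pderiv ^^ m) f * (pderiv ^^ (p - m)) g))"

text \<open>The derivative telescopes, so \<open>dbf\<close> collects the boundary terms of p + 1
  integrations by parts. If f has degree at most p, the second summand vanishes and
  \<open>dbf p f g\<close> is a primitive of f times the derivative of g of order p + 1.\<close>

lemma pderiv_dbf:
  "pderiv (dbf p f g) = f * (pderiv ^^ Suc p) g + smult ((-1) ^ p) ((pderiv ^^ Suc p) f * g)"
proof -
  define T where "T m = smult ((-1) ^ m) ((pderiv ^^ m) f * (pderiv ^^ (Suc p - m)) g)" for m
  have "pderiv (dbf p f g) = (\<Sum>m\<le>p. T m - T (Suc m))"
    unfolding dbf_def higher_pderiv_sum[of 1, simplified]
  proof (intro sum.cong refl)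
    fix m assume "m \<in> {..p}"
    then have "Suc p - m = Suc (p - m)" by auto
    then show "pderiv (smult ((-1) ^ m) ((pderiv ^^ m) f * (pderiv ^^ (p - m)) g)) = T m - T (Suc m)"
      by (simp add: T_def pderiv_smult pderiv_mult smult_add_right mult.commute)
  qed
  also have "\<dots> = T 0 - T (Suc p)"
    by (induction p) (simp_all)
  finally show ?thesis by (simp add: T_def)
qed

lemma higher_pderiv_eq_0: "degree (f :: real poly) < n \<Longrightarrow> (pderiv ^^ n) f = 0"
  by (intro poly_eqI) (simp add: coeff_higher_pderiv coeff_eq_0)

text \<open>By degree both ends of the telescoping sum vanish, so the pairing may be evaluated at
  any convenient point.\<close>

lemma dbf_const:
  assumes "degree f \<le> p" "degree g \<le> p"
  shows "poly (dbf p f g) s = poly (dbf p f g) t"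
proof -
  have "pderiv (dbf p f g) = 0"
    unfolding pderiv_dbf using assms by (simp add: higher_pderiv_eq_0 del: funpow.simps)
  then have "degree (dbf p f g) = 0" by (simp add: pderiv_eq_0_iff)
  then obtain c where "dbf p f g = [:c:]" by (rule degree_eq_zeroE)
  then show ?thesis by simp
qed

lemma higher_pderiv_diff: "(pderiv ^^ n) (f - g :: real poly) = (pderiv ^^ n) f - (pderiv ^^ n) g"
  by (induction n arbitrary: f g) (simp_all add: pderiv_diff)

lemma dbf_diff_left: "dbf p (f - f') g = dbf p f g - dbf p f' g"
  by (simp add: dbf_def higher_pderiv_diff algebra_simps sum_subtractf smult_diff_right)

lemma dbf_diff_right: "dbf p f (g - g') = dbf p f g - dbf p f g'"
  by (simp add: dbf_def higher_pderiv_diff algebra_simps sum_subtractf smult_diff_right)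

lemma dbf_smult_left: "dbf p (smult c f) g = smult c (dbf p f g)"
  by (simp add: dbf_def higher_pderiv_smult smult_sum_right mult.commute)

lemma dbf_smult_right: "dbf p f (smult c g) = smult c (dbf p f g)"
  by (simp add: dbf_def higher_pderiv_smult smult_sum_right mult.commute)

lemma dbf_0_left [simp]: "dbf p 0 g = 0"
  by (simp add: dbf_def)

lemma dbf_sum_left: "dbf p (\<Sum>i\<in>A. f i) g = (\<Sum>i\<in>A. dbf p (f i) g)"
  unfolding dbf_def higher_pderiv_sum sum_distrib_right smult_sum_right by (rule sum.swap)

lemma dbf_sum_right: "dbf p f (\<Sum>i\<in>A. g i) = (\<Sum>i\<in>A. dbf p f (g i))"
  unfolding dbf_def higher_pderiv_sum sum_distrib_left smult_sum_right by (rule sum.swap)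

lemma lin_power_dvd_imp_higher_pderiv_0:
  "lin c ^ q dvd f \<Longrightarrow> m < q \<Longrightarrow> poly ((pderiv ^^ m) f) c = 0"
proof (induction m arbitrary: f q)
  case 0
  then obtain g where "f = lin c ^ q * g" by (auto elim: dvdE)
  with 0 show ?case by (simp add: poly_power)
next
  case (Suc m)
  obtain g where f: "f = lin c ^ q * g" using Suc.prems(1) by (rule dvdE)
  obtain q' where q: "q = Suc q'" using Suc.prems(2) by (cases q) auto
  have "pderiv f = lin c ^ q' * (lin c * pderiv g + smult (real (Suc q')) g)"
    unfolding f q pderiv_mult pderiv_power_Suc
    by (simp add: pderiv_pCons algebra_simps one_pCons[symmetric] del: mult_pCons_left mult_pCons_right)
  then have "poly ((pderiv ^^ m) (pderiv f)) c = 0"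
    using Suc.prems q by (intro Suc.IH[of q']) auto
  then show ?case by (simp add: funpow_swap1)
qed

lemma lin_power_dvd_by_pderiv:
  assumes "lin c ^ q dvd pderiv f" "poly f c = 0"
  shows "lin c ^ Suc q dvd f"
proof (cases "pderiv f = 0")
  case True
  then obtain h where "f = [:h:]" using pderiv_iszero by blast
  then show ?thesis using assms(2) by simp
next
  case False
  have "order c f \<noteq> 0" using assms(2) False by (metis order_root pderiv_0)
  then have "order c f = Suc (order c (pderiv f))" using False assms(2) by (intro order_pderiv) auto
  moreover have "q \<le> order c (pderiv f)"
    using assms(1) False order_divides by blast
  ultimately show ?thesis using order_divides[of c "Suc q" f] by linarith
qed

lemma lin_power_dvdI:
  "(\<And>m. m < q \<Longrightarrow> poly ((pderiv ^^ m) f) c = 0) \<Longrightarrow> lin c ^ q dvd f"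
proof (induction q arbitrary: f)
  case (Suc q)
  have "lin c ^ q dvd pderiv f"
    using Suc.prems[of "Suc m" for m] by (intro Suc.IH) (simp add: funpow_swap1)
  moreover have "poly f c = 0" using Suc.prems[of 0] by simp
  ultimately show ?case by (rule lin_power_dvd_by_pderiv)
qed simp

text \<open>The orders of differentiation in each term add up to p < q + r, so one of the two
  factors still vanishes at c. All cancellations at knots and at the ends of supports are instances
  of this.\<close>

lemma poly_dbf_lin_dvd:
  assumes "lin c ^ q dvd f" "lin c ^ r dvd g" "q + r > p"
  shows "poly (dbf p f g) c = 0"
  unfolding dbf_def poly_sum
proof (intro sum.neutral ballI)
  fix m assume "m \<in> {..p}"
  then have "m < q \<or> p - m < r" using assms(3) by auto
  then show "poly (smult ((-1) ^ m) ((pderiv ^^ m) f * (pderiv ^^ (p - m)) g)) c = 0"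
    using assms(1,2) lin_power_dvd_imp_higher_pderiv_0 by auto
qed

lemma higher_pderiv_lin_power: "m \<le> n \<Longrightarrow> \<exists>a. a \<noteq> 0 \<and> (pderiv ^^ m) (lin c ^ n) = smult a (lin c ^ (n - m))"
proof (induction m)
  case 0
  show ?case by (intro exI[of _ 1]) simp
next
  case (Suc m)
  then obtain a where a: "a \<noteq> 0" "(pderiv ^^ m) (lin c ^ n) = smult a (lin c ^ (n - m))" by auto
  obtain l where l: "n - m = Suc l" using Suc.prems by (cases "n - m") auto
  have "(pderiv ^^ Suc m) (lin c ^ n) = smult (a * real (Suc l)) (lin c ^ l)"
    using a l by (simp add: pderiv_smult pderiv_power_Suc pderiv_pCons del: power_Suc)
  moreover have "l = n - Suc m" using l by simp
  ultimately show ?case using a by (intro exI[of _ "a * real (Suc l)"]) simp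
qed

text \<open>Products of linear factors that trade the roots \<open>a\<close> one by one for the roots \<open>b\<close>; the knot
  polynomials belonging to one knot interval are of this form.\<close>

definition exchange_poly :: "(nat \<Rightarrow> real) \<Rightarrow> (nat \<Rightarrow> real) \<Rightarrow> nat \<Rightarrow> nat \<Rightarrow> real poly" where
  "exchange_poly a b d m = (\<Prod>i<d - m. lin (a i)) * (\<Prod>i<m. lin (b i))"

lemma exchange_poly_Suc:
  "exchange_poly a b (Suc d) (Suc m) = lin (b 0) * exchange_poly a (\<lambda>i. b (Suc i)) d m"
  unfolding exchange_poly_def prod.lessThan_Suc_shift
  by (simp add: ac_simps del: mult_pCons_left mult_pCons_right)

lemma poly_exchange_0_nonzero:
  assumes "\<And>i. a i \<noteq> b 0"
  shows "poly (exchange_poly a b d 0) (b 0) \<noteq> 0"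
  using assms[symmetric] by (simp add: exchange_poly_def poly_prod)

text \<open>All members with m > 0 contain the factor \<open>lin (b 0)\<close>, while the member m =
  0 does not vanish at \<open>b 0\<close>. Subtracting a multiple of the latter leaves a multiple of
  \<open>lin (b 0)\<close>, and the induction continues with the roots b shifted by one.\<close>

lemma exchange_poly_span:
  assumes "\<And>i l. a i \<noteq> b l" "degree f \<le> d"
  shows "\<exists>c. f = (\<Sum>m\<le>d. smult (c m) (exchange_poly a b d m))"
  using assms
proof (induction d arbitrary: b f)
  case 0
  then obtain h where "f = [:h:]" by (metis degree_eq_zeroE le_zero_eq)
  then have "f = (\<Sum>m\<le>0. smult h (exchange_poly a b 0 m))"
    by (simp add: exchange_poly_def one_pCons)
  then show ?case by (rule exI[of _ "\<lambda>_. h"])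
next
  case (Suc d)
  let ?R = "exchange_poly a b (Suc d)"
  define c0 where "c0 = poly f (b 0) / poly (?R 0) (b 0)"
  define g where "g = f - smult c0 (?R 0)"
  have "poly g (b 0) = 0"
    using poly_exchange_0_nonzero[of a b] Suc.prems(1) by (simp add: g_def c0_def)
  then obtain h where h: "g = lin (b 0) * h" by (metis poly_eq_0_iff_dvd dvdE)
  have "degree (?R 0) = Suc d"
    unfolding exchange_poly_def by (simp add: degree_prod_eq_sum_degree del: prod.lessThan_Suc)
  then have "degree g \<le> Suc d"
    unfolding g_def using Suc.prems(2) by (intro degree_diff_le) auto
  moreover have "degree g = Suc (degree h)" if "h \<noteq> 0"
    unfolding h using that by (subst degree_mult_eq) auto
  ultimately have "degree h \<le> d" by (cases "h = 0") auto
  then obtain c where c: "h = (\<Sum>m\<le>d. smult (c m) (exchange_poly a (\<lambda>i. b (Suc i)) d m))"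
    using Suc.IH[of "\<lambda>i. b (Suc i)" h] Suc.prems(1) by auto
  have "f = smult c0 (?R 0) + lin (b 0) * h" using h by (simp add: g_def)
  also have "lin (b 0) * h = (\<Sum>m\<le>d. smult (c m) (?R (Suc m)))"
    unfolding c sum_distrib_left exchange_poly_Suc mult_smult_right ..
  also have "smult c0 (?R 0) + \<dots> = (\<Sum>m\<le>Suc d. smult (case m of 0 \<Rightarrow> c0 | Suc k \<Rightarrow> c k) (?R m))"
    by (subst sum.atMost_Suc_shift) simp
  finally show ?case by blast
qed

text \<open>Evaluation at \<open>b 0\<close> isolates \<open>c 0\<close>; division by
  \<open>lin (b 0)\<close> then lowers d by one.\<close>

lemma exchange_poly_independent:
  assumes "\<And>i l. a i \<noteq> b l" "(\<Sum>m\<le>d. smult (c m) (exchange_poly a b d m)) = 0" "m \<le> d"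
  shows "c m = 0"
  using assms
proof (induction d arbitrary: b c m)
  case 0
  then show ?case by (simp add: exchange_poly_def)
next
  case (Suc d)
  let ?R = "exchange_poly a b (Suc d)"
  have sum: "smult (c 0) (?R 0) + (\<Sum>m\<le>d. smult (c (Suc m)) (?R (Suc m))) = 0"
    using Suc.prems(2) by (subst (asm) sum.atMost_Suc_shift) simp
  then have "poly (smult (c 0) (?R 0) + (\<Sum>m\<le>d. smult (c (Suc m)) (?R (Suc m)))) (b 0) = 0"
    by simp
  then have c0: "c 0 = 0"
    using poly_exchange_0_nonzero[of a b "Suc d"] Suc.prems(1)
    by (simp add: poly_sum exchange_poly_Suc)
  have "lin (b 0) * (\<Sum>m\<le>d. smult (c (Suc m)) (exchange_poly a (\<lambda>i. b (Suc i)) d m)) = 0"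
    using sum c0 by (simp add: sum_distrib_left exchange_poly_Suc del: mult_pCons_left)
  then have "(\<Sum>m\<le>d. smult (c (Suc m)) (exchange_poly a (\<lambda>i. b (Suc i)) d m)) = 0"
    by (simp del: mult_pCons_left)
  then have "c (Suc k) = 0" if "k \<le> d" for k
    using Suc.prems(1) that Suc.IH[of "\<lambda>i. b (Suc i)" "\<lambda>k. c (Suc k)" k] by auto
  then show ?case using c0 Suc.prems(3) by (cases m) auto
qed

text \<open>For indices from j + r - p to j all r copies of \<tau> are among the roots. The other
  roots are knots counted downwards from \<xi>_j and upwards from behind \<tau>. The case r = 0
  describes all polynomials that belong to one knot interval.\<close>

lemma knot_poly_eq_exchange:
  assumes "m + r \<le> p" "\<And>i. i \<in> {1..r} \<Longrightarrow> \<xi> (j + int i) = \<tau>"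
  shows "knot_poly \<xi> p (j + int r - int p + int m) = lin \<tau> ^ r *
     exchange_poly (\<lambda>i. \<xi> (j - int i)) (\<lambda>i. \<xi> (j + int r + 1 + int i)) (p - r) m"
proof -
  define k where "k = j + int r - int p + int m"
  \<comment> \<open>q is the number of roots taken from \<xi>_j downwards.\<close>
  define q where "q = p - r - m"
  have q: "p = q + r + m" "k = j - int q" using assms(1) by (auto simp: q_def k_def)
  let ?f = "\<lambda>i. lin (\<xi> (k + int i))"
  have split: "{1..p} = {1..q} \<union> {q + 1..q + r} \<union> {q + r + 1..p}" using q by auto
  have "knot_poly \<xi> p k = (\<Prod>i\<in>{1..q}. ?f i) * (\<Prod>i\<in>{q + 1..q + r}. ?f i) * (\<Prod>i\<in>{q + r + 1..p}. ?f i)"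
    unfolding knot_poly_def split
    by (subst prod.union_disjoint; (subst prod.union_disjoint)?) auto
  also have "(\<Prod>i\<in>{1..q}. ?f i) = (\<Prod>i<q. lin (\<xi> (j - int i)))"
    by (rule prod.reindex_bij_witness[where i = "\<lambda>i. q - i" and j = "\<lambda>i. q - i"])
       (auto simp: q of_nat_diff algebra_simps)
  also have "(\<Prod>i\<in>{q + 1..q + r}. ?f i) = (\<Prod>i\<in>{q + 1..q + r}. lin \<tau>)"
  proof (intro prod.cong refl)
    fix i assume "i \<in> {q + 1..q + r}"
    then have "i - q \<in> {1..r}" "q \<le> i" by auto
    then show "?f i = lin \<tau>" using assms(2)[of "i - q"] by (simp add: q of_nat_diff algebra_simps)
  qed
  also have "(\<Prod>i\<in>{q + r + 1..p}. ?f i) = (\<Prod>i<m. lin (\<xi> (j + int r + 1 + int i)))"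
    by (rule prod.reindex_bij_witness[where i = "\<lambda>i. q + r + 1 + i" and j = "\<lambda>i. i - (q + r + 1)"])
       (auto simp: q algebra_simps of_nat_diff)
  finally show ?thesis
    using q by (simp add: exchange_poly_def k_def ac_simps del: mult_pCons_left mult_pCons_right)
qed

text \<open>By \<open>dbf_const\<close> the evaluation point may be moved to s, where only the p-th
  derivative of the power survives; the signs from the pairing and from the power cancel.\<close>

lemma dbf_power:
  assumes "degree g \<le> p"
  shows "poly (dbf p ([:s, -1:] ^ p) g) t = fact p * poly g s"
proof -
  have 1: "(pderiv ^^ m) ([:s, -1:] ^ p) = smult ((-1) ^ p) ((pderiv ^^ m) (lin s ^ p))" for m
  proof -
    have "[:s, -1:] = smult (-1) (lin s)" by simp
    then have "[:s, -1:] ^ p = smult ((-1) ^ p) (lin s ^ p)" by (simp only: smult_power)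
    then show ?thesis by (simp only: higher_pderiv_smult)
  qed
  have 2: "(pderiv ^^ p) (lin s ^ p) = [:fact p:]"
  proof (induction p)
    case (Suc p)
    have "(pderiv ^^ Suc p) (lin s ^ Suc p) = (pderiv ^^ p) (smult (real (Suc p)) (lin s ^ p))"
      by (simp only: funpow_Suc_right o_apply pderiv_power_Suc) (simp add: pderiv_pCons)
    then show ?case using Suc by (simp add: higher_pderiv_smult)
  qed (simp add: one_pCons)
  have "degree ([:s, -1:] ^ p) \<le> p" by (simp add: degree_power_eq)
  then have "poly (dbf p ([:s, -1:] ^ p) g) t = poly (dbf p ([:s, -1:] ^ p) g) s"
    using assms by (rule dbf_const)
  also have "\<dots> = (\<Sum>m\<in>{p}. (-1) ^ m * (poly ((pderiv ^^ m) ([:s, -1:] ^ p)) s * poly ((pderiv ^^ (p - m)) g) s))"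
    unfolding dbf_def poly_sum poly_smult poly_mult
  proof (rule sum.mono_neutral_right)
    show "\<forall>m\<in>{..p} - {p}. (-1) ^ m * (poly ((pderiv ^^ m) ([:s, -1:] ^ p)) s * poly ((pderiv ^^ (p - m)) g) s) = 0"
      by (auto simp: 1 lin_power_dvd_imp_higher_pderiv_0[of s p])
  qed auto
  also have "\<dots> = fact p * poly g s"
    by (simp add: 1 2 flip: power_mult_distrib)
  finally show ?thesis .
qed

text \<open>The two families of roots are separated by the nonempty interval between \<xi>_j and
  \<xi>_(j+1), so they are disjoint as the exchange argument requires.\<close>

lemma knot_poly_independent:
  assumes "mono \<xi>" "\<xi> j < \<xi> (j + 1)" "(\<Sum>k\<in>{j - int p..j}. smult (b k) (knot_poly \<xi> p k)) = 0"
    and "k \<in> {j - int p..j}"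
  shows "b k = 0"
proof -
  define R where "R = exchange_poly (\<lambda>i. \<xi> (j - int i)) (\<lambda>i. \<xi> (j + 1 + int i)) p"
  have "\<xi> (j - int i) < \<xi> (j + 1 + int l)" for i l
  proof -
    have "\<xi> (j - int i) \<le> \<xi> j" "\<xi> (j + 1) \<le> \<xi> (j + 1 + int l)"
      by (auto intro!: monoD[OF assms(1)])
    then show ?thesis using assms(2) by simp
  qed
  then have ne: "\<xi> (j - int i) \<noteq> \<xi> (j + 1 + int l)" for i l
    by (metis less_irrefl)
  have "(\<Sum>k\<in>{j - int p..j}. smult (b k) (knot_poly \<xi> p k))
    = (\<Sum>m\<le>p. smult (b (j - int p + int m)) (knot_poly \<xi> p (j - int p + int m)))"
    by (rule sum.reindex_bij_witness[where i = "\<lambda>m. j - int p + int m" and j = "\<lambda>k. nat (k - j + int p)"]) auto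
  also have "\<dots> = (\<Sum>m\<le>p. smult (b (j - int p + int m)) (R m))"
    using knot_poly_eq_exchange[of _ 0 p \<xi> j 0] by (simp add: R_def)
  finally have "b (j - int p + int (nat (k - j + int p))) = 0"
    unfolding R_def using assms(3,4)
    by (intro exchange_poly_independent[OF ne, where c = "\<lambda>m. b (j - int p + int m)"]) auto
  then show ?thesis using assms(4) by simp
qed

text \<open>Pair both sides of Marsden's identity, as polynomials in t, with the i-th knot
  polynomial. By \<open>dbf_power\<close> the result is p! times that polynomial in s, and comparing
  coefficients in the independent family of knot polynomials gives the biorthogonality.\<close>

lemma dbf_piece_knot_poly:
  assumes "mono \<xi>" "\<xi> j < \<xi> (j + 1)" "i \<in> {j - int p..j}"
  shows "poly (dbf p (piece \<xi> j p k) (knot_poly \<xi> p i)) t = (if k = i then fact p else 0)"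
proof (cases "k \<in> {j - int p..j}")
  case False
  then have "piece \<xi> j p k = 0" by (intro piece_eq_0) auto
  then show ?thesis using False assms(3) by auto
next
  case True
  let ?J = "{j - int p..j}"
  define a where "a k = poly (dbf p (piece \<xi> j p k) (knot_poly \<xi> p i)) t" for k
  define b where "b k = a k - (if k = i then fact p else 0)" for k
  have "(\<Sum>k\<in>?J. smult (b k) (knot_poly \<xi> p k)) = 0"
  proof (rule iffD1[OF poly_eq_poly_eq_iff], rule ext)
    fix s
    have "(\<Sum>k\<in>?J. poly (knot_poly \<xi> p k) s * a k)
      = poly (dbf p (\<Sum>k\<in>?J. smult (poly (knot_poly \<xi> p k) s) (piece \<xi> j p k)) (knot_poly \<xi> p i)) t"
      by (simp add: dbf_sum_left dbf_smult_left poly_sum a_def)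
    also have "(\<Sum>k\<in>?J. smult (poly (knot_poly \<xi> p k) s) (piece \<xi> j p k)) = [:s, -1:] ^ p"
      by (rule iffD1[OF poly_eq_poly_eq_iff], rule ext)
         (simp add: poly_sum poly_power marsden_identity[OF assms(1,2)])
    also have "poly (dbf p \<dots> (knot_poly \<xi> p i)) t = fact p * poly (knot_poly \<xi> p i) s"
      by (simp add: dbf_power degree_knot_poly)
    finally have "(\<Sum>k\<in>?J. poly (knot_poly \<xi> p k) s * a k) = fact p * poly (knot_poly \<xi> p i) s" .
    moreover have "(\<Sum>k\<in>?J. poly (knot_poly \<xi> p k) s * (if k = i then fact p else 0))
       = fact p * poly (knot_poly \<xi> p i) s"
      using assms(3) by (simp add: if_distrib sum.delta cong: if_cong)
    ultimately show "poly (\<Sum>k\<in>?J. smult (b k) (knot_poly \<xi> p k)) s = poly 0 s"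
      by (simp add: poly_sum b_def algebra_simps sum_subtractf)
  qed
  then have "b k = 0" using knot_poly_independent[OF assms(1,2)] True by blast
  then show ?thesis by (simp add: a_def b_def)
qed

text \<open>r is the multiplicity of the knot \<tau> between two nonempty intervals. The pieces on
  both sides have the same pairings with the knot polynomials that the intervals share, so their
  difference pairs to zero with these, hence with every multiple of \<open>lin \<tau> ^ r\<close> of
  degree at most p.\<close>

lemma piece_jump_dvd:
  assumes "mono \<xi>" "\<xi> j < \<xi> (j + 1)" "\<xi> (j + int r) < \<xi> (j + int r + 1)" "r \<le> p"
    and \<tau>: "\<And>i. i \<in> {1..r} \<Longrightarrow> \<xi> (j + int i) = \<tau>"
  shows "lin \<tau> ^ (p + 1 - r) dvd piece \<xi> (j + int r) p k - piece \<xi> j p k"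
proof -
  define \<Delta> where "\<Delta> = piece \<xi> (j + int r) p k - piece \<xi> j p k"
  define R where "R = exchange_poly (\<lambda>i. \<xi> (j - int i)) (\<lambda>i. \<xi> (j + int r + 1 + int i)) (p - r)"
  have deg: "degree \<Delta> \<le> p"
    unfolding \<Delta>_def by (intro degree_diff_le degree_piece)
  have "\<xi> (j - int i) < \<xi> (j + int r + 1 + int l)" for i l
  proof -
    have "\<xi> (j - int i) \<le> \<xi> j" "\<xi> (j + 1) \<le> \<xi> (j + int r + 1 + int l)"
      by (auto intro!: monoD[OF assms(1)])
    then show ?thesis using assms(2) by simp
  qed
  then have ne: "\<xi> (j - int i) \<noteq> \<xi> (j + int r + 1 + int l)" for i l
    by (metis less_irrefl)
  have R: "poly (dbf p \<Delta> (lin \<tau> ^ r * R m)) \<tau> = 0" if "m \<le> p - r" for m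
  proof -
    have "lin \<tau> ^ r * R m = knot_poly \<xi> p (j + int r - int p + int m)"
      using that assms(4) \<tau> by (subst knot_poly_eq_exchange[of _ r]) (auto simp: R_def)
    then show ?thesis
      unfolding \<Delta>_def dbf_diff_left using that assms(1-4)
      by (simp add: dbf_piece_knot_poly del: mult_pCons_left)
  qed
  \<comment> \<open>After removing the factor \<open>lin \<tau> ^ r\<close>, the shared knot
    polynomials span all polynomials of degree at most p - r.\<close>
  have f: "poly (dbf p \<Delta> (lin \<tau> ^ r * f)) \<tau> = 0" if df: "degree f \<le> p - r" for f
  proof -
    obtain c where f: "f = (\<Sum>m\<le>p - r. smult (c m) (R m))"
      unfolding R_def using exchange_poly_span[of "\<lambda>i. \<xi> (j - int i)" "\<lambda>i. \<xi> (j + int r + 1 + int i)", OF ne df] by blast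
    show ?thesis unfolding f sum_distrib_left mult_smult_right dbf_sum_right dbf_smult_right poly_sum
      using R by (simp del: mult_pCons_left)
  qed
  show ?thesis
    unfolding \<Delta>_def[symmetric]
  proof (rule lin_power_dvdI)
    fix m assume m: "m < p + 1 - r"
    \<comment> \<open>At \<tau> only the n-th derivative of \<open>lin \<tau> ^ n\<close> is
      nonzero, so pairing with this power reads off the derivative of \<Delta> of order m = p -
      n.\<close>
    define n where "n = p - m"
    have n: "r \<le> n" "n \<le> p" "p - n = m" using m by (auto simp: n_def)
    have "lin \<tau> ^ n = lin \<tau> ^ r * lin \<tau> ^ (n - r)" using n by (simp flip: power_add)
    moreover have "degree (lin \<tau> ^ (n - r)) \<le> p - r" using n by (simp add: degree_power_eq)
    ultimately have "0 = poly (dbf p \<Delta> (lin \<tau> ^ n)) \<tau>" using f by simp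
    also have "\<dots> = (\<Sum>l\<in>{m}. (-1) ^ l * (poly ((pderiv ^^ l) \<Delta>) \<tau> * poly ((pderiv ^^ (p - l)) (lin \<tau> ^ n)) \<tau>))"
      unfolding dbf_def poly_sum poly_smult poly_mult
    proof (rule sum.mono_neutral_right)
      show "\<forall>l\<in>{..p} - {m}. (-1) ^ l * (poly ((pderiv ^^ l) \<Delta>) \<tau> * poly ((pderiv ^^ (p - l)) (lin \<tau> ^ n)) \<tau>) = 0"
      proof
        fix l assume l: "l \<in> {..p} - {m}"
        show "(-1) ^ l * (poly ((pderiv ^^ l) \<Delta>) \<tau> * poly ((pderiv ^^ (p - l)) (lin \<tau> ^ n)) \<tau>) = 0"
        proof (cases "p - l < n")
          case True
          then show ?thesis using lin_power_dvd_imp_higher_pderiv_0[of \<tau> n "lin \<tau> ^ n"] by simp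
        next
          case False
          then have "n < p - l" using l n by auto
          then show ?thesis by (simp add: higher_pderiv_eq_0 degree_power_eq)
        qed
      qed
    qed (use n in auto)
    also have "\<dots> = (-1) ^ m * poly ((pderiv ^^ m) \<Delta>) \<tau> * poly ((pderiv ^^ n) (lin \<tau> ^ n)) \<tau>"
      using n by (simp add: n_def[symmetric])
    finally show "poly ((pderiv ^^ m) \<Delta>) \<tau> = 0"
      using higher_pderiv_lin_power[of n n \<tau>] by auto
  qed
qed

section \<open>B-splines for open knot vectors\<close>

text \<open>Both sides obey the same recursion, so everything is decided in degree 0: a single
  B-spline equals 1 on the interval, and a point equal to the last knot is assigned to the nonempty
  interval before it.\<close>

lemma bspline_eq_piece:
  assumes "mono \<xi>" "\<And>i. i \<in> {1..length \<Xi>} \<Longrightarrow> \<xi> (int i) = knot \<Xi> i"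
    and "1 \<le> j" "j + 1 \<le> length \<Xi>" "\<xi> (int j) < \<xi> (int j + 1)"
    and "\<xi> (int j) \<le> t" "t < \<xi> (int j + 1) \<or> t = \<xi> (int j + 1) \<and> t = last \<Xi>"
    and "1 \<le> k" "k + p + 1 \<le> length \<Xi>"
  shows "bspline \<Xi> k p t = poly (piece \<xi> (int j) p (int k)) t"
  using assms(8,9)
proof (induction p arbitrary: k)
  case 0
  have le: "\<xi> (int a) \<le> \<xi> (int b)" if "a \<le> b" for a b
    using that by (intro monoD[OF assms(1)]) simp
  have k: "knot \<Xi> k = \<xi> (int k)" "knot \<Xi> (k + 1) = \<xi> (int (k + 1))"
    using 0 assms(2) by (metis add_leE add_0_right atLeastAtMost_iff le_add2)+
  have "last \<Xi> = knot \<Xi> (length \<Xi>)"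
    using assms(4) by (subst last_conv_nth) (auto simp: knot_def)
  then have last: "last \<Xi> = \<xi> (int (length \<Xi>))" using assms(2,4) by auto
  have j: "\<xi> (int j + 1) = \<xi> (int (j + 1))" by (simp add: add.commute)
  have b: "bspline \<Xi> k 0 t = (if \<xi> (int k) \<le> t \<and> t < \<xi> (int (k + 1))
      \<or> \<xi> (int k) < t \<and> t = \<xi> (int (k + 1)) \<and> t = last \<Xi> then 1 else 0)"
    by (simp only: bspline.simps k)
  note t = assms(5-7)[unfolded j]
  consider "k < j" | "k = j" | "k > j" by linarith
  then show ?case
  proof cases
    case 1
    then have "\<xi> (int (k + 1)) \<le> \<xi> (int j)" by (intro le) simp
    moreover have "\<xi> (int (j + 1)) \<le> \<xi> (int (length \<Xi>))" using assms(4) by (intro le) simp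
    ultimately show ?thesis
      using 1 t unfolding b last by auto
  next
    case 2
    then show ?thesis
      using t unfolding 2 b[unfolded 2] last by auto
  next
    case 3
    then have "\<xi> (int (j + 1)) \<le> \<xi> (int k)" by (intro le) simp
    moreover have "\<xi> (int (k + 1)) \<le> \<xi> (int (length \<Xi>))" using 0 by (intro le) simp
    ultimately show ?thesis
      using 3 t unfolding b last by auto
  qed
next
  case (Suc p)
  have k: "knot \<Xi> k = \<xi> (int k)" "knot \<Xi> (k + 1) = \<xi> (int k + 1)"
    "knot \<Xi> (k + p + 1) = \<xi> (int k + int p + 1)" "knot \<Xi> (k + p + 2) = \<xi> (int k + int p + 2)"
  proof -
    have *: "knot \<Xi> (k + i) = \<xi> (int k + int i)" if "i \<le> p + 2" for i
      using assms(2)[of "k + i"] Suc.prems that by simp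
    show "knot \<Xi> k = \<xi> (int k)" "knot \<Xi> (k + 1) = \<xi> (int k + 1)"
      "knot \<Xi> (k + p + 1) = \<xi> (int k + int p + 1)" "knot \<Xi> (k + p + 2) = \<xi> (int k + int p + 2)"
      using *[of 0] *[of 1] *[of "p + 1"] *[of "p + 2"] by (simp_all add: algebra_simps)
  qed
  have IH: "bspline \<Xi> k p t = poly (piece \<xi> (int j) p (int k)) t"
    "bspline \<Xi> (k + 1) p t = poly (piece \<xi> (int j) p (int k + 1)) t"
    using Suc.IH[of k] Suc.IH[of "k + 1"] Suc.prems by (simp_all add: add.commute)
  show ?case
    unfolding bspline.simps piece.simps k IH
    by (simp add: divide_inverse algebra_simps)
qed

text \<open>Clamping the index repeats the end knots, which keeps the sequence monotone on all
  integers.\<close>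

definition ext_knots :: "real list \<Rightarrow> int \<Rightarrow> real" where
  "ext_knots \<Xi> i = knot \<Xi> (nat (max 1 (min i (int (length \<Xi>)))))"

lemma ext_knots_eq: "i \<in> {1..length \<Xi>} \<Longrightarrow> ext_knots \<Xi> (int i) = knot \<Xi> i"
  by (simp add: ext_knots_def max_def min_def)

lemma mono_ext_knots:
  assumes "sorted \<Xi>" "\<Xi> \<noteq> []"
  shows "mono (ext_knots \<Xi>)"
proof
  fix i j :: int assume ij: "i \<le> j"
  have "0 < length \<Xi>" using assms(2) by simp
  then show "ext_knots \<Xi> i \<le> ext_knots \<Xi> j"
    using ij unfolding ext_knots_def knot_def by (intro sorted_nth_mono assms(1)) linarith+
qed

text \<open>List positions count from 0, whereas \<open>knot\<close> counts from 1.
  \<open>knots_gap\<close> says that no p + 1 consecutive knots coincide except the first and the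
  last block; this bounds the interior multiplicities by p and makes B-splines continuous.\<close>

locale open_knots =
  fixes \<Xi> :: "real list" and p :: nat
  assumes sorted_knots: "sorted \<Xi>" and p_pos: "p \<ge> 1" and len: "2 * p + 2 \<le> length \<Xi>"
    and first_knots: "i \<le> p \<Longrightarrow> \<Xi> ! i = 0"
    and last_knots: "i < length \<Xi> \<Longrightarrow> length \<Xi> \<le> i + p + 1 \<Longrightarrow> \<Xi> ! i = 1"
    and knots_gap: "1 \<le> i \<Longrightarrow> i + p + 1 < length \<Xi> \<Longrightarrow> \<Xi> ! i < \<Xi> ! (i + p)"
begin

definition n :: nat where "n = num_bsplines \<Xi> p"

abbreviation \<xi> :: "int \<Rightarrow> real" where "\<xi> \<equiv> ext_knots \<Xi>"

lemma length_knots: "length \<Xi> = n + p + 1" and n_ge: "p + 1 \<le> n"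
  using len by (auto simp: n_def num_bsplines_def)

lemma mono_\<xi>: "mono \<xi>"
  using sorted_knots len by (intro mono_ext_knots) auto

lemma \<xi>_le: "i \<le> j \<Longrightarrow> \<xi> i \<le> \<xi> j"
  using mono_\<xi> by (rule monoD)

lemma \<xi>_eq: "1 \<le> i \<Longrightarrow> i \<le> n + p + 1 \<Longrightarrow> \<xi> (int i) = knot \<Xi> i"
  using ext_knots_eq[of i \<Xi>] length_knots by simp

lemma \<xi>_first: "i \<le> int p + 1 \<Longrightarrow> \<xi> i = 0"
  using first_knots n_ge length_knots unfolding ext_knots_def knot_def by (intro first_knots) linarith

lemma \<xi>_last: "i \<ge> int n + 1 \<Longrightarrow> \<xi> i = 1"
  using n_ge length_knots unfolding ext_knots_def knot_def by (intro last_knots) linarith+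

lemma \<xi>_gap:
  assumes "2 \<le> i" "i \<le> int n"
  shows "\<xi> i < \<xi> (i + int p)"
proof -
  obtain k where k: "i = int k" using assms by (metis nat_0_le order_trans zero_le_numeral)
  have "\<Xi> ! (k - 1) < \<Xi> ! (k - 1 + p)"
    by (rule knots_gap) (use assms k length_knots in auto)
  moreover have "k - 1 + p = k + p - 1" using assms k by auto
  ultimately have "knot \<Xi> k < knot \<Xi> (k + p)" by (simp add: knot_def)
  then show ?thesis
    using \<xi>_eq[of k] \<xi>_eq[of "k + p"] assms k by simp
qed

lemma \<xi>_bounds: "0 \<le> \<xi> i" "\<xi> i \<le> 1"
proof -
  have "\<xi> (min i 0) \<le> \<xi> i" "\<xi> i \<le> \<xi> (max i (int n + 1))" by (auto intro!: \<xi>_le)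
  then show "0 \<le> \<xi> i" "\<xi> i \<le> 1" by (simp_all add: \<xi>_first \<xi>_last)
qed

lemma support_nonempty:
  assumes "1 \<le> i" "i \<le> n"
  shows "\<xi> (int i) < \<xi> (int i + int p + 1)"
proof (cases "i = 1")
  case True
  have "\<xi> 1 \<le> \<xi> 2" "\<xi> 2 < \<xi> (2 + int p)" using n_ge p_pos by (simp_all add: \<xi>_le \<xi>_gap)
  then show ?thesis using True by (simp add: add.commute)
next
  case False
  have "\<xi> (int i) < \<xi> (int i + int p)" "\<xi> (int i + int p) \<le> \<xi> (int i + int p + 1)"
    using False assms by (simp_all add: \<xi>_le \<xi>_gap)
  then show ?thesis by simp
qed

text \<open>In the range from p + 1 to n all B-splines that live on the interval, those with indices
  from j - p to j, carry admissible indices between 1 and n.\<close>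

definition cells :: "int set" where
  "cells = {j \<in> {int p + 1..int n}. \<xi> j < \<xi> (j + 1)}"

lemma cellsD:
  assumes "j \<in> cells"
  shows "\<xi> j < \<xi> (j + 1)" "int p + 1 \<le> j" "j \<le> int n"
  using assms by (auto simp: cells_def)

lemma finite_cells: "finite cells"
  unfolding cells_def by (rule finite_subset[of _ "{int p + 1..int n}"]) auto

lemma cell_exists:
  assumes "0 \<le> t" "t < 1"
  obtains j where "j \<in> cells" "\<xi> j \<le> t" "t < \<xi> (j + 1)"
proof -
  define J where "J = {j \<in> {int p + 1..int n}. \<xi> j \<le> t}"
  have fin: "finite J" unfolding J_def by (rule finite_subset[of _ "{int p + 1..int n}"]) auto
  have ne: "int p + 1 \<in> J" using n_ge assms \<xi>_first[of "int p + 1"] by (simp add: J_def)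
  define j where "j = Max J"
  have j: "j \<in> J" unfolding j_def using fin ne by (intro Max_in) auto
  have "t < \<xi> (j + 1)"
  proof (cases "j = int n")
    case True
    then show ?thesis using assms \<xi>_last[of "int n + 1"] by simp
  next
    case False
    have "j + 1 \<notin> J" using Max_ge[OF fin, of "j + 1"] unfolding j_def[symmetric] by auto
    then show ?thesis using False j by (auto simp: J_def)
  qed
  then show ?thesis using that[of j] j by (auto simp: J_def cells_def)
qed

lemma last_cell: "int n \<in> cells" "\<xi> (int n + 1) = 1"
  using \<xi>_gap[of "int n"] \<xi>_last[of "int n + int p"] \<xi>_last[of "int n + 1"] n_ge p_pos
  by (auto simp: cells_def)

text \<open>r is the multiplicity of the interior knot \<xi>_(j+1); a larger multiplicity than p
  would contradict \<open>\<xi>_gap\<close>.\<close>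

lemma next_cell:
  assumes "j \<in> cells" "\<xi> (j + 1) < 1"
  obtains r where "1 \<le> r" "r \<le> p" "j + int r \<in> cells"
    "\<And>i. i \<in> {1..r} \<Longrightarrow> \<xi> (j + int i) = \<xi> (j + 1)"
proof -
  obtain j' where j': "j' \<in> cells" "\<xi> j' \<le> \<xi> (j + 1)" "\<xi> (j + 1) < \<xi> (j' + 1)"
    by (rule cell_exists[OF \<xi>_bounds(1) assms(2)])
  have "j < j'" using \<xi>_le[of "j' + 1" "j + 1"] j'(3) by force
  then have eq: "\<xi> j' = \<xi> (j + 1)" using j'(2) \<xi>_le[of "j + 1" j'] by simp
  define r where "r = nat (j' - j)"
  have r: "j' = j + int r" "1 \<le> r" using \<open>j < j'\<close> by (auto simp: r_def)
  have i: "\<xi> (j + int i) = \<xi> (j + 1)" if "i \<in> {1..r}" for i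
    using that eq r \<xi>_le[of "j + 1" "j + int i"] \<xi>_le[of "j + int i" j'] by auto
  have "r \<le> p"
  proof (rule ccontr)
    assume "\<not> r \<le> p"
    then have "\<xi> (j + int (p + 1)) = \<xi> (j + 1)" by (intro i) auto
    moreover have "\<xi> (j + 1) < \<xi> (j + 1 + int p)"
      using cellsD[OF assms(1)] cellsD[OF j'(1)] \<open>j < j'\<close> p_pos by (intro \<xi>_gap) auto
    ultimately show False by (simp add: algebra_simps)
  qed
  then show ?thesis using that[of r] r i j' by auto
qed

text \<open>The definition assigns the right end of an interior cell to the next cell. The knot
  there has multiplicity r \<le> p, so the jump is divisible by at least the first power of the
  linear factor, and the pieces of the two cells agree at the knot. Hence closed cells may be
  used.\<close>

lemma bspline_on_cell:
  assumes "j \<in> cells" "\<xi> j \<le> t" "t \<le> \<xi> (j + 1)" "1 \<le> k" "k \<le> n"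
  shows "bspline \<Xi> k p t = poly (piece \<xi> j p (int k)) t"
proof -
  have *: "bspline \<Xi> k p t = poly (piece \<xi> j p (int k)) t"
    if j: "j \<in> cells" and t: "\<xi> j \<le> t" "t < \<xi> (j + 1) \<or> t = \<xi> (j + 1) \<and> t = last \<Xi>" for j
  proof -
    have "0 \<le> j" using cellsD(2)[OF j] by simp
    then obtain i where i: "j = int i" by (rule nonneg_int_cases)
    note c = cellsD[OF j, unfolded i]
    show ?thesis unfolding i
    proof (rule bspline_eq_piece[OF mono_\<xi> ext_knots_eq _ _ c(1)])
      show "1 \<le> i" "i + 1 \<le> length \<Xi>" "k + p + 1 \<le> length \<Xi>"
        using c assms(5) length_knots by auto
    qed (use t i assms(4) in auto)
  qed
  have last: "last \<Xi> = 1"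
    using length_knots last_knots[of "length \<Xi> - 1"] by (subst last_conv_nth) auto
  consider "t < \<xi> (j + 1)" | "t = \<xi> (j + 1)" "\<xi> (j + 1) = 1" | "t = \<xi> (j + 1)" "\<xi> (j + 1) < 1"
    using assms(3) \<xi>_bounds(2)[of "j + 1"] by linarith
  then show ?thesis
  proof cases
    case 3
    obtain r where r: "1 \<le> r" "r \<le> p" "j + int r \<in> cells"
      "\<And>i. i \<in> {1..r} \<Longrightarrow> \<xi> (j + int i) = \<xi> (j + 1)"
      by (rule next_cell[OF assms(1) 3(2)]) (rule that)
    have "lin t ^ (p + 1 - r) dvd piece \<xi> (j + int r) p (int k) - piece \<xi> j p (int k)"
      using r(2) r(4) 3 cellsD(1)[OF assms(1)] cellsD(1)[OF r(3)]
      by (intro piece_jump_dvd[OF mono_\<xi>]) simp_all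
    then have "poly ((pderiv ^^ 0) (piece \<xi> (j + int r) p (int k) - piece \<xi> j p (int k))) t = 0"
      using r by (intro lin_power_dvd_imp_higher_pderiv_0) auto
    moreover have "bspline \<Xi> k p t = poly (piece \<xi> (j + int r) p (int k)) t"
      using r(1) r(4)[of r] 3 cellsD(1)[OF r(3)] by (intro *[OF r(3)]) simp_all
    ultimately show ?thesis by simp
  qed (use * assms last in auto)
qed

lemma cell_cover:
  assumes "0 \<le> t" "t \<le> 1"
  obtains j where "j \<in> cells" "\<xi> j \<le> t" "t \<le> \<xi> (j + 1)"
proof (cases "t = 1")
  case True
  then show ?thesis using last_cell \<xi>_bounds(2)[of "int n"] by (intro that[of "int n"]) simp_all
next
  case False
  then have "t < 1" using assms by simp
  with assms(1) obtain j where "j \<in> cells" "\<xi> j \<le> t" "t < \<xi> (j + 1)" by (rule cell_exists)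
  then show ?thesis by (intro that[of j]) simp_all
qed

lemma bspline_nonneg:
  assumes "0 \<le> t" "t \<le> 1" "1 \<le> k" "k \<le> n"
  shows "0 \<le> bspline \<Xi> k p t"
proof -
  obtain j where j: "j \<in> cells" "\<xi> j \<le> t" "t \<le> \<xi> (j + 1)" by (rule cell_cover[OF assms(1,2)])
  show ?thesis unfolding bspline_on_cell[OF j assms(3,4)] by (rule piece_nonneg[OF mono_\<xi> j(2,3)])
qed

lemma bspline_sum:
  assumes "0 \<le> t" "t \<le> 1"
  shows "(\<Sum>k=1..n. bspline \<Xi> k p t) = 1"
proof -
  obtain j where j: "j \<in> cells" "\<xi> j \<le> t" "t \<le> \<xi> (j + 1)" by (rule cell_cover[OF assms])
  have "(\<Sum>k=1..n. bspline \<Xi> k p t) = (\<Sum>k=1..n. poly (piece \<xi> j p (int k)) t)"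
    by (intro sum.cong refl bspline_on_cell[OF j]) auto
  also have "\<dots> = (\<Sum>k\<in>{1..int n}. poly (piece \<xi> j p k) t)"
    by (rule sum.reindex_bij_witness[where i = nat and j = int]) auto
  also have "\<dots> = (\<Sum>k\<in>{j - int p..j}. poly (piece \<xi> j p k) t)"
    using cellsD[OF j(1)] by (intro sum.mono_neutral_right) (auto simp: piece_eq_0)
  finally show ?thesis using piece_partition_of_unity[OF mono_\<xi> cellsD(1)[OF j(1)]] by simp
qed

end

lemma poly_lipschitz:
  fixes q :: "real poly"
  shows "\<exists>C. C-lipschitz_on {a..b} (poly q)"
proof -
  have "compact (poly (pderiv q) ` {a..b})"
    by (intro compact_continuous_image continuous_intros) simp
  then obtain C where C: "\<And>t. t \<in> {a..b} \<Longrightarrow> \<bar>poly (pderiv q) t\<bar> \<le> C"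
    using compact_imp_bounded bounded_real by (metis imageI)
  have "(max C 0)-lipschitz_on {a..b} (poly q)"
  proof (rule bounded_derivative_imp_lipschitz)
    show "(poly q has_derivative (\<lambda>h. poly (pderiv q) t * h)) (at t within {a..b})" for t
      using poly_DERIV[of q t] has_field_derivative_imp_has_derivative has_derivative_at_withinI
      by blast
    show "onorm (\<lambda>h. poly (pderiv q) t * h) \<le> max C 0" if "t \<in> {a..b}" for t
      using C[OF that] by (intro onorm_le) (simp add: abs_mult mult_right_mono max.coboundedI1)
  qed auto
  then show ?thesis ..
qed

section \<open>Values at 0 and regularity of B-splines\<close>

context open_knots
begin

text \<open>The first p + 1 knots are 0, so the knot polynomial with index 1 is s^p. Marsden's
  identity at t = 0 has s^p on the right as well, and independence of the knot polynomials forces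
  the values.\<close>

lemma bspline_0:
  assumes "1 \<le> k" "k \<le> n"
  shows "bspline \<Xi> k p 0 = (if k = 1 then 1 else 0)"
proof -
  let ?j = "int p + 1"
  have z: "\<xi> i = 0" if "i \<le> ?j" for i using that by (rule \<xi>_first)
  have "\<xi> 2 < \<xi> (2 + int p)" using n_ge p_pos by (intro \<xi>_gap) auto
  then have pos: "\<xi> ?j < \<xi> (?j + 1)" using z[of 2] z[of ?j] p_pos by (simp add: add.commute)
  then have j: "?j \<in> cells" using n_ge by (simp add: cells_def)
  define b where "b k = poly (piece \<xi> ?j p k) 0 - (if k = 1 then 1 else 0)" for k
  have \<rho>1: "poly (knot_poly \<xi> p 1) s = s ^ p" for s
  proof -
    have "poly (knot_poly \<xi> p 1) s = (\<Prod>i = 1..p. s)"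
      unfolding knot_poly_def poly_prod by (intro prod.cong refl) (simp add: z)
    then show ?thesis by simp
  qed
  have "(\<Sum>k\<in>{?j - int p..?j}. smult (b k) (knot_poly \<xi> p k)) = 0"
  proof (rule iffD1[OF poly_eq_poly_eq_iff], rule ext)
    fix s
    define J where "J = {?j - int p..?j}"
    have J: "finite J" "1 \<in> J" by (auto simp: J_def)
    have "(\<Sum>k\<in>J. (if k = 1 then 1 else 0) * poly (knot_poly \<xi> p k) s) = s ^ p"
      using J by (simp add: if_distrib[of "\<lambda>x. x * _"] sum.delta \<rho>1 cong: if_cong)
    moreover have "(\<Sum>k\<in>J. poly (knot_poly \<xi> p k) s * poly (piece \<xi> ?j p k) 0) = s ^ p"
      using marsden_identity[OF mono_\<xi> pos, of p s 0] by (simp only: J_def) simp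
    ultimately have "poly (\<Sum>k\<in>J. smult (b k) (knot_poly \<xi> p k)) s = 0"
      by (simp add: poly_sum b_def algebra_simps sum_subtractf)
    then show "poly (\<Sum>k\<in>{?j - int p..?j}. smult (b k) (knot_poly \<xi> p k)) s = poly 0 s"
      by (simp only: J_def poly_0)
  qed
  then have b: "b (int k) = 0" if "int k \<le> ?j"
    using that assms by (intro knot_poly_independent[OF mono_\<xi> pos, where b = b and p = p]) auto
  have "bspline \<Xi> k p 0 = poly (piece \<xi> ?j p (int k)) 0"
    using z[of ?j] pos assms by (intro bspline_on_cell j) simp_all
  also have "\<dots> = (if k = 1 then 1 else 0)"
  proof (cases "int k \<le> ?j")
    case True
    then show ?thesis using b by (simp add: b_def)
  next
    case False
    then show ?thesis by (simp add: piece_eq_0)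
  qed
  finally show ?thesis .
qed

lemma bspline_lipschitz:
  assumes "1 \<le> k" "k \<le> n"
  shows "\<exists>C. C-lipschitz_on {0..1} (bspline \<Xi> k p)"
proof -
  have "\<forall>j. \<exists>C. C-lipschitz_on {\<xi> j..\<xi> (j + 1)} (poly (piece \<xi> j p (int k)))"
    using poly_lipschitz by blast
  then obtain C where C: "\<And>j. (C j)-lipschitz_on {\<xi> j..\<xi> (j + 1)} (poly (piece \<xi> j p (int k)))"
    by metis
  define M where "M = (\<Sum>j\<in>cells. \<bar>C j\<bar>)"
  have "M-lipschitz_on {0..1} (bspline \<Xi> k p)"
  proof (rule lipschitz_on_closed_Union[of cells _ "\<lambda>j. {\<xi> j..\<xi> (j + 1)}"])
    fix j assume j: "j \<in> cells"
    have "C j \<le> M" using member_le_sum[OF j, of "\<lambda>j. \<bar>C j\<bar>"] finite_cells by (simp add: M_def)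
    then have "M-lipschitz_on {\<xi> j..\<xi> (j + 1)} (poly (piece \<xi> j p (int k)))"
      using C lipschitz_on_le by blast
    then show "M-lipschitz_on {\<xi> j..\<xi> (j + 1)} (bspline \<Xi> k p)"
      by (rule lipschitz_on_transform) (simp add: bspline_on_cell[OF j _ _ assms])
    show "closed {\<xi> j..\<xi> (j + 1)}" by simp
  next
    show "{0..1} \<subseteq> (\<Union>j\<in>cells. {\<xi> j..\<xi> (j + 1)})"
    proof
      fix t :: real assume "t \<in> {0..1}"
      then obtain j where "j \<in> cells" "\<xi> j \<le> t" "t \<le> \<xi> (j + 1)"
        using cell_cover[of t] by (metis atLeastAtMost_iff)
      then show "t \<in> (\<Union>j\<in>cells. {\<xi> j..\<xi> (j + 1)})" by auto
    qed
  qed (auto simp: finite_cells M_def intro: sum_nonneg)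
  then show ?thesis ..
qed

lemma continuous_on_bspline: "1 \<le> k \<Longrightarrow> k \<le> n \<Longrightarrow> continuous_on {0..1} (bspline \<Xi> k p)"
  using bspline_lipschitz lipschitz_on_continuous_on by blast

lemma ext_knots_in_set: "\<xi> i \<in> set \<Xi>"
  unfolding ext_knots_def knot_def using len by (intro nth_mem) linarith

lemma bspline_differentiable:
  assumes "1 \<le> k" "k \<le> n" "0 < t" "t < 1" "t \<notin> set \<Xi>"
  shows "\<exists>D. (bspline \<Xi> k p has_real_derivative D) (at t)"
proof -
  obtain j where j: "j \<in> cells" "\<xi> j \<le> t" "t < \<xi> (j + 1)"
    by (rule cell_exists[of t]) (use assms in auto)
  have "\<xi> j \<noteq> t" using ext_knots_in_set[of j] assms(5) by auto
  then have t: "t \<in> {\<xi> j<..<\<xi> (j + 1)}" using j by auto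
  have "(bspline \<Xi> k p has_real_derivative poly (pderiv (piece \<xi> j p (int k))) t) (at t)"
  proof (rule has_field_derivative_transform_within_open[OF poly_DERIV _ t])
    show "poly (piece \<xi> j p (int k)) s = bspline \<Xi> k p s" if "s \<in> {\<xi> j<..<\<xi> (j + 1)}" for s
      using that by (intro bspline_on_cell[symmetric] j assms) auto
  qed simp
  then show ?thesis ..
qed

end

text \<open>Multiplicities are turned into numbers of positions in the sorted list. If position i +
  p repeated the value of position i, that value would occur p + 1 times, too often inside (0,1).
  For the value 0 position 0 is a further occurrence, and for the value 1 the last position
  is.\<close>

lemma open_knotsI:
  assumes sorted: "sorted \<Xi>" and p: "p \<ge> 1" and set: "set \<Xi> \<subseteq> {0..1}"
    and ends: "count_list \<Xi> 0 = p + 1" "count_list \<Xi> 1 = p + 1"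
    and interior: "\<And>x. 0 < x \<Longrightarrow> x < 1 \<Longrightarrow> count_list \<Xi> x \<le> p"
  shows "open_knots \<Xi> p"
proof -
  define m where "m = length \<Xi>"
  have le: "\<Xi> ! i \<le> \<Xi> ! j" if "i \<le> j" "j < m" for i j
    using sorted that by (simp add: sorted_nth_mono m_def)
  have rng: "0 \<le> \<Xi> ! i" "\<Xi> ! i \<le> 1" if "i < m" for i
    using subsetD[OF set nth_mem[of i \<Xi>]] that by (simp_all add: m_def)
  define A where "A x = {i. i < m \<and> x = \<Xi> ! i}" for x
  have card_A: "card (A x) = count_list \<Xi> x" for x
    by (simp add: A_def m_def count_list_eq_length_filter length_filter_conv_card)
  have fin: "finite (A x)" for x by (simp add: A_def)
  have "A 0 \<inter> A 1 = {}" by (auto simp: A_def)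
  then have "card (A 0 \<union> A 1) = 2 * p + 2"
    using ends by (simp add: card_Un_disjoint card_A fin)
  moreover have "card (A 0 \<union> A 1) \<le> card {..<m}" by (intro card_mono) (auto simp: A_def)
  ultimately have len: "2 * p + 2 \<le> m" by simp
  have first: "\<Xi> ! i = 0" if "i \<le> p" for i
  proof (rule ccontr)
    assume ne: "\<Xi> ! i \<noteq> 0"
    have "A 0 \<subseteq> {..<i}"
    proof
      fix k assume k: "k \<in> A 0"
      then have "\<not> i \<le> k" using le[of i k] rng[of i] ne by (auto simp: A_def)
      then show "k \<in> {..<i}" by simp
    qed
    then have "card (A 0) \<le> i" using card_mono[of "{..<i}" "A 0"] by simp
    then show False using that ends by (simp add: card_A)
  qed
  have last: "\<Xi> ! i = 1" if "i < m" "m \<le> i + p + 1" for i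
  proof (rule ccontr)
    assume ne: "\<Xi> ! i \<noteq> 1"
    have "A 1 \<subseteq> {i + 1..<m}"
    proof
      fix k assume k: "k \<in> A 1"
      then have "\<not> k \<le> i" using le[of k i] rng[of i] ne that by (auto simp: A_def)
      then show "k \<in> {i + 1..<m}" using k by (simp add: A_def)
    qed
    then have "card (A 1) \<le> m - (i + 1)" using card_mono[of "{i + 1..<m}" "A 1"] by simp
    then show False using that ends by (simp add: card_A)
  qed
  have gap: "\<Xi> ! i < \<Xi> ! (i + p)" if ii: "1 \<le> i" "i + p + 1 < m" for i
  proof (rule ccontr)
    assume "\<not> \<Xi> ! i < \<Xi> ! (i + p)"
    then have eq: "\<Xi> ! (i + p) = \<Xi> ! i" using le[of i "i + p"] that by simp
    have sub: "{i..i + p} \<subseteq> A (\<Xi> ! i)"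
    proof
      fix k assume "k \<in> {i..i + p}"
      then show "k \<in> A (\<Xi> ! i)"
        using le[of i k] le[of k "i + p"] eq that by (auto simp: A_def)
    qed
    then have c: "p + 1 \<le> count_list \<Xi> (\<Xi> ! i)" using card_mono[OF fin sub] by (simp add: card_A)
    consider "\<Xi> ! i = 0" | "\<Xi> ! i = 1" | "0 < \<Xi> ! i" "\<Xi> ! i < 1"
      using rng[of i] ii by linarith
    then show False
    proof cases
      case 1
      then have "0 \<in> A 0" using first[of 0] len by (simp add: A_def)
      then have "insert 0 {i..i + p} \<subseteq> A 0" using sub 1 by simp
      then have "card (insert 0 {i..i + p}) \<le> p + 1" using card_mono[OF fin[of 0]] ends by (metis card_A)
      then show False using that by simp
    next
      case 2
      then have "m - 1 \<in> A 1" using last[of "m - 1"] len by (simp add: A_def)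
      then have "insert (m - 1) {i..i + p} \<subseteq> A 1" using sub 2 by simp
      then have "card (insert (m - 1) {i..i + p}) \<le> p + 1" using card_mono[OF fin[of 1]] ends by (metis card_A)
      moreover have "m - 1 \<notin> {i..i + p}" using ii by auto
      ultimately show False by simp
    next
      case 3
      then show False using interior[OF 3] c by simp
    qed
  qed
  show ?thesis
    using sorted p len first last gap by unfold_locales (auto simp: m_def)
qed

lemma open_knots_refined:
  assumes "refined_knots M N p \<Xi>" "p \<ge> 1" "N > 1"
  shows "open_knots \<Xi> p"
proof (rule open_knotsI)
  have set: "set \<Xi> = {real (j - 1) * (1 / real (N - 1)) | j. 1 \<le> j \<and> j \<le> N}"
    and c: "\<forall>x\<in>set \<Xi> - {0, 1}. 1 \<le> count_list \<Xi> x \<and> count_list \<Xi> x \<le> p"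
    using assms(1) by (auto simp: refined_knots_def)
  have "0 \<le> real (j - 1) * (1 / real (N - 1)) \<and> real (j - 1) * (1 / real (N - 1)) \<le> 1" if "j \<le> N" for j
    using that assms(3) by (simp add: divide_le_eq)
  then show "set \<Xi> \<subseteq> {0..1}" unfolding set by (smt (verit) atLeastAtMost_iff mem_Collect_eq subsetI)
  show "count_list \<Xi> x \<le> p" if "0 < x" "x < 1" for x
    using c that by (cases "x \<in> set \<Xi>") (auto simp: count_list_0_iff)
qed (use assms in \<open>auto simp: refined_knots_def\<close>)

lemma count_list_replicate: "count_list (replicate k x) y = (if x = y then k else 0)"
  by (induction k) auto

lemma count_list_distinct_le: "distinct xs \<Longrightarrow> count_list xs x \<le> 1"
  by (induction xs) (auto simp: count_list_0_iff)

lemma open_knots_graded: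
  assumes "p \<ge> 1" "N > 1" "0 < \<mu>"
  shows "open_knots (graded_knots N p \<mu>) p"
proof -
  define f where "f j = (real (j - 1) * (1 / real (N - 1))) powr (1 / \<mu>)" for j
  have mono: "f i < f j" if "1 \<le> i" "i < j" for i j
    unfolding f_def using that assms by (intro powr_less_mono2) (auto simp: divide_strict_right_mono)
  have mono_le: "f i \<le> f j" if "1 \<le> i" "i \<le> j" for i j
    using mono[of i j] that by (cases "i = j") auto
  have f0: "f 1 = 0" and f1: "f N = 1" using assms by (auto simp: f_def)
  have rng: "0 < f j \<and> f j < 1" if "j \<in> {2..<N}" for j
    using mono[of 1 j] mono[of j N] f0 f1 that by auto
  have rng': "0 < x \<and> x < 1" if "x \<in> set (map f [2..<N])" for x
    using that rng by auto
  have k: "graded_knots N p \<mu> = replicate (p + 1) 0 @ map f [2..<N] @ replicate (p + 1) 1"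
    by (simp add: graded_knots_def f_def[abs_def])
  have "distinct (map f [2..<N])"
    unfolding distinct_map inj_on_def using mono by (auto, metis less_irrefl linorder_neqE_nat le_trans one_le_numeral)
  then have c: "count_list (map f [2..<N]) x \<le> 1" for x by (rule count_list_distinct_le)
  have c01: "count_list (map f [2..<N]) 0 = 0" "count_list (map f [2..<N]) 1 = 0"
    unfolding count_list_0_iff using rng' by force+
  show ?thesis
  proof (rule open_knotsI)
    have "sorted (map f [2..<N])"
      by (rule sorted_map_mono[OF sorted_upt]) (auto intro!: mono_onI mono_le)
    then show "sorted (graded_knots N p \<mu>)"
      unfolding k sorted_append using rng by (auto simp: less_imp_le)
    show "set (graded_knots N p \<mu>) \<subseteq> {0..1}"
      unfolding k using rng by (auto simp: less_imp_le)
    show "count_list (graded_knots N p \<mu>) 0 = p + 1" "count_list (graded_knots N p \<mu>) 1 = p + 1"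
      unfolding k count_list_append count_list_replicate using c01 by simp_all
    show "count_list (graded_knots N p \<mu>) x \<le> p" if "0 < x" "x < 1" for x
      unfolding k count_list_append count_list_replicate using that c[of x] assms by simp
  qed (use assms in auto)
qed

lemma count_list_concat_replicate:
  assumes "distinct ks" "inj_on f (set ks)"
  shows "count_list (concat (map (\<lambda>k. replicate p (f k)) ks)) x \<le> p"
  using assms
proof (induction ks)
  case (Cons k ks)
  show ?case
  proof (cases "f k = x")
    case True
    then have "x \<notin> set (concat (map (\<lambda>k. replicate p (f k)) ks))" using Cons.prems by auto
    then have "count_list (concat (map (\<lambda>k. replicate p (f k)) ks)) x = 0" by (metis count_list_0_iff)
    then show ?thesis by (simp add: count_list_append count_list_replicate)
  next
    case False
    then show ?thesis using Cons by (simp add: count_list_append count_list_replicate)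
  qed
qed simp

lemma sorted_concat_replicate:
  "sorted (map f ks) \<Longrightarrow> sorted (concat (map (\<lambda>k. replicate p (f k)) ks))"
  by (induction ks) (auto simp: sorted_append)

lemma open_knots_initial:
  assumes "M \<ge> 1" "p \<ge> 1"
  shows "open_knots (initial_knots M p) p"
proof -
  define ks where "ks = concat (map (\<lambda>k. replicate p (real k / real M)) [1..<M])"
  have k: "initial_knots M p = replicate (p + 1) 0 @ ks @ replicate (p + 1) 1"
    by (simp add: initial_knots_def ks_def)
  have rng: "0 < x \<and> x < 1" if "x \<in> set ks" for x using that by (auto simp: ks_def)
  have c: "count_list ks x \<le> p" for x
    unfolding ks_def using assms by (intro count_list_concat_replicate) (auto simp: inj_on_def)
  have c01: "count_list ks 0 = 0" "count_list ks 1 = 0"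
    unfolding count_list_0_iff using rng by force+
  show ?thesis
  proof (rule open_knotsI)
    have "sorted (map (\<lambda>k. real k / real M) [1..<M])"
      by (rule sorted_map_mono[OF sorted_upt]) (auto intro!: mono_onI divide_right_mono)
    then have "sorted ks"
      unfolding ks_def by (rule sorted_concat_replicate)
    then show "sorted (initial_knots M p)"
      unfolding k sorted_append by (auto dest!: rng intro: less_imp_le)
    show "set (initial_knots M p) \<subseteq> {0..1}"
      unfolding k by (auto dest!: rng intro: less_imp_le)
    show "count_list (initial_knots M p) 0 = p + 1" "count_list (initial_knots M p) 1 = p + 1"
      unfolding k count_list_append count_list_replicate using c01 by simp_all
    show "count_list (initial_knots M p) x \<le> p" if "0 < x" "x < 1" for x
      unfolding k count_list_append count_list_replicate using that c[of x] by simp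
  qed (use assms in auto)
qed

section \<open>The transition function and the dual functionals\<close>

text \<open>A summand of a piecewise polynomial that is written as the sum of its jumps. Derivatives
  and integrals can then be taken break by break.\<close>

definition trunc :: "real \<Rightarrow> real poly \<Rightarrow> real \<Rightarrow> real" where
  "trunc c q t = (if c \<le> t then poly q t else 0)"

lemma trunc_eq_max: "poly q c = 0 \<Longrightarrow> trunc c q t = poly q (max c t)"
  by (auto simp: trunc_def max_def)

lemma continuous_on_trunc:
  assumes "poly q c = 0"
  shows "continuous_on S (trunc c q)"
proof -
  have "trunc c q = (\<lambda>t. poly q (max c t))" using trunc_eq_max[OF assms] by blast
  then show ?thesis by (simp only:) (intro continuous_intros)
qed

lemma trunc_has_derivative:
  assumes "t \<noteq> c"
  shows "(trunc c q has_real_derivative trunc c (pderiv q) t) (at t)"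
proof (cases "c < t")
  case True
  have "(poly q has_real_derivative trunc c (pderiv q) t) (at t)"
    using poly_DERIV[of q t] True by (simp add: trunc_def)
  then show ?thesis
    by (rule has_field_derivative_transform_within_open[where S = "{c<..}"])
       (use True in \<open>auto simp: trunc_def\<close>)
next
  case False
  have "((\<lambda>_. 0) has_real_derivative trunc c (pderiv q) t) (at t)"
    using False assms by (simp add: trunc_def)
  then show ?thesis
    by (rule has_field_derivative_transform_within_open[where S = "{..<c}"])
       (use False assms in \<open>auto simp: trunc_def\<close>)
qed

lemma trunc_has_integral:
  assumes "a \<le> x" "a \<le> c" "poly q c = 0"
  shows "(trunc c (pderiv q) has_integral trunc c q x) {a..x}"
proof -
  have "(trunc c (pderiv q) has_integral (trunc c q x - trunc c q a)) {a..x}"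
    using trunc_has_derivative continuous_on_trunc[OF assms(3)] assms(1)
    by (intro fundamental_theorem_of_calculus_interior_strong[of "{c}"])
       (auto simp: has_real_derivative_iff_has_vector_derivative)
  moreover have "trunc c q a = 0" using assms(2,3) by (auto simp: trunc_def)
  ultimately show ?thesis by simp
qed

lemma poly_antiderivative:
  fixes q :: "real poly"
  shows "\<exists>u. pderiv u = q \<and> poly u c = 0"
proof -
  define u where "u = (\<Sum>i\<le>degree q. monom (coeff q i / real (Suc i)) (Suc i))"
  have "pderiv u = (\<Sum>i\<le>degree q. monom (coeff q i) i)"
    unfolding u_def higher_pderiv_sum[of 1, simplified] by (intro sum.cong refl) (simp add: pderiv_monom)
  then have "pderiv u = q" by (simp add: poly_as_sum_of_monoms)
  then have "pderiv (u - [:poly u c:]) = q" by (simp add: pderiv_diff pderiv_pCons)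
  moreover have "poly (u - [:poly u c:]) c = 0" by simp
  ultimately show ?thesis by blast
qed

text \<open>The knots of the perfect B-spline, continued strictly increasingly to all integers.\<close>

definition pknot :: "nat \<Rightarrow> int \<Rightarrow> real" where
  "pknot p i = (if i < 1 then of_int i - 2
     else if i \<le> int p + 2 then cos ((of_nat p + 2 - of_int i) * pi / of_nat (p + 1))
     else of_int i - of_nat p)"

lemma pknot_step: "pknot p i < pknot p (i + 1)"
proof -
  consider "i < 0" | "i = 0" | "1 \<le> i" "i \<le> int p + 1" | "i = int p + 2" | "int p + 2 < i" by linarith
  then show ?thesis
  proof cases
    case 3
    have "real p + 2 - real_of_int i \<le> real p + 1" "real p + 2 - real_of_int i \<ge> 1"
      using 3 by linarith+
    then have "cos ((real p + 2 - real_of_int i) * pi / real (p + 1))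
      < cos ((real p + 2 - real_of_int (i + 1)) * pi / real (p + 1))"
    proof (intro cos_monotone_0_pi)
      have "(real p + 2 - real_of_int i) * pi \<le> pi * real (p + 1)"
        using \<open>real p + 2 - real_of_int i \<le> real p + 1\<close> by (simp add: mult.commute)
      then show "(real p + 2 - real_of_int i) * pi / real (p + 1) \<le> pi"
        by (subst pos_divide_le_eq) auto
    qed (use 3 in \<open>auto intro!: divide_strict_right_mono mult_strict_right_mono divide_nonneg_nonneg mult_nonneg_nonneg\<close>)
    then show ?thesis using 3 by (simp add: pknot_def)
  next
    case 2
    have "pknot p 1 = -1" by (simp add: pknot_def add.commute divide_eq_eq)
    then show ?thesis using 2 by (simp add: pknot_def)
  qed (auto simp: pknot_def)
qed

lemma strict_mono_pknot: "strict_mono (pknot p)"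
proof (rule strict_monoI)
  fix i j :: int assume "i < j"
  then show "pknot p i < pknot p j"
    by (induction rule: int_gr_induct) (use pknot_step less_trans in blast)+
qed

lemma mono_pknot: "mono (pknot p)"
  by (rule strict_mono_mono[OF strict_mono_pknot])

lemma pknot_ends: "pknot p 1 = -1" "pknot p (int p + 2) = 1"
  by (simp_all add: pknot_def add.commute)

lemma pknot_perfect: "i \<in> {1..length (perfect_knots p)} \<Longrightarrow> pknot p (int i) = knot (perfect_knots p) i"
  unfolding perfect_knots_def knot_def
  by (subst nth_map) (auto simp: pknot_def of_nat_diff algebra_simps simp del: upt_Suc)

lemma piece_single_jump:
  assumes "strict_mono \<xi>" "p \<ge> 1"
  shows "lin (\<xi> (j + 1)) ^ p dvd piece \<xi> (j + 1) p k - piece \<xi> j p k"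
  using piece_jump_dvd[of \<xi> j 1 p "\<xi> (j + 1)" k] assms
  by (simp add: strict_mono_mono strict_mono_less)

text \<open>On the first interval of the support only the ascending branch of the recursion
  contributes.\<close>

lemma piece_self:
  "poly (piece \<xi> j p j) t = (\<Prod>i=1..p. (t - \<xi> j) / (\<xi> (j + int i) - \<xi> j))"
  by (induction p) (simp_all add: piece_eq_0 algebra_simps divide_inverse)

lemma perfect_bspline_cell:
  assumes "-1 \<le> t" "t < 1"
  obtains m where "m \<le> p" "pknot p (int m + 1) \<le> t" "t < pknot p (int m + 2)"
    "bspline (perfect_knots p) 1 p t = poly (piece (pknot p) (int m + 1) p 1) t"
proof -
  let ?x = "pknot p"
  have mono: "?x i < ?x j \<longleftrightarrow> i < j" for i j
    using strict_mono_pknot[of p] by (simp add: strict_mono_less)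
  note t = assms
  define m where "m = Max {l. l \<le> p \<and> ?x (int l + 1) \<le> t}"
  have fin: "finite {l. l \<le> p \<and> ?x (int l + 1) \<le> t}" by simp
  have "0 \<in> {l. l \<le> p \<and> ?x (int l + 1) \<le> t}" using t pknot_ends[of p] by simp
  then have "m \<in> {l. l \<le> p \<and> ?x (int l + 1) \<le> t}"
    unfolding m_def using fin by (intro Max_in) auto
  then have m: "m \<le> p" "?x (int m + 1) \<le> t" by auto
  have m': "t < ?x (int m + 2)"
  proof (cases "m = p")
    case True
    then show ?thesis using pknot_ends[of p] t by simp
  next
    case False
    have "Suc m \<notin> {l. l \<le> p \<and> ?x (int l + 1) \<le> t}"
      using Max_ge[OF fin, of "Suc m"] unfolding m_def[symmetric] by auto
    then show ?thesis using False m by (auto simp: add.commute)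
  qed
  have len: "length (perfect_knots p) = p + 2" by (simp add: perfect_knots_def)
  have "bspline (perfect_knots p) 1 p t = poly (piece ?x (int (m + 1)) p (int 1)) t"
    using m m' len mono by (intro bspline_eq_piece mono_pknot pknot_perfect) (auto simp: add.commute)
  then show ?thesis using m m' by (intro that[of m]) (auto simp: add.commute)
qed

text \<open>\<open>V l\<close> is the jump at the l-th break, and partial sums telescope to the
  piece on the current interval. The sum of all jumps is the last piece, which joins the zero
  function at 1 and thus vanishes there to order p.\<close>

lemma perfect_bspline_trunc:
  assumes p: "p \<ge> 1"
  defines "V \<equiv> \<lambda>l. piece (pknot p) (int l + 1) p 1 - piece (pknot p) (int l) p 1"
  shows "lin (pknot p (int l + 1)) ^ p dvd V l"
    and "lin 1 ^ p dvd (\<Sum>l\<le>p. V l)"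
    and "\<And>t. -1 \<le> t \<Longrightarrow> t < 1 \<Longrightarrow> bspline (perfect_knots p) 1 p t = (\<Sum>l\<le>p. trunc (pknot p (int l + 1)) (V l) t)"
proof -
  let ?x = "pknot p"
  have mono: "?x i < ?x j \<longleftrightarrow> i < j" "?x i \<le> ?x j \<longleftrightarrow> i \<le> j" for i j
    using strict_mono_pknot[of p] by (simp_all add: strict_mono_less strict_mono_less_eq)
  show "lin (?x (int l + 1)) ^ p dvd V l"
    unfolding V_def by (rule piece_single_jump[OF strict_mono_pknot p])
  have sum: "(\<Sum>l\<le>m. V l) = piece ?x (int m + 1) p 1" for m
    by (induction m) (simp_all add: V_def piece_eq_0 algebra_simps)
  have "lin (?x (int p + 1 + 1)) ^ p dvd piece ?x (int p + 1 + 1) p 1 - piece ?x (int p + 1) p 1"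
    by (rule piece_single_jump[OF strict_mono_pknot p])
  then show "lin 1 ^ p dvd (\<Sum>l\<le>p. V l)"
    unfolding sum using pknot_ends[of p] by (simp add: piece_eq_0 add.assoc)
  fix t :: real assume t: "-1 \<le> t" "t < 1"
  obtain m where m: "m \<le> p" "?x (int m + 1) \<le> t" and m': "t < ?x (int m + 2)"
    and b: "bspline (perfect_knots p) 1 p t = poly (piece ?x (int m + 1) p 1) t"
    by (rule perfect_bspline_cell[OF t])
  note b
  also have "poly (piece ?x (int m + 1) p 1) t = (\<Sum>l\<le>m. poly (V l) t)"
    using sum[of m] by (simp add: poly_sum[symmetric] add.commute)
  also have "\<dots> = (\<Sum>l\<le>m. trunc (?x (int l + 1)) (V l) t)"
  proof (intro sum.cong refl)
    fix l assume "l \<in> {..m}"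
    then have "?x (int l + 1) \<le> ?x (int m + 1)" by (simp add: mono)
    then show "poly (V l) t = trunc (?x (int l + 1)) (V l) t" using m by (simp add: trunc_def)
  qed
  also have "\<dots> = (\<Sum>l\<le>p. trunc (?x (int l + 1)) (V l) t)"
  proof (rule sum.mono_neutral_left)
    show "\<forall>l\<in>{..p} - {..m}. trunc (?x (int l + 1)) (V l) t = 0"
    proof
      fix l assume "l \<in> {..p} - {..m}"
      then have "?x (int m + 2) \<le> ?x (int l + 1)" by (simp add: mono)
      then show "trunc (?x (int l + 1)) (V l) t = 0" using m' by (simp add: trunc_def)
    qed
  qed (use m in auto)
  finally show "bspline (perfect_knots p) 1 p t = (\<Sum>l\<le>p. trunc (?x (int l + 1)) (V l) t)" .
qed

text \<open>Antiderivatives of the jumps that vanish at their breaks gain one order of divisibility.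
  The same happens at 1: the derivative of \<Sum> U_l - 1 vanishes there to order p, and its value
  vanishes by the normalization of the perfect B-spline.\<close>

lemma transition_fun_trunc:
  assumes p: "p \<ge> 1"
  obtains x :: "nat \<Rightarrow> real" and U :: "nat \<Rightarrow> real poly" where
    "\<And>l. l \<le> p \<Longrightarrow> -1 \<le> x l \<and> x l < 1"
    "\<And>l. lin (x l) ^ Suc p dvd U l"
    "lin 1 ^ Suc p dvd (\<Sum>l\<le>p. U l) - 1"
    "\<And>t. -1 \<le> t \<Longrightarrow> t \<le> 1 \<Longrightarrow> transition_fun p t = (\<Sum>l\<le>p. trunc (x l) (U l) t)"
proof -
  define x where "x l = pknot p (int l + 1)" for l
  define V where "V l = piece (pknot p) (int l + 1) p 1 - piece (pknot p) (int l) p 1" for l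
  note V = perfect_bspline_trunc[OF p, folded x_def V_def]
  have x: "-1 \<le> x l \<and> x l < 1" if "l \<le> p" for l
    using that strict_mono_less[OF strict_mono_pknot[of p], of "int l + 1" "int p + 2"]
      strict_mono_less_eq[OF strict_mono_pknot[of p], of 1 "int l + 1"] pknot_ends[of p]
    by (simp add: x_def)
  have "\<forall>l. \<exists>u. pderiv u = V l \<and> poly u (x l) = 0"
    using poly_antiderivative by blast
  then obtain u where u: "\<And>l. pderiv (u l) = V l" "\<And>l. poly (u l) (x l) = 0" by metis
  define b where "b = bspline (perfect_knots p) 1 p"
  define S where "S t = (\<Sum>l\<le>p. trunc (x l) (V l) t)" for t
  have S_b: "S y = b y" if "-1 \<le> y" "y < 1" for y
    unfolding b_def S_def using V(3)[OF that] by (rule sym)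
  have S_integral: "(S has_integral (\<Sum>l\<le>p. trunc (x l) (u l) t)) {-1..t}" if "-1 \<le> t" for t
    unfolding S_def[abs_def] using that x u
    by (intro has_integral_sum) (auto simp flip: u(1) intro!: trunc_has_integral)
  have b_integral: "(b has_integral (\<Sum>l\<le>p. trunc (x l) (u l) t)) {-1..t}" if "-1 \<le> t" "t \<le> 1" for t
  \<comment> \<open>The representation by jumps is known only to the left of 1; a single point does
    not affect the integral.\<close>
  proof (rule has_integral_spike_finite[OF _ _ S_integral])
    show "b y = S y" if "y \<in> {-1..t} - {1}" for y
      using that \<open>t \<le> 1\<close> by (intro S_b[symmetric]) auto
  qed (use that in auto)
  define I where "I = (\<Sum>l\<le>p. poly (u l) 1)"
  have I: "(\<Sum>l\<le>p. trunc (x l) (u l) 1) = I"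
    unfolding I_def using x by (intro sum.cong refl) (auto simp: trunc_def intro: less_imp_le)
  have S_cont: "continuous_on {-1..1} S"
    unfolding S_def using lin_power_dvd_imp_higher_pderiv_0[OF V(1), of 0] p
    by (intro continuous_on_sum continuous_on_trunc) auto
  have S_nonneg: "0 \<le> S y" if "y \<in> {-1..1}" for y
  proof (cases "y = 1")
    case True
    have "S 1 = poly (\<Sum>l\<le>p. V l) 1"
      unfolding S_def poly_sum using x by (intro sum.cong refl) (auto simp: trunc_def intro: less_imp_le)
    then show ?thesis using lin_power_dvd_imp_higher_pderiv_0[OF V(2), of 0] p True by simp
  next
    case False
    then have y: "-1 \<le> y" "y < 1" using that by auto
    obtain m where m: "pknot p (int m + 1) \<le> y" "y < pknot p (int m + 2)"
      "b y = poly (piece (pknot p) (int m + 1) p 1) y"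
      unfolding b_def by (rule perfect_bspline_cell[OF y])
    show ?thesis unfolding S_b[OF y] m(3)
      using m by (intro piece_nonneg mono_pknot) (simp_all add: add.assoc)
  qed
  \<comment> \<open>The midpoint of the first knot interval: there the B-spline is the explicit
    product of \<open>piece_self\<close> and hence positive. With nonnegativity this excludes that
    the normalizing integral I is 0.\<close>
  define y0 where "y0 = (pknot p 1 + pknot p 2) / 2"
  have "pknot p 1 < pknot p 2" "pknot p 2 \<le> pknot p (int p + 2)"
    using strict_mono_pknot[of p] by (simp_all add: strict_mono_less strict_mono_less_eq)
  then have y0: "-1 < y0" "y0 < 1" "y0 < pknot p 2"
    using pknot_ends[of p] by (auto simp: y0_def)
  obtain m where m: "m \<le> p" "pknot p (int m + 1) \<le> y0"
    "b y0 = poly (piece (pknot p) (int m + 1) p 1) y0"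
    unfolding b_def by (rule perfect_bspline_cell[of y0 p]) (use y0 in auto)
  have "m = 0"
    using m(2) y0(3) strict_mono_less_eq[OF strict_mono_pknot[of p], of 2 "int m + 1"] by (cases m) auto
  then have "S y0 = (\<Prod>i=1..p. (y0 - pknot p 1) / (pknot p (1 + int i) - pknot p 1))"
    using S_b[of y0] y0 m piece_self[of "pknot p" 1 p y0] by simp
  also have "\<dots> > 0"
  proof (intro prod_pos ballI divide_pos_pos)
    show "0 < y0 - pknot p 1" using y0 pknot_ends[of p] by simp
    show "0 < pknot p (1 + int i) - pknot p 1" if "i \<in> {1..p}" for i
      using that strict_mono_less[OF strict_mono_pknot[of p], of 1 "1 + int i"] by simp
  qed
  finally have "S y0 > 0" .
  moreover have "integral {-1..1} S = I"
    using S_integral[of 1] I by (simp add: integral_unique)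
  ultimately have "I \<noteq> 0"
    using integral_eq_0_iff[OF S_cont _ S_nonneg] y0 by force
  define U where "U l = smult (1 / I) (u l)" for l
  show ?thesis
  proof
    show "-1 \<le> x l \<and> x l < 1" if "l \<le> p" for l using x that .
    show "lin (x l) ^ Suc p dvd U l" for l
      unfolding U_def using u V(1) lin_power_dvd_by_pderiv[of "x l" p "u l"] by (auto intro: dvd_smult)
    have "pderiv ((\<Sum>l\<le>p. U l) - 1) = smult (1 / I) (\<Sum>l\<le>p. V l)"
      unfolding U_def by (simp add: pderiv_diff higher_pderiv_sum[of 1, simplified] pderiv_smult u smult_sum_right)
    then have "lin 1 ^ p dvd pderiv ((\<Sum>l\<le>p. U l) - 1)" using V(2) by (simp add: dvd_smult)
    moreover have "poly ((\<Sum>l\<le>p. U l) - 1) 1 = 0"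
      using \<open>I \<noteq> 0\<close> by (simp add: U_def poly_sum I_def flip: sum_divide_distrib)
    ultimately show "lin 1 ^ Suc p dvd (\<Sum>l\<le>p. U l) - 1" by (rule lin_power_dvd_by_pderiv)
    fix t :: real assume t: "-1 \<le> t" "t \<le> 1"
    have "transition_fun p t = integral {-1..t} (\<lambda>y. b y / I)"
      unfolding transition_fun_def perfect_bspline_def[abs_def]
      using b_integral[of 1, unfolded I] by (simp add: b_def integral_unique)
    also have "\<dots> = (\<Sum>l\<le>p. trunc (x l) (u l) t) / I"
      using b_integral[OF t] by (simp add: integral_unique)
    also have "\<dots> = (\<Sum>l\<le>p. trunc (x l) (U l) t)"
      unfolding sum_divide_distrib by (intro sum.cong refl) (simp add: trunc_def U_def)
    finally show "transition_fun p t = (\<Sum>l\<le>p. trunc (x l) (U l) t)" .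
  qed
qed

lemma pcompose_lin: "pcompose (lin x) q = q - [:x:]"
  by (simp add: pcompose_pCons)

lemma trunc_affine:
  assumes "0 < m" "m * c + d = x"
  shows "trunc x q (m * t + d) = trunc c (pcompose q [:d, m:]) t"
proof -
  have "m * t + d = m * (t - c) + x" using assms(2) by (simp add: algebra_simps)
  then have "x \<le> m * t + d \<longleftrightarrow> c \<le> t" using assms(1) by (simp add: zero_le_mult_iff)
  then show ?thesis by (simp add: trunc_def poly_pcompose add.commute mult.commute)
qed

lemma lin_power_dvd_pcompose:
  assumes "lin x ^ k dvd q" "m * c + d = x"
  shows "lin c ^ k dvd pcompose q [:d, m:]"
proof -
  obtain r where q: "q = lin x ^ k * r" using assms(1) by (rule dvdE)
  have "pcompose (lin x) [:d, m:] = smult m (lin c)"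
    using assms(2) by (simp add: pcompose_lin algebra_simps)
  moreover have "pcompose (lin x ^ k) s = pcompose (lin x) s ^ k" for s
    by (induction k) (simp_all add: pcompose_mult pcompose_1 del: mult_pCons_left)
  ultimately have "pcompose q [:d, m:] = smult m (lin c) ^ k * pcompose r [:d, m:]"
    by (simp only: q pcompose_mult)
  also have "\<dots> = smult (m ^ k) (lin c ^ k) * pcompose r [:d, m:]"
    by (simp only: smult_power)
  finally show ?thesis by (simp only: dvd_mult2 dvd_smult dvd_refl)
qed

text \<open>\<open>deriv\<close> at a point depends on a neighbourhood, so the induction carries the
  formula along on an open set free of breaks.\<close>

lemma deriv_funpow_trunc_sum:
  assumes "finite L" "open T" "\<And>l. l \<in> L \<Longrightarrow> c l \<notin> T" "\<And>t. t \<in> T \<Longrightarrow> f t = (\<Sum>l\<in>L. trunc (c l) (q l) t)"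
    and "t \<in> T"
  shows "(deriv ^^ m) f t = (\<Sum>l\<in>L. trunc (c l) ((pderiv ^^ m) (q l)) t)"
  using assms(5)
proof (induction m arbitrary: t)
  case 0
  then show ?case using assms(4) by simp
next
  case (Suc m)
  have "((\<lambda>t. \<Sum>l\<in>L. trunc (c l) ((pderiv ^^ m) (q l)) t) has_real_derivative
      (\<Sum>l\<in>L. trunc (c l) (pderiv ((pderiv ^^ m) (q l))) t)) (at t)"
    using assms(3) Suc.prems by (intro DERIV_sum trunc_has_derivative) auto
  then have "((deriv ^^ m) f has_real_derivative
      (\<Sum>l\<in>L. trunc (c l) (pderiv ((pderiv ^^ m) (q l))) t)) (at t)"
    by (rule has_field_derivative_transform_within_open[OF _ assms(2) Suc.prems]) (simp add: Suc.IH)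
  then show ?case by (simp add: DERIV_imp_deriv)
qed

section \<open>The dual functionals of an open knot vector\<close>

context open_knots
begin

definition right_end :: "nat \<Rightarrow> real" where
  "right_end i = \<xi> (int i + int p + 1)"

definition dual_poly :: "nat \<Rightarrow> real poly" where
  "dual_poly i = smult (1 / fact p) (knot_poly \<xi> p (int i))"

text \<open>The mirror image of \<open>next_cell\<close>: the nonempty interval that ends at the
  knot \<xi>_e, whatever its multiplicity. The last property locates every strictly smaller knot at
  or before the start of this interval.\<close>

lemma left_cell:
  assumes "0 < \<xi> e"
  obtains j where "j \<in> cells" "j < e" "\<xi> (j + 1) = \<xi> e" "\<And>l. \<xi> l < \<xi> e \<Longrightarrow> l \<le> j"
proof -
  define J where "J = {l \<in> {int p + 1..int n}. \<xi> l < \<xi> e}"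
  have fin: "finite J" unfolding J_def by (rule finite_subset[of _ "{int p + 1..int n}"]) auto
  have ne: "int p + 1 \<in> J" using n_ge assms \<xi>_first[of "int p + 1"] by (simp add: J_def)
  define j where "j = Max J"
  have j: "j \<in> J" unfolding j_def using fin ne by (intro Max_in) auto
  then have lt: "\<xi> j < \<xi> e" by (simp add: J_def)
  have "\<xi> e \<le> \<xi> (j + 1)"
  proof (cases "j = int n")
    case True
    then show ?thesis using \<xi>_last[of "int n + 1"] \<xi>_bounds(2)[of e] by simp
  next
    case False
    have "j + 1 \<notin> J" using Max_ge[OF fin, of "j + 1"] unfolding j_def[symmetric] by auto
    then show ?thesis using False j by (auto simp: J_def)
  qed
  moreover have je: "j < e" using lt \<xi>_le[of e j] by force
  then have "\<xi> (j + 1) \<le> \<xi> e" by (intro \<xi>_le) simp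
  ultimately have eq: "\<xi> (j + 1) = \<xi> e" by simp
  have max: "l \<le> j" if "\<xi> l < \<xi> e" for l
  proof (cases "l \<in> {int p + 1..int n}")
    case True
    then show ?thesis using Max_ge[OF fin, of l] that by (simp add: J_def j_def)
  next
    case False
    moreover have "\<not> int n + 1 \<le> l" using \<xi>_last[of l] \<xi>_bounds(2)[of e] that by auto
    ultimately have "l \<le> int p + 1" by auto
    then show ?thesis using j by (simp add: J_def)
  qed
  have "j \<in> cells" using j lt eq by (simp add: cells_def J_def)
  then show ?thesis using je eq max by (rule that)
qed

lemma cell_gap:
  assumes "j \<in> cells" "j + int r \<in> cells" "\<And>i. i \<in> {1..r} \<Longrightarrow> \<xi> (j + int i) = \<tau>"
  shows "r \<le> p"
proof (rule ccontr)
  assume "\<not> r \<le> p"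
  then have "\<xi> (j + int (p + 1)) = \<tau>" "\<xi> (j + int 1) = \<tau>" by (intro assms(3); simp)+
  moreover have "\<xi> (j + 1) < \<xi> (j + 1 + int p)"
    using cellsD[OF assms(1)] cellsD[OF assms(2)] \<open>\<not> r \<le> p\<close> p_pos by (intro \<xi>_gap) auto
  ultimately show False by (simp add: algebra_simps)
qed

lemma lin_power_dvd_knot_poly:
  assumes "int i \<le> j" "j + int r \<le> int i + int p" "\<And>s. s \<in> {1..r} \<Longrightarrow> \<xi> (j + int s) = \<tau>"
  shows "lin \<tau> ^ r dvd knot_poly \<xi> p (int i)"
proof -
  define d where "d = nat (j - int i)"
  have d: "j = int i + int d" "d + r \<le> p" using assms(1,2) by (auto simp: d_def)
  have "(\<Prod>s\<in>{d + 1..d + r}. lin (\<xi> (int i + int s))) = (\<Prod>s\<in>{d + 1..d + r}. lin \<tau>)"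
  proof (intro prod.cong refl)
    fix s assume "s \<in> {d + 1..d + r}"
    then have "s - d \<in> {1..r}" "d \<le> s" by auto
    then show "lin (\<xi> (int i + int s)) = lin \<tau>"
      using assms(3)[of "s - d"] d by (simp add: of_nat_diff algebra_simps)
  qed
  also have "\<dots> = lin \<tau> ^ r" by simp
  moreover have "(\<Prod>s\<in>{d + 1..d + r}. lin (\<xi> (int i + int s))) dvd knot_poly \<xi> p (int i)"
    unfolding knot_poly_def using d by (intro prod_dvd_prod_subset) auto
  ultimately show ?thesis by metis
qed

text \<open>The piece has degree at most p, so by \<open>pderiv_dbf\<close> the pairing is a
  primitive of the integrand.\<close>

lemma cell_integral:
  assumes j: "j \<in> cells" and k: "1 \<le> k" "k \<le> n" and "\<xi> j \<le> c" "c \<le> \<xi> (j + 1)"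
  shows "((\<lambda>t. bspline \<Xi> k p t * poly ((pderiv ^^ Suc p) E) t) has_integral
    poly (dbf p (piece \<xi> j p (int k)) E) (\<xi> (j + 1)) - poly (dbf p (piece \<xi> j p (int k)) E) c) {c..\<xi> (j + 1)}"
proof -
  let ?P = "piece \<xi> j p (int k)"
  have "pderiv (dbf p ?P E) = ?P * (pderiv ^^ Suc p) E"
    unfolding pderiv_dbf using degree_piece[of \<xi> j p "int k"]
    by (simp add: higher_pderiv_eq_0 del: funpow.simps)
  then have D: "(poly (dbf p ?P E) has_vector_derivative poly ?P t * poly ((pderiv ^^ Suc p) E) t) (at t)" for t
    using poly_DERIV[of "dbf p ?P E" t]
    by (simp add: has_real_derivative_iff_has_vector_derivative[symmetric] del: funpow.simps)
  have "((\<lambda>t. poly ?P t * poly ((pderiv ^^ Suc p) E) t) has_integral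
      poly (dbf p ?P E) (\<xi> (j + 1)) - poly (dbf p ?P E) c) {c..\<xi> (j + 1)}"
    by (rule fundamental_theorem_of_calculus[OF assms(5) has_vector_derivative_at_within[OF D]])
  then show ?thesis
    by (rule has_integral_eq[rotated]) (use assms in \<open>simp add: bspline_on_cell[OF j _ _ k]\<close>)
qed

text \<open>Integrating by parts on every knot interval, the boundary terms at an interior knot \<open>\<tau>\<close> of
  multiplicity \<open>r\<close> cancel: the jump of the B-spline vanishes there to order \<open>p + 1 - r\<close>, and \<open>E\<close>
  to order \<open>r\<close>.\<close>

lemma dual_integral_to_cell:
  assumes k: "1 \<le> k" "k \<le> n" and E: "lin c ^ Suc p dvd E" "knot_poly \<xi> p (int i) dvd E"
    and c: "\<xi> (int i) \<le> c"
    and j: "j \<in> cells" "int i \<le> j" "j \<le> int i + int p" "c < \<xi> (j + 1)"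
  shows "((\<lambda>t. bspline \<Xi> k p t * poly ((pderiv ^^ Suc p) E) t) has_integral
    poly (dbf p (piece \<xi> j p (int k)) E) (\<xi> (j + 1))) {c..\<xi> (j + 1)}"
  using j
proof (induction "nat j" arbitrary: j rule: less_induct)
  case less
  let ?D = "\<lambda>j. poly (dbf p (piece \<xi> j p (int k)) E)"
  let ?f = "\<lambda>t. bspline \<Xi> k p t * poly ((pderiv ^^ Suc p) E) t"
  show ?case
  proof (cases "\<xi> j \<le> c")
    case True
    \<comment> \<open>The integration starts in this cell, where E vanishes at c to order p + 1;
      this kills the whole pairing at the lower limit.\<close>
    have "?D j c = 0" by (rule poly_dbf_lin_dvd[where q = 0, OF _ E(1)]) auto
    then show ?thesis
      using cell_integral[OF less.prems(1) k True, of E] less.prems(4) by (simp del: funpow.simps)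
  next
    case False
    then have "0 < \<xi> j" using c \<xi>_bounds(1)[of "int i"] by linarith
    then obtain j0 where j0: "j0 \<in> cells" "j0 < j" "\<xi> (j0 + 1) = \<xi> j" "\<And>l. \<xi> l < \<xi> j \<Longrightarrow> l \<le> j0"
      by (rule left_cell) (rule that)
    have i: "int i \<le> j0" using False c by (intro j0(4)) simp
    have IH: "(?f has_integral ?D j0 (\<xi> j)) {c..\<xi> j}"
      using less.hyps[of j0] less.prems j0(1-3) i cellsD(2)[OF j0(1)] False by simp
    have "(?f has_integral ?D j (\<xi> (j + 1)) - ?D j (\<xi> j)) {\<xi> j..\<xi> (j + 1)}"
      using cellsD(1)[OF less.prems(1)] by (intro cell_integral less.prems k) simp_all
    then have "(?f has_integral ?D j0 (\<xi> j) + (?D j (\<xi> (j + 1)) - ?D j (\<xi> j))) {c..\<xi> (j + 1)}"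
      using False cellsD(1)[OF less.prems(1)] by (intro has_integral_combine[OF _ _ IH]) simp_all
    moreover have "?D j (\<xi> j) = ?D j0 (\<xi> j)"
    proof -
      define r where "r = nat (j - j0)"
      have r: "j = j0 + int r" "1 \<le> r" using j0(2) by (auto simp: r_def)
      have \<tau>: "\<xi> (j0 + int s) = \<xi> j" if "s \<in> {1..r}" for s
        using \<xi>_le[of "j0 + 1" "j0 + int s"] \<xi>_le[of "j0 + int s" j] that r j0(3) by simp
      have "r \<le> p" using j0(1) less.prems(1) \<tau> unfolding r(1) by (rule cell_gap)
      have "lin (\<xi> j) ^ (p + 1 - r) dvd piece \<xi> (j0 + int r) p (int k) - piece \<xi> j0 p (int k)"
        by (rule piece_jump_dvd[OF mono_\<xi> cellsD(1)[OF j0(1)] cellsD(1)[OF less.prems(1), unfolded r(1)]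
              \<open>r \<le> p\<close> \<tau>])
      moreover have "lin (\<xi> j) ^ r dvd E"
        using lin_power_dvd_knot_poly[OF i less.prems(3)[unfolded r(1)] \<tau>] E(2) by (rule dvd_trans)
      ultimately have "poly (dbf p (piece \<xi> (j0 + int r) p (int k) - piece \<xi> j0 p (int k)) E) (\<xi> j) = 0"
        using \<open>r \<le> p\<close> by (intro poly_dbf_lin_dvd[of _ "p + 1 - r" _ r]) simp_all
      then show ?thesis using r(1) by (simp add: dbf_diff_left)
    qed
    ultimately show ?thesis by simp
  qed
qed

lemma prod_knots_dual_poly:
  assumes "1 \<le> i" "i \<le> n"
  shows "(\<Prod>j=1..p. t - knot \<Xi> (i + j)) / fact p = poly (dual_poly i) t"
proof -
  have "(\<Prod>j=1..p. t - knot \<Xi> (i + j)) = poly (knot_poly \<xi> p (int i)) t"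
    unfolding knot_poly_def poly_prod
    by (intro prod.cong refl) (use assms \<xi>_eq[of "i + _"] in auto)
  then show ?thesis by (simp add: dual_poly_def)
qed

text \<open>The jump representation of the transition function is carried to the support by an
  affine map and multiplied by the dual polynomial. The transition function reaches 1 to order p +
  1, so at the right end \<Sum> E_l agrees with \<open>dual_poly i\<close> to that order.\<close>

lemma dual_kernel:
  assumes i: "1 \<le> i" "i \<le> n"
  obtains c :: "nat \<Rightarrow> real" and E :: "nat \<Rightarrow> real poly" where
    "\<And>l. l \<le> p \<Longrightarrow> \<xi> (int i) \<le> c l \<and> c l < right_end i"
    "\<And>l. lin (c l) ^ Suc p dvd E l" "\<And>l. knot_poly \<xi> p (int i) dvd E l"
    "lin (right_end i) ^ Suc p dvd (\<Sum>l\<le>p. E l) - dual_poly i"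
    "\<And>t. t \<in> {\<xi> (int i)<..<right_end i} - c ` {..p} \<Longrightarrow>
       (deriv ^^ Suc p) (dual_psi \<Xi> p i) t = (\<Sum>l\<le>p. trunc (c l) ((pderiv ^^ Suc p) (E l)) t)"
proof -
  define a where "a = \<xi> (int i)"
  define b where "b = right_end i"
  have ab: "a < b" unfolding a_def b_def right_end_def by (rule support_nonempty[OF i])
  obtain x :: "nat \<Rightarrow> real" and U where x: "\<And>l. l \<le> p \<Longrightarrow> -1 \<le> x l \<and> x l < 1"
    and U: "\<And>l. lin (x l) ^ Suc p dvd U l" "lin 1 ^ Suc p dvd (\<Sum>l\<le>p. U l) - 1"
    and g: "\<And>t. -1 \<le> t \<Longrightarrow> t \<le> 1 \<Longrightarrow> transition_fun p t = (\<Sum>l\<le>p. trunc (x l) (U l) t)"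
    by (rule transition_fun_trunc[OF p_pos]) (rule that)
  \<comment> \<open>Slope m and offset d of the affine map from [a, b] onto [-1, 1] that occurs in
    \<open>dual_psi\<close>.\<close>
  define m where "m = 2 / (b - a)"
  define d where "d = - (a + b) / (b - a)"
  have m: "m > 0" using ab by (simp add: m_def)
  define c where "c l = (x l - d) / m" for l
  have c: "m * c l + d = x l" for l using m by (simp add: c_def)
  have aff: "(2 * t - a - b) / (b - a) = m * t + d" for t
    by (simp add: m_def d_def diff_divide_distrib add_divide_distrib)
  have ends: "m * a + d = -1" "m * b + d = 1"
    unfolding aff[symmetric] using ab by (simp_all add: divide_eq_eq)
  have mono: "s \<le> t \<longleftrightarrow> m * s + d \<le> m * t + d" "s < t \<longleftrightarrow> m * s + d < m * t + d" for s t
    using m by simp_all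
  define E where "E l = pcompose (U l) [:d, m:] * dual_poly i" for l
  have kn: "knot \<Xi> i = a" "knot \<Xi> (i + p + 1) = b"
    using i \<xi>_eq[of i] \<xi>_eq[of "i + p + 1"] by (simp_all add: a_def b_def right_end_def add.commute add.left_commute)
  show ?thesis
  proof (rule that[of c E, folded a_def b_def])
    show "a \<le> c l \<and> c l < b" if "l \<le> p" for l
      unfolding mono(1)[of a] mono(2)[of _ b] c ends using x[OF that] .
    show "lin (c l) ^ Suc p dvd E l" for l
      unfolding E_def by (rule dvd_mult2[OF lin_power_dvd_pcompose[OF U(1) c]])
    show "knot_poly \<xi> p (int i) dvd E l" for l
      unfolding E_def dual_poly_def by (intro dvd_mult dvd_smult dvd_refl)
    have "(\<Sum>l\<le>p. E l) - dual_poly i = pcompose ((\<Sum>l\<le>p. U l) - 1) [:d, m:] * dual_poly i"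
      by (simp add: E_def sum_distrib_right sum_distrib_left pcompose_sum pcompose_diff pcompose_1 algebra_simps)
    moreover have "lin b ^ Suc p dvd pcompose ((\<Sum>l\<le>p. U l) - 1) [:d, m:]"
      by (rule lin_power_dvd_pcompose[OF U(2) ends(2)])
    ultimately show "lin b ^ Suc p dvd (\<Sum>l\<le>p. E l) - dual_poly i" by (metis dvd_mult2)
    fix t assume t: "t \<in> {a<..<b} - c ` {..p}"
    show "(deriv ^^ Suc p) (dual_psi \<Xi> p i) t = (\<Sum>l\<le>p. trunc (c l) ((pderiv ^^ Suc p) (E l)) t)"
    proof (rule deriv_funpow_trunc_sum[where T = "{a<..<b} - c ` {..p}"])
      show "open ({a<..<b} - c ` {..p})" by (intro open_Diff finite_imp_closed) auto
      fix s assume s: "s \<in> {a<..<b} - c ` {..p}"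
      have "m * a + d \<le> m * s + d" "m * s + d \<le> m * b + d"
        unfolding mono(1)[symmetric] using s by auto
      then have "-1 \<le> m * s + d" "m * s + d \<le> 1" unfolding ends .
      then have "dual_psi \<Xi> p i s = (\<Sum>l\<le>p. trunc (x l) (U l) (m * s + d)) * poly (dual_poly i) s"
        unfolding dual_psi_def kn aff prod_knots_dual_poly[OF i] by (simp add: g)
      also have "\<dots> = (\<Sum>l\<le>p. trunc (c l) (E l) s)"
        unfolding sum_distrib_right trunc_affine[OF m c]
        by (intro sum.cong refl) (simp add: trunc_def E_def)
      finally show "dual_psi \<Xi> p i s = (\<Sum>l\<le>p. trunc (c l) (E l) s)" .
    qed (use t in auto)
  qed
qed

text \<open>The kernel is replaced by p + 1 polynomial kernels, each on an interval that ends with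
  the support. This yields existence for every continuous function without mention of
  \<open>deriv\<close>. For a B-spline each integral is a pairing at the right end, and their sum is
  the biorthogonal pairing.\<close>

lemma dual_functional_representation:
  assumes i: "1 \<le> i" "i \<le> n"
  obtains c :: "nat \<Rightarrow> real" and q :: "nat \<Rightarrow> real poly" where
    "\<And>l. l \<le> p \<Longrightarrow> 0 \<le> c l \<and> c l < right_end i"
    "\<And>w. continuous_on {0..1} w \<Longrightarrow> (dual_integrand \<Xi> p i w has_integral
       (\<Sum>l\<le>p. integral {c l..right_end i} (\<lambda>t. w t * poly (q l) t))) {knot \<Xi> i..knot \<Xi> (i + p + 1)}"
    "\<And>k. 1 \<le> k \<Longrightarrow> k \<le> n \<Longrightarrow>
       (\<Sum>l\<le>p. integral {c l..right_end i} (\<lambda>t. bspline \<Xi> k p t * poly (q l) t)) = (if k = i then 1 else 0)"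
proof -
  define a where "a = \<xi> (int i)"
  define b where "b = right_end i"
  obtain c :: "nat \<Rightarrow> real" and E where c: "\<And>l. l \<le> p \<Longrightarrow> a \<le> c l \<and> c l < b"
    and E: "\<And>l. lin (c l) ^ Suc p dvd E l" "\<And>l. knot_poly \<xi> p (int i) dvd E l"
    and sum: "lin b ^ Suc p dvd (\<Sum>l\<le>p. E l) - dual_poly i"
    and kernel: "\<And>t. t \<in> {a<..<b} - c ` {..p} \<Longrightarrow>
       (deriv ^^ Suc p) (dual_psi \<Xi> p i) t = (\<Sum>l\<le>p. trunc (c l) ((pderiv ^^ Suc p) (E l)) t)"
    using dual_kernel[OF i, folded a_def b_def] by blast
  define q where "q l = (pderiv ^^ Suc p) (E l)" for l
  have ab: "0 \<le> a" "b \<le> 1" "a < b"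
    using \<xi>_bounds support_nonempty[OF i] by (simp_all add: a_def b_def right_end_def)
  have kn: "knot \<Xi> i = a" "knot \<Xi> (i + p + 1) = b"
    using i \<xi>_eq[of i] \<xi>_eq[of "i + p + 1"]
    by (simp_all add: a_def b_def right_end_def add.commute add.left_commute)
  show ?thesis
  proof (rule that[of c q, folded b_def])
    show "0 \<le> c l \<and> c l < b" if "l \<le> p" for l using c[OF that] ab by auto
    fix w :: "real \<Rightarrow> real" assume w: "continuous_on {0..1} w"
    have "((\<lambda>t. w t * trunc (c l) (q l) t) has_integral integral {c l..b} (\<lambda>t. w t * poly (q l) t)) {a..b}"
      if l: "l \<in> {..p}" for l
    proof -
      have sub: "{c l..b} \<subseteq> {0..1}" "{c l..b} \<subseteq> {a..b}" using c[of l] l ab by auto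
      have "(\<lambda>t. w t * poly (q l) t) integrable_on {c l..b}"
        by (intro integrable_continuous_real continuous_intros continuous_on_subset[OF w] sub)
      then have "((\<lambda>t. w t * poly (q l) t) has_integral integral {c l..b} (\<lambda>t. w t * poly (q l) t)) {c l..b}"
        by (rule integrable_integral)
      then have "((\<lambda>t. if t \<in> {c l..b} then w t * poly (q l) t else 0) has_integral
          integral {c l..b} (\<lambda>t. w t * poly (q l) t)) {a..b}"
        by (subst has_integral_restrict[OF sub(2)])
      then show ?thesis by (rule has_integral_eq[rotated]) (auto simp: trunc_def)
    qed
    then have "((\<lambda>t. \<Sum>l\<le>p. w t * trunc (c l) (q l) t) has_integral
        (\<Sum>l\<le>p. integral {c l..b} (\<lambda>t. w t * poly (q l) t))) {a..b}"
      by (intro has_integral_sum) auto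
    then show "(dual_integrand \<Xi> p i w has_integral
        (\<Sum>l\<le>p. integral {c l..b} (\<lambda>t. w t * poly (q l) t))) {knot \<Xi> i..knot \<Xi> (i + p + 1)}"
      unfolding kn
    \<comment> \<open>At the ends of the support and at the breaks nothing is known about
      \<open>deriv\<close>; these are finitely many points.\<close>
    proof (rule has_integral_spike_finite[of "{a, b} \<union> c ` {..p}", rotated 2])
      fix t assume "t \<in> {a..b} - ({a, b} \<union> c ` {..p})"
      then have "t \<in> {a<..<b} - c ` {..p}" by auto
      from kernel[OF this] show "dual_integrand \<Xi> p i w t = (\<Sum>l\<le>p. w t * trunc (c l) (q l) t)"
        by (simp add: dual_integrand_def q_def sum_distrib_left)
    qed auto
  next
    fix k assume k: "1 \<le> k" "k \<le> n"
    have b: "\<xi> (int i + int p + 1) = b" by (simp add: b_def right_end_def)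
    with ab have "0 < \<xi> (int i + int p + 1)" by simp
    \<comment> \<open>The last cell inside the support; its right end is b even if b is a multiple
      knot.\<close>
    then obtain j where j: "j \<in> cells" "j < int i + int p + 1"
      "\<xi> (j + 1) = \<xi> (int i + int p + 1)" "\<And>l. \<xi> l < \<xi> (int i + int p + 1) \<Longrightarrow> l \<le> j"
      by (rule left_cell) (rule that)
    note j = j(1,2) j(3,4)[unfolded b]
    have ij: "int i \<le> j" using ab by (intro j(4)) (simp add: a_def)
    have "integral {c l..b} (\<lambda>t. bspline \<Xi> k p t * poly (q l) t)
        = poly (dbf p (piece \<xi> j p (int k)) (E l)) b" if "l \<in> {..p}" for l
      unfolding q_def j(3)[symmetric] using c[of l] that j ij
      by (intro integral_unique dual_integral_to_cell[OF k E]) (simp_all add: a_def)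
    then have "(\<Sum>l\<le>p. integral {c l..b} (\<lambda>t. bspline \<Xi> k p t * poly (q l) t))
        = poly (dbf p (piece \<xi> j p (int k)) (\<Sum>l\<le>p. E l)) b"
      by (simp add: dbf_sum_right poly_sum)
    \<comment> \<open>\<Sum> E_l and the dual polynomial agree at b to order p + 1, so the pairing
      does not distinguish them.\<close>
    also have "\<dots> = poly (dbf p (piece \<xi> j p (int k)) (dual_poly i)) b"
      using poly_dbf_lin_dvd[OF _ sum, of 0 "piece \<xi> j p (int k)" p] by (simp add: dbf_diff_right)
    also have "\<dots> = (if k = i then 1 else 0)"
      using dbf_piece_knot_poly[OF mono_\<xi> cellsD(1)[OF j(1)], of "int i" p "int k" b] ij j(2)
      by (simp add: dual_poly_def dbf_smult_right)
    finally show "(\<Sum>l\<le>p. integral {c l..b} (\<lambda>t. bspline \<Xi> k p t * poly (q l) t))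
        = (if k = i then 1 else 0)" .
  qed
qed

lemma dual_defined:
  assumes "1 \<le> i" "i \<le> n" "continuous_on {0..1} w"
  shows "dual_defined \<Xi> p i w"
proof (rule dual_functional_representation[OF assms(1,2)])
  fix c :: "nat \<Rightarrow> real" and q
  assume "\<And>w. continuous_on {0..1} w \<Longrightarrow> (dual_integrand \<Xi> p i w has_integral
       (\<Sum>l\<le>p. integral {c l..right_end i} (\<lambda>t. w t * poly (q l) t))) {knot \<Xi> i..knot \<Xi> (i + p + 1)}"
  from this[OF assms(3)] show ?thesis unfolding dual_defined_def by (rule has_integral_integrable)
qed

lemma dual_functional_bspline:
  assumes "1 \<le> i" "i \<le> n" "1 \<le> k" "k \<le> n"
  shows "dual_functional \<Xi> p i (bspline \<Xi> k p) = (if k = i then 1 else 0)"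
proof (rule dual_functional_representation[OF assms(1,2)])
  fix c :: "nat \<Rightarrow> real" and q
  assume rep: "\<And>w. continuous_on {0..1} w \<Longrightarrow> (dual_integrand \<Xi> p i w has_integral
       (\<Sum>l\<le>p. integral {c l..right_end i} (\<lambda>t. w t * poly (q l) t))) {knot \<Xi> i..knot \<Xi> (i + p + 1)}"
    and dual: "\<And>k. 1 \<le> k \<Longrightarrow> k \<le> n \<Longrightarrow>
       (\<Sum>l\<le>p. integral {c l..right_end i} (\<lambda>t. bspline \<Xi> k p t * poly (q l) t)) = (if k = i then 1 else 0)"
  show ?thesis
    unfolding dual_functional_def dual[OF assms(3,4), symmetric]
    by (rule integral_unique[OF rep[OF continuous_on_bspline[OF assms(3,4)]]])
qed

lemma dual_functional_sum:
  assumes i: "1 \<le> i" "i \<le> n" and A: "finite A" "\<And>k. k \<in> A \<Longrightarrow> continuous_on {0..1} (f k)"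
    and w: "\<And>t. t \<in> {0..1} \<Longrightarrow> w t = (\<Sum>k\<in>A. a k * f k t)"
  shows "dual_functional \<Xi> p i w = (\<Sum>k\<in>A. a k * dual_functional \<Xi> p i (f k))"
proof -
  let ?I = "{knot \<Xi> i..knot \<Xi> (i + p + 1)}"
  have "(dual_integrand \<Xi> p i (f k) has_integral dual_functional \<Xi> p i (f k)) ?I" if "k \<in> A" for k
    using dual_defined[OF i A(2)[OF that]]
    by (simp add: dual_defined_def dual_functional_def integrable_integral)
  then have "((\<lambda>t. \<Sum>k\<in>A. a k * dual_integrand \<Xi> p i (f k) t) has_integral
      (\<Sum>k\<in>A. a k * dual_functional \<Xi> p i (f k))) ?I"
    using A(1) by (intro has_integral_sum has_integral_mult_right)
  moreover have "(\<Sum>k\<in>A. a k * dual_integrand \<Xi> p i (f k) t) = dual_integrand \<Xi> p i w t" if "t \<in> ?I" for t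
  proof -
    have "t \<in> {0..1}"
      using that \<xi>_bounds[of "int i"] \<xi>_bounds[of "int (i + p + 1)"] \<xi>_eq[of i] \<xi>_eq[of "i + p + 1"] i by auto
    then show ?thesis by (simp add: dual_integrand_def w sum_distrib_right mult.assoc)
  qed
  ultimately have "(dual_integrand \<Xi> p i w has_integral (\<Sum>k\<in>A. a k * dual_functional \<Xi> p i (f k))) ?I"
    by (rule has_integral_eq[rotated])
  then show ?thesis by (simp add: dual_functional_def integral_unique)
qed

text \<open>The inner functional must be continuous in the parameter for the outer integral of a
  tensor functional to exist. The representation reduces this to integrals of jointly continuous
  functions.\<close>

lemma continuous_on_dual_functional:
  assumes i: "1 \<le> i" "i \<le> n" and f: "continuous_on ({0..1} \<times> {0..1}) (\<lambda>(s, t). f s t)"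
  shows "continuous_on {0..1} (\<lambda>s. dual_functional \<Xi> p i (f s))"
proof -
  obtain c :: "nat \<Rightarrow> real" and q where c: "\<And>l. l \<le> p \<Longrightarrow> 0 \<le> c l \<and> c l < right_end i"
    and rep: "\<And>w. continuous_on {0..1} w \<Longrightarrow> (dual_integrand \<Xi> p i w has_integral
       (\<Sum>l\<le>p. integral {c l..right_end i} (\<lambda>t. w t * poly (q l) t))) {knot \<Xi> i..knot \<Xi> (i + p + 1)}"
    by (rule dual_functional_representation[OF i]) (rule that)
  have "continuous_on {0..1} (\<lambda>s. \<Sum>l\<le>p. integral {c l..right_end i} (\<lambda>t. f s t * poly (q l) t))"
  proof (intro continuous_on_sum)
    fix l assume l: "l \<in> {..p}"
    have "right_end i \<le> 1" unfolding right_end_def by (rule \<xi>_bounds)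
    then have "continuous_on ({0..1} \<times> {c l..right_end i}) (\<lambda>(s, t). f s t)"
      using c[of l] l by (intro continuous_on_subset[OF f]) auto
    then have "continuous_on ({0..1} \<times> cbox (c l) (right_end i)) (\<lambda>(s, t). f s t * poly (q l) t)"
      unfolding case_prod_unfold by (auto intro!: continuous_intros)
    then have "continuous_on {0..1} (\<lambda>s. integral (cbox (c l) (right_end i)) (\<lambda>t. f s t * poly (q l) t))"
      by (rule integral_continuous_on_param)
    then show "continuous_on {0..1} (\<lambda>s. integral {c l..right_end i} (\<lambda>t. f s t * poly (q l) t))"
      by simp
  qed
  moreover have "dual_functional \<Xi> p i (f s) = (\<Sum>l\<le>p. integral {c l..right_end i} (\<lambda>t. f s t * poly (q l) t))"
    if "s \<in> {0..1}" for s
  proof -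
    have "continuous_on {0..1} (\<lambda>t. case (s, t) of (s, t) \<Rightarrow> f s t)"
      using that by (intro continuous_on_compose2[OF f]) (auto intro!: continuous_intros)
    then show ?thesis unfolding dual_functional_def by (intro integral_unique rep) simp
  qed
  ultimately show ?thesis by (subst continuous_on_cong[OF refl]) auto
qed

end

section \<open>Tensor products\<close>

lemma mem_unit_square: "\<zeta> \<in> cbox (0::real^2) 1 \<longleftrightarrow> \<zeta> $ 1 \<in> {0..1} \<and> \<zeta> $ 2 \<in> {0..1}"
  by (auto simp: mem_box_cart forall_2)

lemma mem_open_unit_square: "\<zeta> \<in> box (0::real^2) 1 \<longleftrightarrow> \<zeta> $ 1 \<in> {0<..<1} \<and> \<zeta> $ 2 \<in> {0<..<1}"
  by (auto simp: mem_box_cart forall_2)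

lemma continuous_on_vector_2 [continuous_intros]:
  assumes "continuous_on S f" "continuous_on S g"
  shows "continuous_on S (\<lambda>x. vector [f x, g x] :: real^2)"
proof -
  have "(\<lambda>x. vector [f x, g x] :: real^2) = (\<lambda>x. f x *\<^sub>R axis 1 1 + g x *\<^sub>R axis 2 1)"
    by (auto simp: vec_eq_iff forall_2 axis_def)
  then show ?thesis using assms by (simp only:) (intro continuous_intros)
qed

locale tensor_knots = K1: open_knots \<Xi>1 p1 + K2: open_knots \<Xi>2 p2
  for \<Xi>1 p1 \<Xi>2 p2
begin

abbreviation I :: "(nat \<times> nat) set" where
  "I \<equiv> tensor_index \<Xi>1 p1 \<Xi>2 p2"

lemma index_eq: "I = {1..K1.n} \<times> {1..K2.n}"
  by (simp add: tensor_index_def K1.n_def K2.n_def)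

lemma finite_index: "finite I"
  by (simp add: index_eq)

lemma index_iff: "i \<in> I \<longleftrightarrow> 1 \<le> fst i \<and> fst i \<le> K1.n \<and> 1 \<le> snd i \<and> snd i \<le> K2.n"
  by (cases i) (auto simp: index_eq)

lemma continuous_on_tensor_bspline:
  assumes "i \<in> I"
  shows "continuous_on (cbox 0 1) (tensor_bspline \<Xi>1 p1 \<Xi>2 p2 i)"
proof -
  note i = assms[unfolded index_iff]
  show ?thesis
    unfolding tensor_bspline_def[abs_def]
    by (intro continuous_on_mult continuous_on_compose2[OF K1.continuous_on_bspline]
        continuous_on_compose2[OF K2.continuous_on_bspline] continuous_intros)
       (use i in \<open>auto simp: mem_unit_square\<close>)
qed

lemma continuous_on_slice:
  fixes u :: "real^2 \<Rightarrow> real"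
  assumes "continuous_on (cbox 0 1) u"
  shows "continuous_on ({0..1} \<times> {0..1}) (\<lambda>(s, t). u (vector [s, t]))"
  unfolding case_prod_unfold
  by (intro continuous_on_compose2[OF assms] continuous_intros) (auto simp: mem_unit_square)

lemma continuous_on_slice_2:
  fixes u :: "real^2 \<Rightarrow> real"
  assumes "continuous_on (cbox 0 1) u" "s \<in> {0..1}"
  shows "continuous_on {0..1} (\<lambda>t. u (vector [s, t]))"
  by (intro continuous_on_compose2[OF assms(1)] continuous_intros) (use assms(2) in \<open>auto simp: mem_unit_square\<close>)

lemma tensor_defined:
  assumes u: "continuous_on (cbox 0 1) u" and "i \<in> I"
  shows "tensor_defined \<Xi>1 p1 \<Xi>2 p2 i u"
proof -
  note i = assms(2)[unfolded index_iff]
  have "continuous_on {0..1} (\<lambda>s. dual_functional \<Xi>2 p2 (snd i) (\<lambda>t. u (vector [s, t])))"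
    using i continuous_on_slice[OF u] by (intro K2.continuous_on_dual_functional) auto
  then show ?thesis
    unfolding tensor_defined_def using i
    by (auto intro!: K1.dual_defined K2.dual_defined continuous_on_slice_2[OF u])
qed

text \<open>The functional in the second direction leaves the row with the right second index. In
  the first direction duality finishes the proof for i1 \<ge> 2; for i1 = 1 the point evaluation is
  dual as well, by \<open>bspline_0\<close>.\<close>

lemma tensor_functional_spline:
  assumes i: "i \<in> I" and u: "\<And>\<zeta>. \<zeta> \<in> cbox 0 1 \<Longrightarrow> u \<zeta> = (\<Sum>k\<in>I. a k * tensor_bspline \<Xi>1 p1 \<Xi>2 p2 k \<zeta>)"
  shows "tensor_functional \<Xi>1 p1 \<Xi>2 p2 i u = a i"
proof -
  note i' = i[unfolded index_iff]
  have inner: "dual_functional \<Xi>2 p2 (snd i) (\<lambda>t. u (vector [s, t]))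
      = (\<Sum>k\<in>I. (a k * (if snd k = snd i then 1 else 0)) * bspline \<Xi>1 (fst k) p1 s)"
    if s: "s \<in> {0..1}" for s
  proof -
    have "dual_functional \<Xi>2 p2 (snd i) (\<lambda>t. u (vector [s, t]))
      = (\<Sum>k\<in>I. (a k * bspline \<Xi>1 (fst k) p1 s) * dual_functional \<Xi>2 p2 (snd i) (bspline \<Xi>2 (snd k) p2))"
    proof (rule K2.dual_functional_sum)
      show "continuous_on {0..1} (bspline \<Xi>2 (snd k) p2)" if "k \<in> I" for k
        using that by (intro K2.continuous_on_bspline) (auto simp: index_iff)
      fix t :: real assume "t \<in> {0..1}"
      then have "vector [s, t] \<in> cbox (0 :: real^2) 1" using s by (simp add: mem_unit_square)
      then show "u (vector [s, t]) = (\<Sum>k\<in>I. a k * bspline \<Xi>1 (fst k) p1 s * bspline \<Xi>2 (snd k) p2 t)"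
        by (simp add: u tensor_bspline_def mult.assoc)
    qed (use i' finite_index in auto)
    also have "\<dots> = (\<Sum>k\<in>I. (a k * (if snd k = snd i then 1 else 0)) * bspline \<Xi>1 (fst k) p1 s)"
      using i' by (intro sum.cong refl) (simp add: index_iff K2.dual_functional_bspline)
    finally show ?thesis .
  qed
  have pick: "(\<Sum>k\<in>I. (a k * (if snd k = snd i then 1 else 0)) * (if fst k = fst i then 1 else 0)) = a i"
  proof -
    have "(\<Sum>k\<in>I. (a k * (if snd k = snd i then 1 else 0)) * (if fst k = fst i then 1 else 0))
      = (\<Sum>k\<in>{i}. a k)"
      using i finite_index by (intro sum.mono_neutral_cong_right) (auto simp: prod_eq_iff)
    then show ?thesis by simp
  qed
  show ?thesis
  proof (cases "fst i = 1")
    case True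
    have "tensor_functional \<Xi>1 p1 \<Xi>2 p2 i u
      = (\<Sum>k\<in>I. (a k * (if snd k = snd i then 1 else 0)) * bspline \<Xi>1 (fst k) p1 0)"
      using True by (simp add: tensor_functional_def polar_functional_def inner)
    also have "\<dots> = a i"
      unfolding pick[symmetric] using True
      by (intro sum.cong refl) (simp add: index_iff K1.bspline_0)
    finally show ?thesis .
  next
    case False
    have "tensor_functional \<Xi>1 p1 \<Xi>2 p2 i u
      = (\<Sum>k\<in>I. (a k * (if snd k = snd i then 1 else 0)) * dual_functional \<Xi>1 p1 (fst i) (bspline \<Xi>1 (fst k) p1))"
      unfolding tensor_functional_def polar_functional_def if_not_P[OF False]
    proof (rule K1.dual_functional_sum)
      show "continuous_on {0..1} (bspline \<Xi>1 (fst k) p1)" if "k \<in> I" for k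
        using that by (intro K1.continuous_on_bspline) (auto simp: index_iff)
    qed (use i' finite_index inner in auto)
    also have "\<dots> = a i"
      unfolding pick[symmetric] using i'
      by (intro sum.cong refl) (simp add: index_iff K1.dual_functional_bspline)
    finally show ?thesis .
  qed
qed

end

locale weighted_tensor_knots = tensor_knots +
  fixes w :: "nat \<times> nat \<Rightarrow> real" and W :: "real^2 \<Rightarrow> real"
  assumes w_pos: "\<And>i. i \<in> I \<Longrightarrow> w i > 0"
    and w_indep: "\<And>i1 j1 i2. (i1, i2) \<in> I \<Longrightarrow> (j1, i2) \<in> I \<Longrightarrow> w (i1, i2) = w (j1, i2)"
    and W_eq: "\<And>\<zeta>. \<zeta> \<in> cbox 0 1 \<Longrightarrow> W \<zeta> = tensor_spline \<Xi>1 p1 \<Xi>2 p2 w \<zeta>"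
begin

definition W2 :: "real \<Rightarrow> real" where
  "W2 t = (\<Sum>k=1..K2.n. w (1, k) * bspline \<Xi>2 k p2 t)"

lemma w_first: "i \<in> I \<Longrightarrow> w i = w (1, snd i)"
  using w_indep[of "fst i" "snd i" 1] K1.n_ge by (simp add: index_iff)

lemma W_sum: "\<zeta> \<in> cbox 0 1 \<Longrightarrow> W \<zeta> = (\<Sum>i\<in>I. w i * tensor_bspline \<Xi>1 p1 \<Xi>2 p2 i \<zeta>)"
  by (simp add: W_eq tensor_spline_def mult.commute)

text \<open>The weights do not depend on the first index, and the B-splines in the first direction
  sum to 1.\<close>

lemma W_eq_W2:
  assumes "\<zeta> \<in> cbox 0 1"
  shows "W \<zeta> = W2 (\<zeta> $ 2)"
proof -
  have "W \<zeta> = (\<Sum>i\<in>I. bspline \<Xi>1 (fst i) p1 (\<zeta> $ 1) * (w (1, snd i) * bspline \<Xi>2 (snd i) p2 (\<zeta> $ 2)))"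
    unfolding W_sum[OF assms] by (intro sum.cong refl) (simp add: tensor_bspline_def w_first)
  also have "\<dots> = (\<Sum>i=1..K1.n. bspline \<Xi>1 i p1 (\<zeta> $ 1)) * W2 (\<zeta> $ 2)"
    unfolding W2_def sum_product index_eq by (simp add: sum.cartesian_product case_prod_unfold)
  also have "(\<Sum>i=1..K1.n. bspline \<Xi>1 i p1 (\<zeta> $ 1)) = 1"
    using assms by (intro K1.bspline_sum) (auto simp: mem_unit_square)
  finally show ?thesis by simp
qed

lemma W2_pos:
  assumes "t \<in> {0..1}"
  shows "W2 t > 0"
proof -
  have nonneg: "0 \<le> bspline \<Xi>2 k p2 t" if "k \<in> {1..K2.n}" for k
    using that assms by (intro K2.bspline_nonneg) auto
  have w: "0 < w (1, k)" if "k \<in> {1..K2.n}" for k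
    using that K1.n_ge by (intro w_pos) (simp add: index_iff)
  have sum1: "(\<Sum>k=1..K2.n. bspline \<Xi>2 k p2 t) = 1" using assms by (intro K2.bspline_sum) auto
  then obtain k where k: "k \<in> {1..K2.n}" "bspline \<Xi>2 k p2 t \<noteq> 0"
    by (metis sum.neutral zero_neq_one)
  then have "0 < w (1, k) * bspline \<Xi>2 k p2 t" using nonneg[OF k(1)] w by simp
  also have "\<dots> \<le> W2 t"
    unfolding W2_def
    by (rule member_le_sum[OF k(1), of "\<lambda>k. w (1, k) * bspline \<Xi>2 k p2 t"])
       (use nonneg w in \<open>simp_all add: less_imp_le\<close>)
  finally show ?thesis .
qed

lemma W_pos: "\<zeta> \<in> cbox 0 1 \<Longrightarrow> W \<zeta> > 0"
  using W2_pos by (simp add: W_eq_W2 mem_unit_square)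

lemma continuous_on_W: "continuous_on (cbox 0 1) W"
proof -
  have "continuous_on (cbox 0 1) (\<lambda>\<zeta>. \<Sum>i\<in>I. w i * tensor_bspline \<Xi>1 p1 \<Xi>2 p2 i \<zeta>)"
    by (intro continuous_intros continuous_on_tensor_bspline)
  then show ?thesis by (subst continuous_on_cong[OF refl W_sum])
qed

text \<open>For i1 = 1 only the values on the edge enter. There c W is a spline in \<zeta>2 with the
  coefficients c w_i, which the second functional recovers.\<close>

lemma tensor_functional_edge:
  assumes "i \<in> I" "fst i = 1" "\<And>t. t \<in> {0..1} \<Longrightarrow> u (vector [0, t]) = c * W (vector [0, t])"
  shows "tensor_functional \<Xi>1 p1 \<Xi>2 p2 i u = c * w i"
proof -
  note i = assms(1)[unfolded index_iff]
  have "tensor_functional \<Xi>1 p1 \<Xi>2 p2 i u = dual_functional \<Xi>2 p2 (snd i) (\<lambda>t. u (vector [0, t]))"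
    using assms(2) by (simp add: tensor_functional_def polar_functional_def)
  also have "\<dots> = (\<Sum>k\<in>{1..K2.n}. (c * w (1, k)) * dual_functional \<Xi>2 p2 (snd i) (bspline \<Xi>2 k p2))"
  proof (rule K2.dual_functional_sum)
    fix t :: real assume t: "t \<in> {0..1}"
    then have "W (vector [0, t]) = W2 t" using W_eq_W2[of "vector [0, t]"] by (simp add: mem_unit_square)
    then show "u (vector [0, t]) = (\<Sum>k\<in>{1..K2.n}. c * w (1, k) * bspline \<Xi>2 k p2 t)"
      using assms(3)[OF t] by (simp add: W2_def sum_distrib_left mult.assoc)
  qed (use i K2.continuous_on_bspline in auto)
  also have "\<dots> = (\<Sum>k\<in>{1..K2.n}. if k = snd i then c * w (1, k) else 0)"
    using i by (intro sum.cong refl) (simp add: K2.dual_functional_bspline)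
  also have "\<dots> = c * w (1, snd i)" using i by (simp add: sum.delta)
  finally show ?thesis using w_first[OF assms(1)] by simp
qed

end

section \<open>Lipschitz functions and weak derivatives\<close>

lemma L2_bounded:
  assumes "\<Omega> \<in> lmeasurable" "(\<lambda>x. indicator \<Omega> x *\<^sub>R f x) \<in> borel_measurable lebesgue"
    and "AE x in lebesgue. x \<in> \<Omega> \<longrightarrow> \<bar>f x\<bar> \<le> B"
  shows "f \<in> L2 \<Omega>"
proof -
  have "integrable lebesgue (\<lambda>x. indicator \<Omega> x *\<^sub>R (f x)\<^sup>2)"
  proof (rule Bochner_Integration.integrable_bound)
    show "integrable lebesgue (\<lambda>x. B\<^sup>2 * indicator \<Omega> x :: real)"
      using assms(1) by (intro integrable_mult_right) (simp add: lmeasurable_iff_integrable)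
    have "(\<lambda>x. (indicator \<Omega> x *\<^sub>R f x)\<^sup>2) \<in> borel_measurable lebesgue"
      using assms(2) by (rule borel_measurable_power)
    moreover have "(\<lambda>x. (indicator \<Omega> x *\<^sub>R f x)\<^sup>2) = (\<lambda>x. indicator \<Omega> x *\<^sub>R (f x)\<^sup>2)"
      by (auto simp: indicator_def)
    ultimately show "(\<lambda>x. indicator \<Omega> x *\<^sub>R (f x)\<^sup>2) \<in> borel_measurable lebesgue" by simp
    show "AE x in lebesgue. norm (indicator \<Omega> x *\<^sub>R (f x)\<^sup>2) \<le> norm (B\<^sup>2 * indicator \<Omega> x :: real)"
      using assms(3)
    proof eventually_elim
      case (elim x)
      have "(f x)\<^sup>2 \<le> B\<^sup>2" if "\<bar>f x\<bar> \<le> B" using power_mono[OF that, of 2] by simp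
      then show ?case using elim by (auto simp: indicator_def)
    qed
  qed
  then show ?thesis using assms(2) by (simp add: L2_def set_integrable_def set_borel_measurable_def)
qed

lemma test_function_facts:
  assumes "\<phi> \<in> test_functions \<Omega>"
  obtains K where "compact K" "K \<subseteq> \<Omega>" "\<And>x. x \<notin> K \<Longrightarrow> \<phi> x = 0"
    "\<And>x. \<phi> differentiable (at x)" "\<And>k. continuous_on UNIV (partial_deriv k \<phi>)"
    "\<And>k x. x \<notin> K \<Longrightarrow> partial_deriv k \<phi> x = 0" "continuous_on UNIV \<phi>"
proof -
  have d: "foldr partial_deriv ks \<phi> differentiable (at x)" for ks x
    using assms by (auto simp: test_functions_def)
  obtain K where K: "compact K" "K \<subseteq> \<Omega>" "\<And>x. x \<notin> K \<Longrightarrow> \<phi> x = 0"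
    using assms by (auto simp: test_functions_def)
  have 1: "\<phi> differentiable (at x)" for x using d[of "[]"] by simp
  have "partial_deriv k \<phi> differentiable (at x)" for k x using d[of "[k]"] by simp
  then have 2: "continuous_on UNIV (partial_deriv k \<phi>)" for k
    by (meson differentiable_imp_continuous_within continuous_at_imp_continuous_on)
  have 3: "partial_deriv k \<phi> x = 0" if "x \<notin> K" for k x
  proof -
    have "((\<lambda>_. 0) has_derivative (\<lambda>_. 0)) (at x)" by simp
    then have "(\<phi> has_derivative (\<lambda>_. 0)) (at x)"
      by (rule has_derivative_transform_within_open[OF _ open_Compl[OF compact_imp_closed[OF K(1)]]])
         (use that K in auto)
    then show ?thesis by (simp add: partial_deriv_def frechet_derivative_at[symmetric])
  qed
  have 4: "continuous_on UNIV \<phi>"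
    using 1 by (meson differentiable_imp_continuous_within continuous_at_imp_continuous_on)
  show ?thesis by (rule that[OF K 1 2 3 4])
qed

lemma continuous_support_bounded:
  fixes f :: "'a::topological_space \<Rightarrow> real"
  assumes "continuous_on UNIV f" "compact K" "\<And>x. x \<notin> K \<Longrightarrow> f x = 0"
  obtains C where "C \<ge> 0" "\<And>x. \<bar>f x\<bar> \<le> C"
proof -
  have "bounded (f ` K)"
    using assms(1,2) by (intro compact_imp_bounded compact_continuous_image) (auto intro: continuous_on_subset)
  then obtain C where C: "\<And>x. x \<in> K \<Longrightarrow> \<bar>f x\<bar> \<le> C" by (auto simp: bounded_real)
  have "\<bar>f x\<bar> \<le> max C 0" for x using C[of x] assms(3)[of x] by (cases "x \<in> K") auto
  then show ?thesis using that[of "max C 0"] by auto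
qed

lemma has_derivative_directional:
  assumes "(f has_derivative D) (at x)"
  shows "((\<lambda>h. f (x + h *\<^sub>R e)) has_vector_derivative D e) (at 0)"
proof -
  have "((\<lambda>h. x + h *\<^sub>R e) has_derivative (\<lambda>h. h *\<^sub>R e)) (at 0)"
    by (auto intro!: derivative_eq_intros)
  then have "((\<lambda>h. f (x + h *\<^sub>R e)) has_derivative (\<lambda>h. D (h *\<^sub>R e))) (at 0)"
    using assms by (intro has_derivative_compose[where f = "\<lambda>h. x + h *\<^sub>R e" and g = f]) simp_all
  moreover have "D (h *\<^sub>R e) = h *\<^sub>R D e" for h
    using assms has_derivative_linear linear_scale by blast
  ultimately show ?thesis by (simp add: has_vector_derivative_def)
qed

lemma difference_quotient_tendsto:
  fixes f :: "'a::real_normed_vector \<Rightarrow> real"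
  assumes "(f has_derivative D) (at x)" "h \<longlonglongrightarrow> 0" "\<And>n. h n \<noteq> 0"
  shows "(\<lambda>n. (f (x + h n *\<^sub>R e) - f x) / h n) \<longlonglongrightarrow> D e"
proof -
  have "((\<lambda>h. f (x + h *\<^sub>R e)) has_real_derivative D e) (at 0)"
    using has_derivative_directional[OF assms(1)] by (simp add: has_real_derivative_iff_has_vector_derivative)
  then have "((\<lambda>h. (f (x + h *\<^sub>R e) - f x) / h) \<longlongrightarrow> D e) (at 0)"
    by (simp add: DERIV_def)
  moreover have "filterlim h (at 0) sequentially"
    using assms by (simp add: filterlim_at)
  ultimately show ?thesis by (rule filterlim_compose)
qed

lemma integral_difference_zero:
  fixes f :: "'a::euclidean_space \<Rightarrow> real"
  assumes "f \<in> borel_measurable borel" "integrable lborel f"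
  shows "integral\<^sup>L lebesgue (\<lambda>x. f (x + c) - f x) = 0"
proof -
  have "integrable (distr lborel borel ((+) c)) f"
    using assms(2) by (simp add: lborel_distr_plus)
  then have i: "integrable lborel (\<lambda>x. f (c + x))"
    using assms(1) by (subst (asm) integrable_distr_eq) simp_all
  have "integral\<^sup>L lborel f = integral\<^sup>L (distr lborel borel ((+) c)) f"
    by (simp add: lborel_distr_plus)
  also have "\<dots> = integral\<^sup>L lborel (\<lambda>x. f (c + x))"
    using assms(1) by (intro integral_distr) simp_all
  finally have "integral\<^sup>L lborel (\<lambda>x. f (c + x) - f x) = 0"
    using i assms(2) by simp
  moreover have "(\<lambda>x. f (c + x) - f x) \<in> borel_measurable lborel" using assms(1) by measurable
  ultimately show ?thesis by (simp add: integral_completion add.commute)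
qed

lemma bounded_subset_cball_0:
  fixes S :: "'a::real_normed_vector set"
  assumes "bounded S"
  shows "\<exists>R. S \<subseteq> cball 0 R"
proof -
  obtain R where "\<forall>x\<in>S. norm x \<le> R" using assms unfolding bounded_iff by blast
  then have "S \<subseteq> cball 0 R" by auto
  then show ?thesis ..
qed

lemma integrable_bounded_support:
  fixes f :: "'a::euclidean_space \<Rightarrow> real"
  assumes "f \<in> borel_measurable borel" "bounded S" "\<And>x. x \<notin> S \<Longrightarrow> f x = 0" "\<And>x. \<bar>f x\<bar> \<le> C"
  shows "integrable lborel f"
proof -
  obtain R where R: "S \<subseteq> cball 0 R" using bounded_subset_cball_0[OF assms(2)] by blast
  show ?thesis
  proof (rule Bochner_Integration.integrable_bound)
    show "integrable lborel (\<lambda>x. C * indicator (cball (0::'a) R) x :: real)"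
      by (intro integrable_mult_right integrable_real_indicator emeasure_lborel_cball_finite) simp
    show "AE x in lborel. norm (f x) \<le> norm (C * indicator (cball 0 R) x)"
    proof (rule AE_I2)
      fix x
      show "norm (f x) \<le> norm (C * indicator (cball 0 R) x)"
        using assms(3)[of x] assms(4)[of x] R by (cases "x \<in> S") (auto simp: indicator_def)
    qed
  qed (use assms(1) in simp)
qed

lemma partial_deriv_lipschitz:
  fixes \<phi> :: "real^2 \<Rightarrow> real"
  assumes "\<And>x. \<phi> differentiable (at x)" "\<And>x. \<bar>partial_deriv k \<phi> x\<bar> \<le> C" "0 \<le> h"
  shows "\<bar>\<phi> (x + h *\<^sub>R axis k 1) - \<phi> x\<bar> \<le> C * h"
proof -
  let ?f = "\<lambda>t. \<phi> (x + t *\<^sub>R axis k 1)"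
  have "(?f has_vector_derivative partial_deriv k \<phi> (x + t *\<^sub>R axis k 1)) (at t)" for t
  proof -
    have "(\<phi> has_derivative frechet_derivative \<phi> (at (x + t *\<^sub>R axis k 1))) (at (x + t *\<^sub>R axis k 1))"
      using assms(1) frechet_derivative_works by blast
    then have "((\<lambda>h. \<phi> ((x + t *\<^sub>R axis k 1) + h *\<^sub>R axis k 1)) has_vector_derivative
        partial_deriv k \<phi> (x + t *\<^sub>R axis k 1)) (at 0)"
      unfolding partial_deriv_def by (rule has_derivative_directional)
    then have "((\<lambda>h. ?f (h + t)) has_real_derivative partial_deriv k \<phi> (x + t *\<^sub>R axis k 1)) (at 0)"
      by (simp add: has_real_derivative_iff_has_vector_derivative algebra_simps)
    then show ?thesis
      by (subst (asm) DERIV_shift[symmetric]) (simp add: has_real_derivative_iff_has_vector_derivative)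
  qed
  note D = this
  have "C-lipschitz_on {0..h} ?f"
  proof (rule bounded_derivative_imp_lipschitz)
    show "(?f has_derivative (\<lambda>u. u *\<^sub>R partial_deriv k \<phi> (x + t *\<^sub>R axis k 1))) (at t within {0..h})" for t
      using D[of t] unfolding has_vector_derivative_def by (rule has_derivative_at_withinI)
    show "onorm (\<lambda>u. u *\<^sub>R partial_deriv k \<phi> (x + t *\<^sub>R axis k 1)) \<le> C" for t
      using assms(2)[of "x + t *\<^sub>R axis k 1"]
      by (intro onorm_le) (simp add: abs_mult mult.commute[of C] mult_left_mono)
    show "0 \<le> C" using assms(2)[of x] by linarith
  qed simp
  then show ?thesis using lipschitz_onD[of C "{0..h}" ?f h 0] assms(3) by (simp add: dist_real_def)
qed

lemma null_sequence_below:
  assumes "(0::real) < r"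
  obtains h :: "nat \<Rightarrow> real" where "\<And>n. 0 < h n" "\<And>n. h n < r" "h \<longlonglongrightarrow> 0"
proof
  let ?h = "\<lambda>n. r * inverse (real (Suc (Suc n)))"
  show "0 < ?h n" for n using assms by simp
  have "inverse (real (Suc (Suc n))) < 1" for n by (simp add: inverse_less_1_iff)
  then have "r * inverse (real (Suc (Suc n))) < r * 1" for n
    using assms by (intro mult_strict_left_mono) auto
  then show "?h n < r" for n by simp
  have "(\<lambda>n. r * inverse (real (Suc n))) \<longlonglongrightarrow> r * 0"
    by (intro tendsto_intros LIMSEQ_inverse_real_of_nat)
  from LIMSEQ_Suc[OF this] show "?h \<longlonglongrightarrow> 0" by simp
qed

text \<open>Difference quotients of (u \<phi>), with u the extension of v by zero, integrate to 0 by
  translation invariance. The discrete product rule splits them into a quotient of \<phi> and a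
  quotient of u. The latter is needed only on the compact support of \<phi>, where L bounds it for
  small shifts, so dominated convergence gives the weak derivative.\<close>

lemma H1_lipschitz:
  fixes v :: "real^2 \<Rightarrow> real"
  assumes \<Omega>: "open \<Omega>" "bounded \<Omega>" and L: "L \<ge> 0"
    and lip: "\<And>x. x \<in> \<Omega> \<Longrightarrow> \<exists>r>0. ball x r \<subseteq> \<Omega> \<and> L-lipschitz_on (ball x r) v"
    and bnd: "\<And>x. x \<in> \<Omega> \<Longrightarrow> \<bar>v x\<bar> \<le> B" and "negligible N"
    and diff: "\<And>x. x \<in> \<Omega> - N \<Longrightarrow> v differentiable (at x)"
  shows "v \<in> H1 \<Omega>"
proof -
  have \<Omega>_meas: "\<Omega> \<in> lmeasurable" using \<Omega> by (intro lmeasurable_open)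
  define u where "u x = indicator \<Omega> x *\<^sub>R v x" for x
  have "isCont v x" if x: "x \<in> \<Omega>" for x
  proof -
    obtain r where r: "r > 0" "L-lipschitz_on (ball x r) v" using lip[OF x] by blast
    then show ?thesis
      using lipschitz_on_continuous_on continuous_on_eq_continuous_at open_ball centre_in_ball by blast
  qed
  then have "continuous_on \<Omega> v" using continuous_at_imp_continuous_on by blast
  then have u_meas [measurable]: "u \<in> borel_measurable borel"
    unfolding u_def[abs_def] using \<Omega>(1) by (intro borel_measurable_continuous_on_indicator) auto
  have u_bnd: "\<bar>u x\<bar> \<le> \<bar>B\<bar>" for x using bnd[of x] by (auto simp: u_def indicator_def)
  have N_null: "AE x in lebesgue. x \<notin> N"
    using \<open>negligible N\<close> by (simp add: negligible_iff_null_sets AE_not_in)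
  have "v \<in> L2 \<Omega>"
  proof (rule L2_bounded[OF \<Omega>_meas])
    show "(\<lambda>x. indicator \<Omega> x *\<^sub>R v x) \<in> borel_measurable lebesgue"
      using u_meas by (simp add: u_def[abs_def] measurable_completion)
  qed (use bnd in auto)
  moreover have "\<exists>g\<in>L2 \<Omega>. weak_partial_deriv \<Omega> k v g" for k
  proof -
    let ?e = "axis k (1::real) :: real^2"
    define q where "q h x = (u (x + h *\<^sub>R ?e) - u x) / h" for h x
    \<comment> \<open>A limit along one fixed sequence is Borel measurable. On \<Omega> it exists
      off N, so in \<Omega> the default value of \<open>lim\<close> can matter only on a null
      set.\<close>
    define g where "g x = lim (\<lambda>n. q (inverse (real (Suc n))) x)" for x
    have q_meas: "q h \<in> borel_measurable borel" for h unfolding q_def[abs_def] by measurable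
    have g_meas: "g \<in> borel_measurable borel"
      unfolding g_def[abs_def] by (intro borel_measurable_lim_metric q_meas)
    have q_lim: "(\<lambda>n. q (h n) x) \<longlonglongrightarrow> partial_deriv k v x"
      if x: "x \<in> \<Omega> - N" and h: "h \<longlonglongrightarrow> 0" "\<And>n. h n \<noteq> 0" for h x
    proof -
      have "(v has_derivative frechet_derivative v (at x)) (at x)"
        using diff[OF x] by (simp add: frechet_derivative_works)
      then have "(u has_derivative frechet_derivative v (at x)) (at x)"
        by (rule has_derivative_transform_within_open[OF _ \<Omega>(1)]) (use x in \<open>auto simp: u_def\<close>)
      from difference_quotient_tendsto[OF this h, of ?e] show ?thesis
        by (simp add: q_def partial_deriv_def)
    qed
    have g_eq: "g x = partial_deriv k v x" if x: "x \<in> \<Omega> - N" for x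
      unfolding g_def using q_lim[OF x LIMSEQ_inverse_real_of_nat] by (intro limI) simp
    have lip_h: "\<bar>q h x\<bar> \<le> L" if "L-lipschitz_on (ball x r) v" "ball x r \<subseteq> \<Omega>" "0 < h" "h < r" for h r x
    proof -
      have b: "x + h *\<^sub>R ?e \<in> ball x r" "x \<in> ball x r" using that by (auto simp: dist_norm)
      have "\<bar>v (x + h *\<^sub>R ?e) - v x\<bar> \<le> L * h"
        using lipschitz_onD[OF that(1) b] that by (simp add: dist_norm)
      moreover have "x + h *\<^sub>R ?e \<in> \<Omega>" "x \<in> \<Omega>" using b that(2) by blast+
      then have "u (x + h *\<^sub>R ?e) = v (x + h *\<^sub>R ?e)" "u x = v x" by (simp_all add: u_def)
      ultimately show ?thesis using that by (simp add: q_def pos_divide_le_eq)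
    qed
    have g_bnd: "\<bar>g x\<bar> \<le> L" if x: "x \<in> \<Omega> - N" for x
    proof -
      obtain r where r: "r > 0" "ball x r \<subseteq> \<Omega>" "L-lipschitz_on (ball x r) v" using lip[of x] x by blast
      \<comment> \<open>A new null sequence below r, because the Lipschitz bound needs the shifted
        point to stay in the ball. The limit is the same partial derivative.\<close>
      obtain h where h: "\<And>n. 0 < h n" "\<And>n. h n < r" and "h \<longlonglongrightarrow> 0"
        by (rule null_sequence_below[OF r(1)]) (rule that)
      from this(3) have "(\<lambda>n. q (h n) x) \<longlonglongrightarrow> partial_deriv k v x"
        using h(1) by (intro q_lim[OF x]) (simp_all add: less_imp_neq[symmetric])
      then have "(\<lambda>n. \<bar>q (h n) x\<bar>) \<longlonglongrightarrow> \<bar>g x\<bar>" unfolding g_eq[OF x] by (rule tendsto_rabs)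
      then show ?thesis by (rule tendsto_upperbound) (use lip_h[OF r(3,2) h] in auto)
    qed
    have g_L2: "g \<in> L2 \<Omega>"
    proof (rule L2_bounded[OF \<Omega>_meas])
      show "(\<lambda>x. indicator \<Omega> x *\<^sub>R g x) \<in> borel_measurable lebesgue"
        using g_meas \<Omega>(1) by (intro measurable_completion) simp
      show "AE x in lebesgue. x \<in> \<Omega> \<longrightarrow> \<bar>g x\<bar> \<le> L"
        using N_null by eventually_elim (use g_bnd in auto)
    qed
    moreover have "weak_partial_deriv \<Omega> k v g"
      unfolding weak_partial_deriv_def
    proof
      fix \<phi> assume "\<phi> \<in> test_functions \<Omega>"
      then obtain K where K: "compact K" "K \<subseteq> \<Omega>" "\<And>x. x \<notin> K \<Longrightarrow> \<phi> x = 0"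
        and \<phi>: "\<And>x. \<phi> differentiable (at x)" "\<And>k. continuous_on UNIV (partial_deriv k \<phi>)"
          "\<And>k x. x \<notin> K \<Longrightarrow> partial_deriv k \<phi> x = 0" "continuous_on UNIV \<phi>"
        by (rule test_function_facts) (rule that)
      have [measurable]: "\<phi> \<in> borel_measurable borel" "partial_deriv k \<phi> \<in> borel_measurable borel"
        using \<phi>(2,4) by (simp_all add: borel_measurable_continuous_onI)
      obtain C0 where C0: "C0 \<ge> 0" "\<And>x. \<bar>\<phi> x\<bar> \<le> C0"
        using continuous_support_bounded[OF \<phi>(4) K(1,3)] by blast
      obtain C1 where C1: "C1 \<ge> 0" "\<And>x. \<bar>partial_deriv k \<phi> x\<bar> \<le> C1"
        using continuous_support_bounded[OF \<phi>(2) K(1) \<phi>(3)] by blast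
      have "\<forall>x\<in>K. \<exists>r>0. ball x r \<subseteq> \<Omega> \<and> L-lipschitz_on (ball x r) v" using lip K(2) by blast
      then obtain r where r: "\<And>x. x \<in> K \<Longrightarrow> r x > 0 \<and> ball x (r x) \<subseteq> \<Omega> \<and> L-lipschitz_on (ball x (r x)) v"
        by metis
      \<comment> \<open>A Lebesgue number of the cover of K: one radius e serves all points of
        K.\<close>
      obtain e where e: "0 < e" "\<And>x. x \<in> K \<Longrightarrow> \<exists>G\<in>(\<lambda>x. ball x (r x)) ` K. ball x e \<subseteq> G"
      proof (rule Heine_Borel_lemma[OF K(1), of "(\<lambda>x. ball x (r x)) ` K"])
        show "K \<subseteq> \<Union> ((\<lambda>x. ball x (r x)) ` K)"
          using r centre_in_ball by blast
      qed auto
      \<comment> \<open>Shifts below e admit the Lipschitz estimate on K; shifts below 1 keep all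
        supports in one ball.\<close>
      obtain h where h0: "\<And>n. 0 < h n" "\<And>n. h n < min e 1" and h_lim: "h \<longlonglongrightarrow> 0"
        by (rule null_sequence_below[of "min e 1"]) (use e(1) in auto)
      have h: "0 < h n" "h n < e" "h n \<le> 1" for n using h0[of n] by auto
      have q_bnd: "\<bar>q (h n) x\<bar> \<le> L" if xK: "x \<in> K" for n x
      proof -
        obtain y where y: "y \<in> K" "ball x e \<subseteq> ball y (r y)" using e(2)[OF xK] by blast
        have "L-lipschitz_on (ball x e) v" "ball x e \<subseteq> \<Omega>"
          using r[OF y(1)] y(2) lipschitz_on_subset by blast+
        then show ?thesis using h by (intro lip_h)
      qed
      define f where "f x = u x * \<phi> x" for x
      \<comment> \<open>The discrete product rule F = R + q \<phi>, where the shift is put on u in R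
        and \<phi> in the second term stays unshifted, so that q is needed on K alone.\<close>
      define F where "F n x = (f (x + h n *\<^sub>R ?e) - f x) / h n" for n x
      define R where "R n x = u (x + h n *\<^sub>R ?e) * ((\<phi> (x + h n *\<^sub>R ?e) - \<phi> x) / h n)" for n x
      have F_eq: "F n x = R n x + q (h n) x * \<phi> x" for n x
        using h(1)[of n] by (simp add: F_def f_def R_def q_def field_simps)
      obtain \<rho> where \<rho>: "K \<subseteq> cball 0 \<rho>" using bounded_subset_cball_0[OF compact_imp_bounded[OF K(1)]] by blast
      define S where "S = cball (0::real^2) (\<rho> + 1)"
      have S: "x \<in> K \<or> x + h n *\<^sub>R ?e \<in> K \<Longrightarrow> x \<in> S" for x n
      proof (elim disjE)
        assume "x + h n *\<^sub>R ?e \<in> K"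
        then have "norm (x + h n *\<^sub>R ?e) \<le> \<rho>" using \<rho> by auto
        moreover have "norm x \<le> norm (x + h n *\<^sub>R ?e) + norm (h n *\<^sub>R ?e)"
          using norm_triangle_ineq4[of "x + h n *\<^sub>R ?e" "h n *\<^sub>R ?e"] by simp
        ultimately show "x \<in> S" using h[of n] by (simp add: S_def)
      qed (use \<rho> in \<open>auto simp: S_def\<close>)
      have R_bnd: "\<bar>R n x\<bar> \<le> \<bar>B\<bar> * C1" for n x
      proof -
        have "\<bar>\<phi> (x + h n *\<^sub>R ?e) - \<phi> x\<bar> \<le> C1 * h n"
          using h(1)[of n] by (intro partial_deriv_lipschitz \<phi>(1) C1(2)) simp
        then have "\<bar>(\<phi> (x + h n *\<^sub>R ?e) - \<phi> x) / h n\<bar> \<le> C1"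
          using h(1)[of n] by (simp add: pos_divide_le_eq)
        then show ?thesis unfolding R_def abs_mult using u_bnd by (intro mult_mono) auto
      qed
      have F_bnd: "\<bar>F n x\<bar> \<le> (\<bar>B\<bar> * C1 + L * C0) * indicator S x" for n x
      proof (cases "x \<in> S")
        case True
        have "\<bar>q (h n) x * \<phi> x\<bar> \<le> L * C0"
        proof (cases "x \<in> K")
          case True
          then show ?thesis unfolding abs_mult using q_bnd C0 L by (intro mult_mono) auto
        qed (use K(3) L C0(1) in auto)
        then have "\<bar>F n x\<bar> \<le> \<bar>B\<bar> * C1 + L * C0" unfolding F_eq using R_bnd[of n x] by linarith
        then show ?thesis using True by simp
      next
        case False
        then have "\<phi> x = 0" "\<phi> (x + h n *\<^sub>R ?e) = 0" using S K(3) by blast+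
        then show ?thesis using False by (simp add: F_def f_def)
      qed
      have f_meas: "f \<in> borel_measurable borel" unfolding f_def[abs_def] by measurable
      have f_int: "integrable lborel f"
      proof (rule integrable_bounded_support[OF f_meas compact_imp_bounded[OF K(1)]])
        show "f x = 0" if "x \<notin> K" for x using that K(3) by (simp add: f_def)
        show "\<bar>f x\<bar> \<le> \<bar>B\<bar> * C0" for x
          unfolding f_def abs_mult using u_bnd C0 by (intro mult_mono) auto
      qed
      define G where "G x = indicator \<Omega> x *\<^sub>R (v x * partial_deriv k \<phi> x) + indicator \<Omega> x *\<^sub>R (g x * \<phi> x)" for x
      have F_lim: "AE x in lebesgue. (\<lambda>n. F n x) \<longlonglongrightarrow> G x"
        using N_null
      proof eventually_elim
        case (elim x)
        have d\<phi>: "(\<lambda>n. (\<phi> (x + h n *\<^sub>R ?e) - \<phi> x) / h n) \<longlonglongrightarrow> partial_deriv k \<phi> x"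
          unfolding partial_deriv_def using \<phi>(1) frechet_derivative_works h(1)
          by (intro difference_quotient_tendsto[OF _ h_lim]) (auto simp: less_imp_neq[symmetric])
        show ?case
        proof (cases "x \<in> \<Omega>")
          case True
          have "isCont u x"
          proof (rule continuous_on_interior[of \<Omega>])
            show "continuous_on \<Omega> u"
              using \<open>continuous_on \<Omega> v\<close> by (rule continuous_on_eq) (simp add: u_def)
            show "x \<in> interior \<Omega>" using True \<Omega>(1) by (simp add: interior_open)
          qed
          moreover have "(\<lambda>n. x + h n *\<^sub>R ?e) \<longlonglongrightarrow> x + 0 *\<^sub>R ?e" by (intro tendsto_intros h_lim)
          ultimately have "(\<lambda>n. u (x + h n *\<^sub>R ?e)) \<longlonglongrightarrow> u x"
            by (intro isCont_tendsto_compose[of x u]) simp_all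
          have "(\<lambda>n. R n x + q (h n) x * \<phi> x) \<longlonglongrightarrow> u x * partial_deriv k \<phi> x + partial_deriv k v x * \<phi> x"
            unfolding R_def using True elim h(1) \<open>(\<lambda>n. u (x + h n *\<^sub>R ?e)) \<longlonglongrightarrow> u x\<close>
            by (intro tendsto_intros d\<phi> q_lim h_lim) (auto simp: less_imp_neq[symmetric])
          then show ?thesis using True elim by (simp add: F_eq G_def u_def g_eq)
        next
          case False
          then have z: "\<phi> x = 0" "u x = 0" "partial_deriv k \<phi> x = 0"
            using K \<phi>(3) by (auto simp: u_def)
          \<comment> \<open>Outside \<Omega> the extension u may be discontinuous. Its boundedness
            is enough here, since the quotient of \<phi> tends to 0.\<close>
          have "(\<lambda>n. \<bar>B\<bar> * \<bar>(\<phi> (x + h n *\<^sub>R ?e) - \<phi> x) / h n\<bar>) \<longlonglongrightarrow> \<bar>B\<bar> * \<bar>partial_deriv k \<phi> x\<bar>"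
            by (intro tendsto_intros d\<phi>)
          then have lim0: "(\<lambda>n. \<bar>B\<bar> * \<bar>(\<phi> (x + h n *\<^sub>R ?e) - \<phi> x) / h n\<bar>) \<longlonglongrightarrow> 0"
            by (simp only: z(3) abs_zero mult_zero_right)
          have "(\<lambda>n. R n x) \<longlonglongrightarrow> 0"
          proof (rule Lim_null_comparison[OF always_eventually lim0], rule allI)
            show "norm (R n x) \<le> \<bar>B\<bar> * \<bar>(\<phi> (x + h n *\<^sub>R ?e) - \<phi> x) / h n\<bar>" for n
              unfolding R_def real_norm_def abs_mult by (intro mult_right_mono u_bnd) simp
          qed
          then show ?thesis using False by (simp add: F_eq z G_def)
        qed
      qed
      have F_meas: "F n \<in> borel_measurable lebesgue" for n
      proof -
        have [measurable]: "f \<in> borel_measurable borel" by (rule f_meas)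
        have "F n \<in> borel_measurable borel" unfolding F_def[abs_def] by measurable
        then show ?thesis by (simp add: measurable_completion)
      qed
      have G_parts: "integrable lebesgue (\<lambda>x. indicator \<Omega> x *\<^sub>R (v x * partial_deriv k \<phi> x))"
        "integrable lebesgue (\<lambda>x. indicator \<Omega> x *\<^sub>R (g x * \<phi> x))"
      proof -
        have "(\<lambda>x. u x * partial_deriv k \<phi> x) \<in> borel_measurable borel" by measurable
        moreover have "(\<lambda>x. u x * partial_deriv k \<phi> x) = (\<lambda>x. indicator \<Omega> x *\<^sub>R (v x * partial_deriv k \<phi> x))"
          by (simp add: u_def mult.assoc)
        ultimately have m1: "(\<lambda>x. indicator \<Omega> x *\<^sub>R (v x * partial_deriv k \<phi> x)) \<in> borel_measurable lebesgue"
          by (simp add: measurable_completion)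
        have m2: "(\<lambda>x. indicator \<Omega> x *\<^sub>R (g x * \<phi> x)) \<in> borel_measurable lebesgue"
          using g_meas \<Omega>(1) by (intro measurable_completion) simp
        have ind: "integrable lebesgue (\<lambda>x. c * indicator \<Omega> x :: real)" for c
          using \<Omega>_meas by (intro integrable_mult_right) (simp add: lmeasurable_iff_integrable)
        show "integrable lebesgue (\<lambda>x. indicator \<Omega> x *\<^sub>R (v x * partial_deriv k \<phi> x))"
        proof (rule Bochner_Integration.integrable_bound[OF ind[of "\<bar>B\<bar> * C1"] m1], rule AE_I2)
          fix x
          have "\<bar>u x * partial_deriv k \<phi> x\<bar> \<le> \<bar>B\<bar> * C1"
            unfolding abs_mult using u_bnd C1 by (intro mult_mono) auto
          then show "norm (indicator \<Omega> x *\<^sub>R (v x * partial_deriv k \<phi> x)) \<le> norm (\<bar>B\<bar> * C1 * indicator \<Omega> x)"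
            using C1(1) by (auto simp: u_def indicator_def)
        qed
        show "integrable lebesgue (\<lambda>x. indicator \<Omega> x *\<^sub>R (g x * \<phi> x))"
        proof (rule Bochner_Integration.integrable_bound[OF ind[of "L * C0"] m2])
          show "AE x in lebesgue. norm (indicator \<Omega> x *\<^sub>R (g x * \<phi> x)) \<le> norm (L * C0 * indicator \<Omega> x)"
            using N_null
          proof eventually_elim
            case (elim x)
            have "\<bar>g x * \<phi> x\<bar> \<le> L * C0" if "x \<in> \<Omega>"
              unfolding abs_mult using that elim g_bnd C0 L by (intro mult_mono) auto
            then show ?case using L C0(1) by (auto simp: indicator_def)
          qed
        qed
      qed
      have "(\<lambda>n. integral\<^sup>L lebesgue (F n)) \<longlonglongrightarrow> integral\<^sup>L lebesgue G"
      proof (rule integral_dominated_convergence)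
        show "integrable lebesgue (\<lambda>x. (\<bar>B\<bar> * C1 + L * C0) * indicator S x)"
          by (intro integrable_mult_right) (simp add: S_def flip: lmeasurable_iff_integrable)
        show "G \<in> borel_measurable lebesgue"
          unfolding G_def[abs_def] using G_parts by (intro borel_measurable_add) (auto intro: borel_measurable_integrable)
      qed (use F_bnd F_lim F_meas in auto)
      moreover have "integral\<^sup>L lebesgue (F n) = 0" for n
        unfolding F_def using integral_difference_zero[OF f_meas f_int, of "h n *\<^sub>R ?e"] by simp
      ultimately have "integral\<^sup>L lebesgue G = 0" by (simp add: LIMSEQ_const_iff)
      then show "(LINT x:\<Omega>|lebesgue. v x * partial_deriv k \<phi> x) = - (LINT x:\<Omega>|lebesgue. g x * \<phi> x)"
        unfolding G_def set_lebesgue_integral_def using G_parts by simp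
    qed
    ultimately show ?thesis by blast
  qed
  ultimately show ?thesis by (simp add: H1_def)
qed

section \<open>The polar parametrization\<close>

definition cross2 :: "real^2 \<Rightarrow> real^2 \<Rightarrow> real" where
  "cross2 a b = a $ 1 * b $ 2 - a $ 2 * b $ 1"

lemma cross2_bilinear:
  "cross2 (a + a') b = cross2 a b + cross2 a' b" "cross2 a (b + b') = cross2 a b + cross2 a b'"
  "cross2 (a - a') b = cross2 a b - cross2 a' b" "cross2 a (b - b') = cross2 a b - cross2 a b'"
  "cross2 (r *\<^sub>R a) b = r * cross2 a b" "cross2 a (r *\<^sub>R b) = r * cross2 a b"
  "cross2 a a = 0"
  by (simp_all add: cross2_def algebra_simps)

lemma cross2_swap: "cross2 b a = - cross2 a b"
  by (simp add: cross2_def)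

lemma abs_cross2_le: "\<bar>cross2 a b\<bar> \<le> 2 * norm a * norm b"
proof -
  have "\<bar>a $ 1 * b $ 2\<bar> \<le> norm a * norm b" "\<bar>a $ 2 * b $ 1\<bar> \<le> norm a * norm b"
    unfolding abs_mult using component_le_norm_cart[of a] component_le_norm_cart[of b]
    by (intro mult_mono; simp)+
  then show ?thesis unfolding cross2_def by linarith
qed

text \<open>A mean value inequality in integrated form, which tolerates finitely many points without
  derivative.\<close>

lemma increment_ge:
  fixes q :: "real \<Rightarrow> real"
  assumes "a \<le> b" "finite Z" "continuous_on {a..b} q"
    and "\<And>s. s \<in> {a<..<b} - Z \<Longrightarrow> (q has_vector_derivative q' s) (at s)"
    and "\<And>s. s \<in> {a<..<b} - Z \<Longrightarrow> m \<le> q' s"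
  shows "m * (b - a) \<le> q b - q a"
proof -
  define d where "d s = (if s \<in> {a<..<b} - Z then q' s else m)" for s
  have 1: "(d has_integral q b - q a) {a..b}"
    using assms by (intro fundamental_theorem_of_calculus_interior_strong[of Z]) (auto simp: d_def)
  have 2: "((\<lambda>_. m) has_integral m * (b - a)) {a..b}"
    using has_integral_const_real[of m a b] assms(1) by (simp add: mult.commute)
  show ?thesis
    by (rule has_integral_le[OF 2 1]) (use assms(5) in \<open>auto simp: d_def\<close>)
qed

lemma vector_derivative_norm_le_lipschitz:
  fixes f :: "real \<Rightarrow> 'a::real_normed_vector"
  assumes "C-lipschitz_on S f" "open T" "T \<subseteq> S" "t \<in> T" "(f has_vector_derivative f') (at t)"
  shows "norm f' \<le> C"
proof -
  have "((\<lambda>h. norm (f (t + h) - f t - h *\<^sub>R f') / norm h) \<longlongrightarrow> 0) (at 0)"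
    using assms(5) by (simp add: has_vector_derivative_def has_derivative_at)
  moreover have "\<forall>\<^sub>F h in at 0. norm f' - C \<le> norm (f (t + h) - f t - h *\<^sub>R f') / norm h"
  proof -
    obtain d where d: "d > 0" "ball t d \<subseteq> T" using assms(2,4) openE by blast
    have "norm f' - C \<le> norm (f (t + h) - f t - h *\<^sub>R f') / norm h" if "h \<noteq> 0" "dist h 0 < d" for h
    proof -
      have "t + h \<in> ball t d" using that by (simp add: dist_norm)
      then have "t + h \<in> S" using d(2) assms(3) by blast
      then have "norm (f (t + h) - f t) \<le> C * norm h"
        using lipschitz_onD[OF assms(1), of "t + h" t] assms(3,4) by (auto simp: dist_norm)
      moreover have "norm (h *\<^sub>R f') \<le> norm (f (t + h) - f t) + norm (f (t + h) - f t - h *\<^sub>R f')"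
        using norm_triangle_ineq4[of "f (t + h) - f t" "f (t + h) - f t - h *\<^sub>R f'"] by simp
      ultimately have "(norm f' - C) * norm h \<le> norm (f (t + h) - f t - h *\<^sub>R f')"
        by (simp add: algebra_simps)
      then show ?thesis using that by (simp add: pos_le_divide_eq)
    qed
    then show ?thesis unfolding eventually_at using d(1) by blast
  qed
  ultimately have "norm f' - C \<le> 0" by (rule tendsto_lowerbound) simp
  then show ?thesis by simp
qed

lemma polar_has_derivative:
  assumes "\<And>\<zeta>. \<zeta> \<in> cbox 0 1 \<Longrightarrow> F \<zeta> = \<zeta> $ 1 *\<^sub>R \<gamma> (\<zeta> $ 2)" "\<zeta> \<in> box 0 1"
    and "(\<gamma> has_vector_derivative d) (at (\<zeta> $ 2))"
  shows "(F has_derivative (\<lambda>h. h $ 1 *\<^sub>R \<gamma> (\<zeta> $ 2) + (\<zeta> $ 1 * h $ 2) *\<^sub>R d)) (at (\<zeta> :: real^2))"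
proof -
  have "(\<gamma> has_derivative (\<lambda>h. h *\<^sub>R d)) (at (\<zeta> $ 2))"
    using assms(3) by (simp add: has_vector_derivative_def)
  then have "((\<lambda>\<zeta>. \<gamma> (\<zeta> $ 2)) has_derivative (\<lambda>h. h $ 2 *\<^sub>R d)) (at \<zeta>)"
    by (rule has_derivative_compose[OF bounded_linear_imp_has_derivative[OF bounded_linear_vec_nth]])
  then have "((\<lambda>\<zeta>. \<zeta> $ 1 *\<^sub>R \<gamma> (\<zeta> $ 2)) has_derivative
      (\<lambda>h. \<zeta> $ 1 *\<^sub>R (h $ 2 *\<^sub>R d) + h $ 1 *\<^sub>R \<gamma> (\<zeta> $ 2))) (at \<zeta>)"
    by (rule has_derivative_scaleR[OF bounded_linear_imp_has_derivative[OF bounded_linear_vec_nth]])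
  then have "((\<lambda>\<zeta>. \<zeta> $ 1 *\<^sub>R \<gamma> (\<zeta> $ 2)) has_derivative
      (\<lambda>h. h $ 1 *\<^sub>R \<gamma> (\<zeta> $ 2) + (\<zeta> $ 1 * h $ 2) *\<^sub>R d)) (at \<zeta>)"
    by (simp add: add.commute)
  then show ?thesis
    by (rule has_derivative_transform_within_open[OF _ open_box assms(2)])
       (use box_subset_cbox assms(1) in \<open>metis subsetD\<close>)
qed

text \<open>Since det J_F is \<zeta>1 times
  \<open>cross2 (\<gamma> \<zeta>2) (\<gamma>' \<zeta>2)\<close>, the assumption
  \<open>cross\<close> is the lower Jacobian bound freed from the radius. Z contains the parameters
  at which \<gamma> may have a kink.\<close>

locale polar_map =
  fixes \<gamma> \<gamma>' :: "real \<Rightarrow> real^2" and F :: "real^2 \<Rightarrow> real^2" and Z :: "real set" and CL c1 :: real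
    and \<Omega> :: "(real^2) set"
  assumes F_eq: "\<And>\<zeta>. \<zeta> \<in> cbox 0 1 \<Longrightarrow> F \<zeta> = \<zeta> $ 1 *\<^sub>R \<gamma> (\<zeta> $ 2)"
    and \<gamma>_lip: "CL-lipschitz_on {0..1} \<gamma>" and CL: "CL > 0" and finite_Z: "finite Z" and c1: "c1 > 0"
    and \<gamma>_diff: "\<And>t. t \<in> {0<..<1} - Z \<Longrightarrow> (\<gamma> has_vector_derivative \<gamma>' t) (at t)"
    and cross: "\<And>t. t \<in> {0<..<1} - Z \<Longrightarrow> c1 \<le> cross2 (\<gamma> t) (\<gamma>' t)"
    and inj: "inj_on F (box 0 1)" and \<Omega>_eq: "\<Omega> = F ` box 0 1"
begin

text \<open>Chosen such that replacing \<gamma>(s) by \<gamma>(a) for |a - s| < \<delta> changes the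
  cross product with \<gamma>'(s) by at most 2 (CL \<delta>) CL = c1 / 2, half of its lower
  bound.\<close>

definition \<delta> :: real where "\<delta> = c1 / (4 * CL * CL)"

lemma \<delta>_pos: "\<delta> > 0"
  using c1 CL by (simp add: \<delta>_def)

lemma \<gamma>_dist: "s \<in> {0..1} \<Longrightarrow> t \<in> {0..1} \<Longrightarrow> norm (\<gamma> s - \<gamma> t) \<le> CL * \<bar>s - t\<bar>"
  using lipschitz_onD[OF \<gamma>_lip] by (simp add: dist_norm)

lemma \<gamma>'_norm: "t \<in> {0<..<1} - Z \<Longrightarrow> norm (\<gamma>' t) \<le> CL"
  by (rule vector_derivative_norm_le_lipschitz[OF \<gamma>_lip, of "{0<..<1}" t]) (use \<gamma>_diff in auto)

lemma continuous_on_\<gamma>: "continuous_on {0..1} \<gamma>"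
  by (rule lipschitz_on_continuous_on[OF \<gamma>_lip])

text \<open>As a function of b, the cross product starts at 0 for b = a and has derivative at least
  c1 / 2 by the choice of \<delta>: the curve turns counterclockwise at a uniform rate.\<close>

lemma cross_increment:
  assumes "a \<in> {0<..<1}" "b \<in> {0<..<1}" "a \<le> b" "b - a < \<delta>"
  shows "c1 / 2 * (b - a) \<le> cross2 (\<gamma> a) (\<gamma> b)"
proof -
  have "c1 / 2 * (b - a) \<le> cross2 (\<gamma> a) (\<gamma> b) - cross2 (\<gamma> a) (\<gamma> a)"
  proof (rule increment_ge[OF assms(3) finite_Z])
    have "continuous_on {a..b} \<gamma>" using assms by (intro continuous_on_subset[OF continuous_on_\<gamma>]) auto
    then show "continuous_on {a..b} (\<lambda>s. cross2 (\<gamma> a) (\<gamma> s))"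
      unfolding cross2_def by (intro continuous_intros)
    fix s assume s: "s \<in> {a<..<b} - Z"
    then have s': "s \<in> {0<..<1} - Z" using assms by auto
    have "((\<lambda>s. \<gamma> s $ i) has_vector_derivative \<gamma>' s $ i) (at s)" for i
      by (rule bounded_linear.has_vector_derivative[OF bounded_linear_vec_nth \<gamma>_diff[OF s']])
    then show "((\<lambda>s. cross2 (\<gamma> a) (\<gamma> s)) has_vector_derivative cross2 (\<gamma> a) (\<gamma>' s)) (at s)"
      unfolding cross2_def by (intro has_vector_derivative_diff has_vector_derivative_mult_right)
    have "\<bar>cross2 (\<gamma> a - \<gamma> s) (\<gamma>' s)\<bar> \<le> 2 * norm (\<gamma> a - \<gamma> s) * norm (\<gamma>' s)"
      by (rule abs_cross2_le)
    also have "\<dots> \<le> 2 * (CL * \<delta>) * CL"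
    proof (intro mult_mono \<gamma>'_norm[OF s'])
      have "CL * \<bar>a - s\<bar> \<le> CL * \<delta>" using s assms(4) CL by (intro mult_left_mono) auto
      then show "norm (\<gamma> a - \<gamma> s) \<le> CL * \<delta>" using \<gamma>_dist[of a s] s' assms by force
    qed (use CL \<delta>_pos in auto)
    also have "\<dots> = c1 / 2" using CL by (simp add: \<delta>_def)
    finally have "\<bar>cross2 (\<gamma> a - \<gamma> s) (\<gamma>' s)\<bar> \<le> c1 / 2" .
    moreover have "cross2 (\<gamma> a) (\<gamma>' s) = cross2 (\<gamma> s) (\<gamma>' s) + cross2 (\<gamma> a - \<gamma> s) (\<gamma>' s)"
      by (simp add: cross2_bilinear)
    ultimately show "c1 / 2 \<le> cross2 (\<gamma> a) (\<gamma>' s)"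
      using cross[OF s'] by linarith
  qed
  then show ?thesis by (simp add: cross2_bilinear)
qed

lemma abs_cross_ge:
  assumes "a \<in> {0<..<1}" "b \<in> {0<..<1}" "\<bar>a - b\<bar> < \<delta>"
  shows "c1 / 2 * \<bar>a - b\<bar> \<le> \<bar>cross2 (\<gamma> a) (\<gamma> b)\<bar>"
  using cross_increment[of a b] cross_increment[of b a] assms cross2_swap[of "\<gamma> a" "\<gamma> b"]
  by (cases "a \<le> b") auto

text \<open>A curve that turns this fast cannot come close to the corner: the cross product of
  \<gamma>(t) and \<gamma>(t + h) is at least c1 h / 2 and at most 2 |\<gamma>(t)| CL h.\<close>

lemma \<gamma>_norm_ge:
  assumes "t \<in> {0<..<1}"
  shows "c1 / (4 * CL) \<le> norm (\<gamma> t)"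
proof -
  define h where "h = min (\<delta> / 2) ((1 - t) / 2)"
  have h: "0 < h" "h < \<delta>" "t + h < 1" using assms \<delta>_pos by (auto simp: h_def min_def field_simps)
  have "c1 / 2 * h \<le> cross2 (\<gamma> t) (\<gamma> (t + h))" using cross_increment[of t "t + h"] assms h by simp
  also have "\<dots> = cross2 (\<gamma> t) (\<gamma> (t + h) - \<gamma> t)" by (simp add: cross2_bilinear)
  also have "\<dots> \<le> 2 * norm (\<gamma> t) * norm (\<gamma> (t + h) - \<gamma> t)"
    using abs_cross2_le[of "\<gamma> t" "\<gamma> (t + h) - \<gamma> t"] by linarith
  also have "\<dots> \<le> 2 * norm (\<gamma> t) * (CL * h)"
    using \<gamma>_dist[of "t + h" t] assms h by (intro mult_left_mono) auto
  finally have "(c1 / 2) * h \<le> (2 * norm (\<gamma> t) * CL) * h" by (simp add: mult_ac)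
  then have "c1 / 2 \<le> 2 * norm (\<gamma> t) * CL" using h(1) by (simp only: mult_le_cancel_right_pos)
  then show ?thesis using CL by (simp add: divide_le_eq mult_ac)
qed

definition \<Gamma> :: real where "\<Gamma> = norm (\<gamma> 0) + CL"

lemma \<gamma>_norm_le:
  assumes "t \<in> {0..1}"
  shows "norm (\<gamma> t) \<le> \<Gamma>"
proof -
  have "norm (\<gamma> t - \<gamma> 0) \<le> CL * \<bar>t - 0\<bar>" using assms by (intro \<gamma>_dist) auto
  also have "\<dots> \<le> CL * 1" using assms CL by (intro mult_left_mono) auto
  finally show ?thesis using norm_triangle_sub[of "\<gamma> t" "\<gamma> 0"] by (simp add: \<Gamma>_def)
qed

lemma \<Gamma>_pos: "\<Gamma> > 0"
  using CL by (simp add: \<Gamma>_def add_nonneg_pos)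

text \<open>The angular difference, weighted with the radius, is controlled by the cross product of
  the two images, and the radial difference afterwards by the triangle inequality. Close second
  parameters are required, because across a slit close images can have distant parameters.\<close>

lemma inverse_estimate:
  obtains A where "A > 0" "\<And>\<zeta> \<eta>. \<zeta> \<in> box 0 1 \<Longrightarrow> \<eta> \<in> box 0 1 \<Longrightarrow> \<bar>\<zeta> $ 2 - \<eta> $ 2\<bar> < \<delta> \<Longrightarrow>
    \<zeta> $ 1 * \<bar>\<zeta> $ 2 - \<eta> $ 2\<bar> \<le> A * norm (F \<zeta> - F \<eta>) \<and> \<bar>\<zeta> $ 1 - \<eta> $ 1\<bar> \<le> A * norm (F \<zeta> - F \<eta>)"
proof -
  define A1 where "A1 = 4 * \<Gamma> / c1"
  define A2 where "A2 = (1 + CL * A1) * (4 * CL) / c1"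
  have A1: "A1 > 0" using \<Gamma>_pos c1 by (simp add: A1_def)
  have A2: "A2 > 0" unfolding A2_def using A1 CL c1 by (intro divide_pos_pos mult_pos_pos add_pos_pos) auto
  show ?thesis
  proof (rule that[of "A1 + A2"])
    fix \<zeta> \<eta> :: "real^2" assume \<zeta>\<eta>: "\<zeta> \<in> box 0 1" "\<eta> \<in> box 0 1" "\<bar>\<zeta> $ 2 - \<eta> $ 2\<bar> < \<delta>"
    then have m: "\<zeta> $ 1 \<in> {0<..<1}" "\<zeta> $ 2 \<in> {0<..<1}" "\<eta> $ 1 \<in> {0<..<1}" "\<eta> $ 2 \<in> {0<..<1}"
      by (auto simp: mem_open_unit_square)
    define x where "x = F \<zeta>"
    define y where "y = F \<eta>"
    have F: "x = \<zeta> $ 1 *\<^sub>R \<gamma> (\<zeta> $ 2)" "y = \<eta> $ 1 *\<^sub>R \<gamma> (\<eta> $ 2)"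
      using \<zeta>\<eta> box_subset_cbox[of 0 "1::real^2"] by (auto simp: F_eq x_def y_def)
    define d2 where "d2 = \<bar>\<zeta> $ 2 - \<eta> $ 2\<bar>"
    \<comment> \<open>The cross product of x and y equals that of x - y and y. It carries the factor
      \<eta>1 on both sides of the estimate, so this factor can be cancelled.\<close>
    have "\<eta> $ 1 * (\<zeta> $ 1 * (c1 / 2 * d2)) \<le> \<eta> $ 1 * (\<zeta> $ 1 * \<bar>cross2 (\<gamma> (\<zeta> $ 2)) (\<gamma> (\<eta> $ 2))\<bar>)"
      unfolding d2_def using m abs_cross_ge[OF m(2,4) \<zeta>\<eta>(3)] by (intro mult_left_mono) auto
    also have "\<dots> = \<bar>cross2 x y\<bar>"
      unfolding F cross2_bilinear using m by (simp add: abs_mult)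
    also have "\<dots> = \<bar>cross2 (x - y) y\<bar>" by (simp add: cross2_bilinear)
    also have "\<dots> \<le> 2 * norm (x - y) * norm y" by (rule abs_cross2_le)
    also have "\<dots> \<le> 2 * norm (x - y) * (\<eta> $ 1 * \<Gamma>)"
      unfolding F(2) using m \<gamma>_norm_le[of "\<eta> $ 2"] by (intro mult_left_mono) auto
    finally have "\<eta> $ 1 * (\<zeta> $ 1 * (c1 / 2 * d2)) \<le> \<eta> $ 1 * (2 * norm (x - y) * \<Gamma>)"
      by (simp add: mult_ac)
    then have "\<zeta> $ 1 * (c1 / 2 * d2) \<le> 2 * norm (x - y) * \<Gamma>" using m by simp
    then have 1: "\<zeta> $ 1 * d2 \<le> A1 * norm (x - y)"
      unfolding A1_def using c1 by (simp add: field_simps)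
    \<comment> \<open>The splitting is arranged so that the angular error appears with the weight
      \<zeta>1, which has just been estimated; |\<gamma>| is bounded away from 0.\<close>
    have "(\<zeta> $ 1 - \<eta> $ 1) *\<^sub>R \<gamma> (\<eta> $ 2) = (x - y) + \<zeta> $ 1 *\<^sub>R (\<gamma> (\<eta> $ 2) - \<gamma> (\<zeta> $ 2))"
      unfolding F by (simp add: algebra_simps)
    then have "\<bar>\<zeta> $ 1 - \<eta> $ 1\<bar> * norm (\<gamma> (\<eta> $ 2)) = norm ((x - y) + \<zeta> $ 1 *\<^sub>R (\<gamma> (\<eta> $ 2) - \<gamma> (\<zeta> $ 2)))"
      by (metis norm_scaleR)
    also have "\<dots> \<le> norm (x - y) + \<zeta> $ 1 * norm (\<gamma> (\<eta> $ 2) - \<gamma> (\<zeta> $ 2))"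
      using norm_triangle_ineq[of "x - y" "\<zeta> $ 1 *\<^sub>R (\<gamma> (\<eta> $ 2) - \<gamma> (\<zeta> $ 2))"] m by simp
    also have "\<dots> \<le> norm (x - y) + \<zeta> $ 1 * (CL * d2)"
      unfolding d2_def using m \<gamma>_dist[of "\<eta> $ 2" "\<zeta> $ 2"]
      by (intro add_left_mono mult_left_mono) (auto simp: abs_minus_commute)
    also have "\<dots> = norm (x - y) + CL * (\<zeta> $ 1 * d2)" by simp
    also have "\<dots> \<le> norm (x - y) + CL * (A1 * norm (x - y))"
      using 1 CL by (intro add_left_mono mult_left_mono) auto
    finally have 2: "\<bar>\<zeta> $ 1 - \<eta> $ 1\<bar> * norm (\<gamma> (\<eta> $ 2)) \<le> (1 + CL * A1) * norm (x - y)"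
      by (simp add: algebra_simps)
    have "\<bar>\<zeta> $ 1 - \<eta> $ 1\<bar> * (c1 / (4 * CL)) \<le> \<bar>\<zeta> $ 1 - \<eta> $ 1\<bar> * norm (\<gamma> (\<eta> $ 2))"
      using \<gamma>_norm_ge[OF m(4)] by (intro mult_left_mono) auto
    with 2 have "\<bar>\<zeta> $ 1 - \<eta> $ 1\<bar> * (c1 / (4 * CL)) \<le> (1 + CL * A1) * norm (x - y)" by linarith
    then have "\<bar>\<zeta> $ 1 - \<eta> $ 1\<bar> \<le> (1 + CL * A1) * norm (x - y) / (c1 / (4 * CL))"
      using c1 CL by (subst pos_le_divide_eq) auto
    also have "\<dots> = A2 * norm (x - y)" by (simp add: A2_def)
    finally have 3: "\<bar>\<zeta> $ 1 - \<eta> $ 1\<bar> \<le> A2 * norm (x - y)" .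
    have "A1 * norm (x - y) \<le> (A1 + A2) * norm (x - y)" "A2 * norm (x - y) \<le> (A1 + A2) * norm (x - y)"
      using A1 A2 by (intro mult_right_mono; simp)+
    then show "\<zeta> $ 1 * \<bar>\<zeta> $ 2 - \<eta> $ 2\<bar> \<le> (A1 + A2) * norm (F \<zeta> - F \<eta>) \<and> \<bar>\<zeta> $ 1 - \<eta> $ 1\<bar> \<le> (A1 + A2) * norm (F \<zeta> - F \<eta>)"
      using 1 3 unfolding d2_def x_def y_def by linarith
  qed (use A1 A2 in simp)
qed

lemma F_lipschitz: "\<exists>C. C-lipschitz_on (cbox 0 1) F"
proof -
  have "(\<Gamma> + CL)-lipschitz_on (cbox 0 1) F"
  proof (rule lipschitz_onI)
    fix \<zeta> \<eta> :: "real^2" assume "\<zeta> \<in> cbox 0 1" "\<eta> \<in> cbox 0 1"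
    then have m: "\<zeta> $ 1 \<in> {0..1}" "\<zeta> $ 2 \<in> {0..1}" "\<eta> $ 1 \<in> {0..1}" "\<eta> $ 2 \<in> {0..1}"
      and F: "F \<zeta> = \<zeta> $ 1 *\<^sub>R \<gamma> (\<zeta> $ 2)" "F \<eta> = \<eta> $ 1 *\<^sub>R \<gamma> (\<eta> $ 2)"
      by (auto simp: mem_unit_square F_eq)
    have c: "\<bar>\<zeta> $ i - \<eta> $ i\<bar> \<le> norm (\<zeta> - \<eta>)" for i
      using component_le_norm_cart[of "\<zeta> - \<eta>" i] by simp
    have "F \<zeta> - F \<eta> = (\<zeta> $ 1 - \<eta> $ 1) *\<^sub>R \<gamma> (\<zeta> $ 2) + \<eta> $ 1 *\<^sub>R (\<gamma> (\<zeta> $ 2) - \<gamma> (\<eta> $ 2))"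
      by (simp add: F algebra_simps)
    then have "norm (F \<zeta> - F \<eta>) \<le> \<bar>\<zeta> $ 1 - \<eta> $ 1\<bar> * norm (\<gamma> (\<zeta> $ 2)) + \<bar>\<eta> $ 1\<bar> * norm (\<gamma> (\<zeta> $ 2) - \<gamma> (\<eta> $ 2))"
      by (metis norm_triangle_ineq norm_scaleR)
    also have "\<dots> \<le> norm (\<zeta> - \<eta>) * \<Gamma> + 1 * (CL * norm (\<zeta> - \<eta>))"
    proof (intro add_mono mult_mono c \<gamma>_norm_le m)
      have "norm (\<gamma> (\<zeta> $ 2) - \<gamma> (\<eta> $ 2)) \<le> CL * \<bar>\<zeta> $ 2 - \<eta> $ 2\<bar>" by (intro \<gamma>_dist m)
      also have "\<dots> \<le> CL * norm (\<zeta> - \<eta>)" using CL by (intro mult_left_mono c) simp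
      finally show "norm (\<gamma> (\<zeta> $ 2) - \<gamma> (\<eta> $ 2)) \<le> CL * norm (\<zeta> - \<eta>)" .
    qed (use m \<Gamma>_pos in auto)
    finally show "dist (F \<zeta>) (F \<eta>) \<le> (\<Gamma> + CL) * dist \<zeta> \<eta>" by (simp add: dist_norm algebra_simps)
  qed (use \<Gamma>_pos CL in simp)
  then show ?thesis ..
qed

lemma continuous_on_F: "continuous_on (cbox 0 1) F"
  using F_lipschitz lipschitz_on_continuous_on by blast

lemma continuous_on_F_box: "continuous_on (box 0 1) F"
  by (rule continuous_on_subset[OF continuous_on_F box_subset_cbox])

abbreviation G :: "real^2 \<Rightarrow> real^2" where "G \<equiv> inv_into (box 0 1) F"

lemma open_\<Omega>: "open \<Omega>"
  unfolding \<Omega>_eq by (rule invariance_of_domain[OF continuous_on_F_box open_box inj])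

lemma bounded_\<Omega>: "bounded \<Omega>"
proof -
  have "bounded (F ` cbox 0 1)"
    by (intro compact_imp_bounded compact_continuous_image continuous_on_F compact_cbox)
  then show ?thesis unfolding \<Omega>_eq by (rule bounded_subset) (use box_subset_cbox in blast)
qed

lemma G_F: "\<zeta> \<in> box 0 1 \<Longrightarrow> G (F \<zeta>) = \<zeta>"
  using inj by simp

lemma F_G: "x \<in> \<Omega> \<Longrightarrow> F (G x) = x"
  unfolding \<Omega>_eq by (rule f_inv_into_f)

lemma G_box: "x \<in> \<Omega> \<Longrightarrow> G x \<in> box 0 1"
  unfolding \<Omega>_eq by (rule inv_into_into)

lemma continuous_on_G: "continuous_on \<Omega> G"
proof -
  obtain g where g: "homeomorphism (box 0 1) (F ` box 0 1) F g"
    using invariance_of_domain_homeomorphism[OF open_box continuous_on_F_box _ inj] by auto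
  then have "continuous_on \<Omega> g" "\<And>x. x \<in> \<Omega> \<Longrightarrow> G x = g x"
    unfolding homeomorphism_def \<Omega>_eq using inj by (auto simp: inv_into_f_f)
  then show ?thesis by (simp cong: continuous_on_cong)
qed

end

lemma lipschitz_on_divide:
  fixes f g :: "real \<Rightarrow> real"
  assumes "C-lipschitz_on {0..1} f" "D-lipschitz_on {0..1} g" "\<And>t. t \<in> {0..1} \<Longrightarrow> g t > 0"
  shows "\<exists>E. E-lipschitz_on {0..1} (\<lambda>t. f t / g t)"
proof -
  have cf: "continuous_on {0..1} f" and cg: "continuous_on {0..1} g"
    using assms(1,2) lipschitz_on_continuous_on by blast+
  obtain t0 where t0: "t0 \<in> {0..1}" "\<And>t. t \<in> {0..1} \<Longrightarrow> g t0 \<le> g t"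
    using continuous_attains_inf[of "{0..1::real}" g] cg by auto
  define m where "m = g t0"
  have m: "m > 0" "\<And>t. t \<in> {0..1} \<Longrightarrow> m \<le> g t" using t0 assms(3) by (auto simp: m_def)
  have "bounded (f ` {0..1})" by (intro compact_imp_bounded compact_continuous_image cf) simp
  then obtain B where "\<forall>y\<in>f ` {0..1}. \<bar>y\<bar> \<le> B" unfolding bounded_real by blast
  then have B: "\<And>t. t \<in> {0..1} \<Longrightarrow> \<bar>f t\<bar> \<le> B" by blast
  have CD: "C \<ge> 0" "D \<ge> 0" using assms(1,2) lipschitz_on_nonneg by blast+
  have B0: "B \<ge> 0" using B[of 0] by simp
  have "(C / m + B * D / (m * m))-lipschitz_on {0..1} (\<lambda>t. f t / g t)"
  proof (rule lipschitz_onI)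
    fix s t :: real assume st: "s \<in> {0..1}" "t \<in> {0..1}"
    have g: "g s > 0" "g t > 0" using assms(3) st by auto
    have "f s / g s - f t / g t = (f s - f t) / g s + f t * (g t - g s) / (g s * g t)"
      using g by (simp add: field_simps)
    then have "\<bar>f s / g s - f t / g t\<bar> \<le> \<bar>f s - f t\<bar> / g s + \<bar>f t\<bar> * \<bar>g t - g s\<bar> / (g s * g t)"
      using g abs_triangle_ineq[of "(f s - f t) / g s" "f t * (g t - g s) / (g s * g t)"]
      by (simp add: abs_mult)
    also have "\<dots> \<le> C * \<bar>s - t\<bar> / m + B * (D * \<bar>s - t\<bar>) / (m * m)"
    proof (intro add_mono frac_le mult_mono)
      show "\<bar>f s - f t\<bar> \<le> C * \<bar>s - t\<bar>" using lipschitz_onD[OF assms(1) st] by (simp add: dist_real_def)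
      show "\<bar>g t - g s\<bar> \<le> D * \<bar>s - t\<bar>"
        using lipschitz_onD[OF assms(2) st(2,1)] by (simp add: dist_real_def abs_minus_commute)
    qed (use m st B CD g B0 in \<open>auto intro!: mult_nonneg_nonneg\<close>)
    finally show "dist (f s / g s) (f t / g t) \<le> (C / m + B * D / (m * m)) * dist s t"
      by (simp add: dist_real_def algebra_simps)
  qed (use CD m B0 in simp)
  then show ?thesis ..
qed

section \<open>Transfer of functions to the physical domain\<close>

context polar_map
begin

text \<open>The inverse map is continuous, so near x the second parameters differ by less than
  \<delta> and the inverse estimate applies. Only the radius of the ball depends on x, not the
  constant.\<close>

lemma locally_lipschitz_pullback:
  assumes U: "\<And>\<zeta> \<eta>. \<zeta> \<in> box 0 1 \<Longrightarrow> \<eta> \<in> box 0 1 \<Longrightarrow>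
      \<bar>U \<zeta> - U \<eta>\<bar> \<le> L0 * (\<bar>\<zeta> $ 1 - \<eta> $ 1\<bar> + \<zeta> $ 1 * \<bar>\<zeta> $ 2 - \<eta> $ 2\<bar>)" and L0: "L0 \<ge> 0"
  obtains L where "L \<ge> 0" "\<And>x. x \<in> \<Omega> \<Longrightarrow> \<exists>r>0. ball x r \<subseteq> \<Omega> \<and> L-lipschitz_on (ball x r) (U \<circ> G)"
proof -
  obtain A where A: "A > 0" "\<And>\<zeta> \<eta>. \<zeta> \<in> box 0 1 \<Longrightarrow> \<eta> \<in> box 0 1 \<Longrightarrow> \<bar>\<zeta> $ 2 - \<eta> $ 2\<bar> < \<delta> \<Longrightarrow>
    \<zeta> $ 1 * \<bar>\<zeta> $ 2 - \<eta> $ 2\<bar> \<le> A * norm (F \<zeta> - F \<eta>) \<and> \<bar>\<zeta> $ 1 - \<eta> $ 1\<bar> \<le> A * norm (F \<zeta> - F \<eta>)"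
    by (rule inverse_estimate) (rule that)
  show ?thesis
  proof (rule that[of "L0 * (2 * A)"])
    fix x assume x: "x \<in> \<Omega>"
    have "isCont G x" using continuous_on_G open_\<Omega> x by (simp add: continuous_on_eq_continuous_at)
    then obtain d where d: "d > 0" "\<And>y. dist y x < d \<Longrightarrow> dist (G y) (G x) < \<delta> / 2"
      using \<delta>_pos unfolding continuous_at_eps_delta by (meson half_gt_zero)
    obtain r0 where r0: "r0 > 0" "ball x r0 \<subseteq> \<Omega>" using open_\<Omega> x openE by blast
    define r where "r = min d r0"
    have r: "r > 0" "ball x r \<subseteq> \<Omega>" using d r0 by (auto simp: r_def)
    have "(L0 * (2 * A))-lipschitz_on (ball x r) (U \<circ> G)"
    proof (rule lipschitz_onI)
      fix y z assume yz: "y \<in> ball x r" "z \<in> ball x r"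
      then have \<Omega>: "y \<in> \<Omega>" "z \<in> \<Omega>" using r by auto
      have "dist y x < d" "dist z x < d" using yz by (simp_all add: r_def dist_commute)
      then have "dist (G y) (G x) < \<delta> / 2" "dist (G z) (G x) < \<delta> / 2" using d(2) by blast+
      then have "norm (G y - G z) < \<delta>" using dist_triangle2[of "G y" "G z" "G x"] by (simp add: dist_norm)
      then have close: "\<bar>G y $ 2 - G z $ 2\<bar> < \<delta>"
        using component_le_norm_cart[of "G y - G z" 2] by simp
      have a: "G y $ 1 * \<bar>G y $ 2 - G z $ 2\<bar> \<le> A * norm (y - z)" "\<bar>G y $ 1 - G z $ 1\<bar> \<le> A * norm (y - z)"
        using A(2)[OF G_box[OF \<Omega>(1)] G_box[OF \<Omega>(2)] close] by (simp_all add: F_G \<Omega>)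
      have "\<bar>U (G y) - U (G z)\<bar> \<le> L0 * (\<bar>G y $ 1 - G z $ 1\<bar> + G y $ 1 * \<bar>G y $ 2 - G z $ 2\<bar>)"
        by (intro U G_box \<Omega>)
      also have "\<dots> \<le> L0 * (A * norm (y - z) + A * norm (y - z))"
        using a L0 by (intro mult_left_mono add_mono) auto
      finally show "dist ((U \<circ> G) y) ((U \<circ> G) z) \<le> L0 * (2 * A) * dist y z"
        by (simp add: dist_real_def dist_norm algebra_simps)
    qed (use L0 A(1) in simp)
    then show "\<exists>r>0. ball x r \<subseteq> \<Omega> \<and> (L0 * (2 * A))-lipschitz_on (ball x r) (U \<circ> G)" using r by blast
  qed (use L0 A(1) in simp)
qed

lemma F_has_derivative:
  assumes "\<zeta> \<in> box 0 1" "\<zeta> $ 2 \<notin> Z"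
  shows "(F has_derivative (\<lambda>h. h $ 1 *\<^sub>R \<gamma> (\<zeta> $ 2) + (\<zeta> $ 1 * h $ 2) *\<^sub>R \<gamma>' (\<zeta> $ 2))) (at \<zeta>)"
  by (rule polar_has_derivative[OF F_eq assms(1) \<gamma>_diff]) (use assms in \<open>auto simp: mem_open_unit_square\<close>)

text \<open>The derivative of F is injective because \<gamma> and \<gamma>' have a positive cross
  product and \<zeta>1 > 0; the inverse function rule needs only this and continuity of the
  inverse.\<close>

lemma G_differentiable:
  assumes "x \<in> \<Omega>" "G x $ 2 \<notin> Z"
  shows "G differentiable (at x)"
proof -
  define \<zeta> where "\<zeta> = G x"
  have \<zeta>: "\<zeta> \<in> box 0 1" "\<zeta> $ 2 \<notin> Z" using assms G_box by (auto simp: \<zeta>_def)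
  then have t: "\<zeta> $ 2 \<in> {0<..<1} - Z" "\<zeta> $ 1 > 0" by (auto simp: mem_open_unit_square)
  define D where "D h = h $ 1 *\<^sub>R \<gamma> (\<zeta> $ 2) + (\<zeta> $ 1 * h $ 2) *\<^sub>R \<gamma>' (\<zeta> $ 2)" for h :: "real^2"
  have D: "(F has_derivative D) (at (G x))"
    using F_has_derivative[OF \<zeta>] by (simp add: D_def[abs_def] \<zeta>_def)
  have lin: "linear D" using D has_derivative_linear by blast
  have "inj D"
  proof (rule linear_injective_0[OF lin, THEN iffD2], intro allI impI)
    fix h assume h: "D h = 0"
    have c: "cross2 (\<gamma> (\<zeta> $ 2)) (\<gamma>' (\<zeta> $ 2)) > 0" using cross[OF t(1)] c1 by linarith
    have "cross2 (\<gamma> (\<zeta> $ 2)) (D h) = \<zeta> $ 1 * h $ 2 * cross2 (\<gamma> (\<zeta> $ 2)) (\<gamma>' (\<zeta> $ 2))"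
      by (simp add: D_def cross2_bilinear)
    moreover have "cross2 (\<gamma> (\<zeta> $ 2)) (D h) = 0" by (simp add: h cross2_def)
    ultimately have h2: "h $ 2 = 0" using c t(2) by simp
    then have "h $ 1 *\<^sub>R \<gamma> (\<zeta> $ 2) = 0" using h by (simp add: D_def)
    moreover have "\<gamma> (\<zeta> $ 2) \<noteq> 0" using c by (auto simp: cross2_def)
    ultimately have "h $ 1 = 0" by simp
    then show "h = 0" using h2 by (simp add: vec_eq_iff forall_2)
  qed
  then obtain g' where g': "linear g'" "g' \<circ> D = id" using linear_injective_left_inverse[OF lin] by blast
  have cont: "isCont G x" using continuous_on_G open_\<Omega> assms(1) by (simp add: continuous_on_eq_continuous_at)
  have "bounded_linear g'" using g'(1) by (simp add: linear_conv_bounded_linear)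
  then have "(G has_derivative g') (at x)"
    using g'(2) cont open_\<Omega> assms(1) F_G by (rule has_derivative_inverse_basic[where f = F and f' = D and g = G and y = x, OF D])
  then show ?thesis by (auto simp: differentiable_def)
qed

lemma negligible_mesh_image:
  assumes "finite Z1" "finite Z2"
  shows "negligible (F ` {\<zeta> \<in> box 0 1. \<zeta> $ 1 \<in> Z1 \<or> \<zeta> $ 2 \<in> Z2})"
proof (rule negligible_locally_Lipschitz_image)
  have hyper: "negligible {\<zeta> :: real^2. \<zeta> $ k = a}" for k a
    using negligible_hyperplane[of "axis k (1::real)" a] by (simp add: inner_axis' axis_eq_0_iff)
  have "negligible ((\<Union>a\<in>Z1. {\<zeta> :: real^2. \<zeta> $ 1 = a}) \<union> (\<Union>a\<in>Z2. {\<zeta>. \<zeta> $ 2 = a}))"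
    using assms by (intro negligible_Un negligible_Union) (auto simp: hyper)
  then show "negligible {\<zeta> \<in> box (0::real^2) 1. \<zeta> $ 1 \<in> Z1 \<or> \<zeta> $ 2 \<in> Z2}"
    by (rule negligible_subset) auto
  obtain C where C: "C-lipschitz_on (cbox 0 1) F" using F_lipschitz by blast
  fix \<zeta> assume "\<zeta> \<in> {\<zeta> \<in> box (0::real^2) 1. \<zeta> $ 1 \<in> Z1 \<or> \<zeta> $ 2 \<in> Z2}"
  then have "\<zeta> \<in> cbox 0 1" using box_subset_cbox by blast
  then show "\<exists>T B. open T \<and> \<zeta> \<in> T \<and>
      (\<forall>\<eta>\<in>{\<zeta> \<in> box 0 1. \<zeta> $ 1 \<in> Z1 \<or> \<zeta> $ 2 \<in> Z2} \<inter> T. norm (F \<eta> - F \<zeta>) \<le> B * norm (\<eta> - \<zeta>))"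
    using lipschitz_onD[OF C] box_subset_cbox[of 0 "1::real^2"]
    by (intro exI[of _ UNIV] exI[of _ C]) (auto simp: dist_norm)
qed simp

lemma H1_pullback:
  assumes U: "\<And>\<zeta> \<eta>. \<zeta> \<in> box 0 1 \<Longrightarrow> \<eta> \<in> box 0 1 \<Longrightarrow>
      \<bar>U \<zeta> - U \<eta>\<bar> \<le> L0 * (\<bar>\<zeta> $ 1 - \<eta> $ 1\<bar> + \<zeta> $ 1 * \<bar>\<zeta> $ 2 - \<eta> $ 2\<bar>)" and L0: "L0 \<ge> 0"
    and bnd: "\<And>\<zeta>. \<zeta> \<in> box 0 1 \<Longrightarrow> \<bar>U \<zeta>\<bar> \<le> B" and fin: "finite Z1" "finite Z2"
    and diff: "\<And>\<zeta>. \<zeta> \<in> box 0 1 \<Longrightarrow> \<zeta> $ 1 \<notin> Z1 \<Longrightarrow> \<zeta> $ 2 \<notin> Z2 \<Longrightarrow> U differentiable (at \<zeta>)"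
  shows "U \<circ> G \<in> H1 \<Omega>"
proof -
  obtain L where L: "L \<ge> 0" "\<And>x. x \<in> \<Omega> \<Longrightarrow> \<exists>r>0. ball x r \<subseteq> \<Omega> \<and> L-lipschitz_on (ball x r) (U \<circ> G)"
    using locally_lipschitz_pullback[OF U L0] by blast
  show ?thesis
  proof (rule H1_lipschitz[OF open_\<Omega> bounded_\<Omega> L _ negligible_mesh_image[of Z1 "Z2 \<union> Z"]])
    show "\<bar>(U \<circ> G) x\<bar> \<le> B" if "x \<in> \<Omega>" for x using bnd G_box[OF that] by simp
    show "finite Z1" "finite (Z2 \<union> Z)" using fin finite_Z by auto
    fix x assume x: "x \<in> \<Omega> - F ` {\<zeta> \<in> box 0 1. \<zeta> $ 1 \<in> Z1 \<or> \<zeta> $ 2 \<in> Z2 \<union> Z}"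
    then have m: "G x $ 1 \<notin> Z1" "G x $ 2 \<notin> Z2 \<union> Z" using G_box F_G by (force simp: image_iff)+
    have "G differentiable (at x)" using x m by (intro G_differentiable) auto
    moreover have "U differentiable (at (G x))" using x m by (intro diff G_box) auto
    ultimately show "U \<circ> G differentiable (at x)" by (rule differentiable_chain_at)
  qed
qed

end

section \<open>Functions with vanishing weak derivatives\<close>

text \<open>Differentiating q(1/x) exp(-1/x) gives r(1/x) exp(-1/x) with r(y) = y^2 (q(y) -
  q'(y)).\<close>

fun flat_poly :: "nat \<Rightarrow> real poly" where
  "flat_poly 0 = 1"
| "flat_poly (Suc n) = [:0, 0, 1:] * (flat_poly n - pderiv (flat_poly n))"

text \<open>The \<open>n\<close>-th derivative of the flat function that is \<open>exp (- 1 / x)\<close> for \<open>x > 0\<close>.\<close>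

definition flat :: "nat \<Rightarrow> real \<Rightarrow> real" where
  "flat n x = (if x > 0 then poly (flat_poly n) (1 / x) * exp (- 1 / x) else 0)"

lemma poly_exp_tendsto_0: "((\<lambda>y. poly q y * exp (- y)) \<longlongrightarrow> (0::real)) at_top"
proof -
  have "((\<lambda>y. \<Sum>i\<le>degree q. coeff q i * (y ^ i / exp y)) \<longlongrightarrow> (\<Sum>i\<le>degree q. coeff q i * 0)) at_top"
    by (intro tendsto_intros tendsto_power_div_exp_0)
  moreover have "(\<lambda>y. \<Sum>i\<le>degree q. coeff q i * (y ^ i / exp y)) = (\<lambda>y. poly q y * exp (- y))"
    by (simp add: poly_altdef exp_minus divide_inverse sum_distrib_right mult.assoc)
  ultimately show ?thesis by simp
qed

lemma flat_has_derivative: "(flat n has_real_derivative flat (Suc n) x) (at x)"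
proof -
  consider "x > 0" | "x < 0" | "x = 0" by linarith
  then show ?thesis
  proof cases
    case 1
    have d: "((\<lambda>x. 1 / x) has_real_derivative - ((1 / x)\<^sup>2)) (at x)"
      using DERIV_inverse[of x] 1 by (simp add: inverse_eq_divide power_divide power2_eq_square)
    have "((\<lambda>x. poly (flat_poly n) (1 / x) * exp (- (1 / x))) has_real_derivative
        poly (pderiv (flat_poly n)) (1 / x) * - ((1 / x)\<^sup>2) * exp (- (1 / x))
        + exp (- (1 / x)) * - (- ((1 / x)\<^sup>2)) * poly (flat_poly n) (1 / x)) (at x)"
      by (intro DERIV_mult DERIV_chain2[OF poly_DERIV d] DERIV_fun_exp DERIV_minus d)
    moreover have "poly (pderiv (flat_poly n)) (1 / x) * - ((1 / x)\<^sup>2) * exp (- (1 / x))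
        + exp (- (1 / x)) * - (- ((1 / x)\<^sup>2)) * poly (flat_poly n) (1 / x) = flat (Suc n) x"
      using 1 by (simp add: flat_def power2_eq_square algebra_simps)
    ultimately have "((\<lambda>x. poly (flat_poly n) (1 / x) * exp (- 1 / x)) has_real_derivative flat (Suc n) x) (at x)"
      by simp
    then show ?thesis
      by (rule has_field_derivative_transform_within_open[where S = "{0<..}"]) (use 1 in \<open>auto simp: flat_def\<close>)
  next
    case 2
    have "((\<lambda>_. 0) has_real_derivative flat (Suc n) x) (at x)" using 2 by (simp add: flat_def)
    then show ?thesis
      by (rule has_field_derivative_transform_within_open[where S = "{..<0}"]) (use 2 in \<open>auto simp: flat_def\<close>)
  next
    case 3
    \<comment> \<open>With y = 1/h the difference quotient from the right is y q(y) exp(-y);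
      \<open>pCons 0\<close> supplies the factor y.\<close>
    have "((\<lambda>h. poly (pCons 0 (flat_poly n)) (inverse h) * exp (- inverse h)) \<longlongrightarrow> 0) (at_right 0)"
      by (rule filterlim_compose[OF poly_exp_tendsto_0 filterlim_inverse_at_top_right])
    then have "((\<lambda>h. flat n h / h) \<longlongrightarrow> 0) (at_right 0)"
      by (rule Lim_transform_eventually)
         (auto simp: eventually_at_right_field flat_def divide_inverse intro!: exI[of _ 1])
    moreover have "((\<lambda>h. flat n h / h) \<longlongrightarrow> 0) (at_left 0)"
      by (rule Lim_transform_eventually[OF tendsto_const])
         (auto simp: eventually_at_left_field flat_def intro!: exI[of _ "-1"])
    ultimately have "((\<lambda>h. flat n h / h) \<longlongrightarrow> 0) (at 0)"
      by (simp add: filterlim_at_split)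
    then show ?thesis using 3 by (simp add: DERIV_def flat_def)
  qed
qed

text \<open>A class of smooth functions that is closed under differentiation and contains enough cut-off
  functions.\<close>

inductive smooth_fun :: "(real \<Rightarrow> real) \<Rightarrow> bool" where
  flat: "smooth_fun (\<lambda>x. flat n (c * x + d))"
| const: "smooth_fun (\<lambda>x. c)"
| add: "smooth_fun f \<Longrightarrow> smooth_fun g \<Longrightarrow> smooth_fun (\<lambda>x. f x + g x)"
| mult: "smooth_fun f \<Longrightarrow> smooth_fun g \<Longrightarrow> smooth_fun (\<lambda>x. f x * g x)"
| antiderivative: "smooth_fun f \<Longrightarrow> (\<And>x. (F has_real_derivative f x) (at x)) \<Longrightarrow> smooth_fun F"

lemma smooth_fun_derivative:
  "smooth_fun f \<Longrightarrow> \<exists>f'. smooth_fun f' \<and> (\<forall>x. (f has_real_derivative f' x) (at x))"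
proof (induction rule: smooth_fun.induct)
  case (flat n c d)
  have "((\<lambda>x. flat n (c * x + d)) has_real_derivative flat (Suc n) (c * x + d) * c) (at x)" for x
    by (rule DERIV_chain2[OF flat_has_derivative]) (auto intro!: derivative_eq_intros)
  moreover have "smooth_fun (\<lambda>x. flat (Suc n) (c * x + d) * c)" by (intro smooth_fun.intros)
  ultimately show ?case by blast
next
  case (const c)
  show ?case by (intro exI[of _ "\<lambda>_. 0"]) (auto intro: smooth_fun.intros)
next
  case (add f g)
  then obtain f' g' where "smooth_fun f'" "smooth_fun g'"
    "\<And>x. (f has_real_derivative f' x) (at x)" "\<And>x. (g has_real_derivative g' x) (at x)" by blast
  then show ?case by (intro exI[of _ "\<lambda>x. f' x + g' x"]) (auto intro!: smooth_fun.add DERIV_add)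
next
  case (mult f g)
  then obtain f' g' where "smooth_fun f'" "smooth_fun g'"
    "\<And>x. (f has_real_derivative f' x) (at x)" "\<And>x. (g has_real_derivative g' x) (at x)" by blast
  then show ?case
    using mult.hyps by (intro exI[of _ "\<lambda>x. f' x * g x + g' x * f x"])
      (auto intro!: smooth_fun.add smooth_fun.mult DERIV_mult)
next
  case (antiderivative f F)
  then show ?case by blast
qed

lemma continuous_on_smooth_fun: "smooth_fun f \<Longrightarrow> continuous_on S f"
  using smooth_fun_derivative by (meson DERIV_isCont continuous_at_imp_continuous_on)

lemma has_derivative_product_fun:
  assumes "\<And>t. (f has_real_derivative f' t) (at t)" "\<And>t. (g has_real_derivative g' t) (at t)"
  shows "((\<lambda>x::real^2. f (x $ 1) * g (x $ 2)) has_derivative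
    (\<lambda>h. f (x $ 1) * (g' (x $ 2) * h $ 2) + f' (x $ 1) * h $ 1 * g (x $ 2))) (at x)"
proof -
  have "((\<lambda>x::real^2. f (x $ 1)) has_derivative (\<lambda>h. f' (x $ 1) * h $ 1)) (at x)"
    "((\<lambda>x::real^2. g (x $ 2)) has_derivative (\<lambda>h. g' (x $ 2) * h $ 2)) (at x)"
    using assms[unfolded has_field_derivative_def]
    by (auto intro!: has_derivative_compose[OF bounded_linear_imp_has_derivative[OF bounded_linear_vec_nth]])
  then show ?thesis by (rule has_derivative_mult)
qed

lemma partial_deriv_product_fun:
  assumes "\<And>t. (f has_real_derivative f' t) (at t)" "\<And>t. (g has_real_derivative g' t) (at t)"
  shows "partial_deriv 1 (\<lambda>x. f (x $ 1) * g (x $ 2)) = (\<lambda>x. f' (x $ 1) * g (x $ 2))"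
    and "partial_deriv 2 (\<lambda>x. f (x $ 1) * g (x $ 2)) = (\<lambda>x. f (x $ 1) * g' (x $ 2))"
proof -
  have *: "partial_deriv k (\<lambda>x. f (x $ 1) * g (x $ 2)) x
    = f (x $ 1) * (g' (x $ 2) * axis k 1 $ 2) + f' (x $ 1) * axis k 1 $ 1 * g (x $ 2)" for k and x :: "real^2"
    unfolding partial_deriv_def frechet_derivative_at[OF has_derivative_product_fun[OF assms], symmetric] ..
  show "partial_deriv 1 (\<lambda>x. f (x $ 1) * g (x $ 2)) = (\<lambda>x. f' (x $ 1) * g (x $ 2))"
    "partial_deriv 2 (\<lambda>x. f (x $ 1) * g (x $ 2)) = (\<lambda>x. f (x $ 1) * g' (x $ 2))"
    by (rule ext, simp add: * axis_def)+
qed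

lemma foldr_partial_deriv_product_fun:
  assumes "smooth_fun f" "smooth_fun g"
  shows "\<exists>f' g'. smooth_fun f' \<and> smooth_fun g' \<and>
    foldr partial_deriv ks (\<lambda>x. f (x $ 1) * g (x $ 2)) = (\<lambda>x. f' (x $ 1) * g' (x $ 2))"
proof (induction ks)
  case (Cons k ks)
  then obtain a b where ab: "smooth_fun a" "smooth_fun b"
    "foldr partial_deriv ks (\<lambda>x. f (x $ 1) * g (x $ 2)) = (\<lambda>x. a (x $ 1) * b (x $ 2))" by blast
  obtain a' where a': "smooth_fun a'" "\<And>x. (a has_real_derivative a' x) (at x)"
    using smooth_fun_derivative[OF ab(1)] by blast
  obtain b' where b': "smooth_fun b'" "\<And>x. (b has_real_derivative b' x) (at x)"
    using smooth_fun_derivative[OF ab(2)] by blast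
  have "k = 1 \<or> k = 2" using exhaust_2 by blast
  then show ?case
    using partial_deriv_product_fun[OF a'(2) b'(2)] ab a' b' by auto
qed (use assms in auto)

lemma product_test_function:
  assumes "smooth_fun f" "smooth_fun g" "\<And>t. t \<notin> {a1..b1} \<Longrightarrow> f t = 0" "\<And>t. t \<notin> {a2..b2} \<Longrightarrow> g t = 0"
    and "cbox (vector [a1, a2]) (vector [b1, b2]) \<subseteq> \<Omega>"
  shows "(\<lambda>x. f (x $ 1) * g (x $ 2)) \<in> test_functions \<Omega>"
proof -
  have "foldr partial_deriv ks (\<lambda>x. f (x $ 1) * g (x $ 2)) differentiable (at x)" for ks x
  proof -
    obtain a b where ab: "smooth_fun a" "smooth_fun b"
      "foldr partial_deriv ks (\<lambda>x. f (x $ 1) * g (x $ 2)) = (\<lambda>x. a (x $ 1) * b (x $ 2))"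
      using foldr_partial_deriv_product_fun[OF assms(1,2)] by blast
    obtain a' where a': "\<And>x. (a has_real_derivative a' x) (at x)"
      using smooth_fun_derivative[OF ab(1)] by blast
    obtain b' where b': "\<And>x. (b has_real_derivative b' x) (at x)"
      using smooth_fun_derivative[OF ab(2)] by blast
    show ?thesis unfolding ab(3) differentiable_def using has_derivative_product_fun[OF a' b'] by blast
  qed
  moreover have "f (x $ 1) * g (x $ 2) = 0" if "x \<notin> cbox (vector [a1, a2]) (vector [b1, b2])" for x :: "real^2"
    using that assms(3)[of "x $ 1"] assms(4)[of "x $ 2"] by (auto simp: mem_box_cart forall_2)
  ultimately show ?thesis
    unfolding test_functions_def using assms(5) by (auto intro!: exI[of _ "cbox (vector [a1, a2]) (vector [b1, b2])"])
qed

definition bump :: "real \<Rightarrow> real \<Rightarrow> real \<Rightarrow> real" where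
  "bump a b x = flat 0 (x - a) * flat 0 (b - x)"

lemma smooth_bump: "smooth_fun (bump a b)"
proof -
  have "smooth_fun (\<lambda>x. flat 0 (1 * x + (- a)) * flat 0 (-1 * x + b))"
    by (intro smooth_fun.intros)
  then show ?thesis by (simp add: bump_def[abs_def])
qed

lemma bump_nonneg: "0 \<le> bump a b x"
  by (simp add: bump_def flat_def)

lemma bump_pos: "a < x \<Longrightarrow> x < b \<Longrightarrow> 0 < bump a b x"
  by (simp add: bump_def flat_def)

lemma bump_eq_0: "x \<le> a \<or> b \<le> x \<Longrightarrow> bump a b x = 0"
  by (auto simp: bump_def flat_def)

lemma bump_shift: "bump (a + h) (b + h) x = bump a b (x - h)"
  by (simp add: bump_def algebra_simps)

text \<open>Testing with this antiderivative compares the averages of a function near two points.\<close>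

lemma bump_difference_antiderivative:
  assumes "a < b" "0 \<le> h"
  obtains B where "smooth_fun B" "\<And>x. (B has_real_derivative bump a b x - bump (a + h) (b + h) x) (at x)"
    "\<And>x. x \<notin> {a..b + h} \<Longrightarrow> B x = 0"
proof -
  \<comment> \<open>Starting one unit left of the support makes every x \<ge> a an interior point of
    an interval of integration.\<close>
  define A where "A x = integral {a - 1..x} (bump a b)" for x
  have cont: "continuous_on S (bump a b)" for S by (rule continuous_on_smooth_fun[OF smooth_bump])
  have A0: "A x = 0" if "x < a" for x
    unfolding A_def by (subst integral_cong[of _ _ "\<lambda>_. 0"]) (use that in \<open>auto simp: bump_eq_0\<close>)
  have A_deriv: "(A has_real_derivative bump a b x) (at x)" for x
  proof (cases "x < a")
    case True
    have "((\<lambda>_. 0) has_real_derivative bump a b x) (at x)" using True by (simp add: bump_eq_0)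
    then show ?thesis
      by (rule has_field_derivative_transform_within_open[where S = "{..<a}"]) (use True A0 in auto)
  next
    case False
    have "(A has_real_derivative bump a b x) (at x within {a - 1..x + 1})"
      unfolding A_def[abs_def] using False cont by (intro integral_has_real_derivative) auto
    then show ?thesis using False by (simp add: at_within_Icc_at)
  qed
  have A_const: "A x = A b" if "b \<le> x" for x
  proof (cases "x = b")
    case False
    show ?thesis
    proof (rule DERIV_isconst_end[of b x A])
      show "continuous_on {b..x} A" using A_deriv by (meson DERIV_isCont continuous_at_imp_continuous_on)
      show "(A has_real_derivative 0) (at y)" if "b < y" "y < x" for y
        using A_deriv[of y] bump_eq_0[of y a b] that by simp
    qed (use that False in simp)
  qed simp
  \<comment> \<open>A(x) - A(x - h), spelled to fit the rules of \<open>smooth_fun\<close>. Both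
    terms are 0 to the left of a and take the same constant value beyond b + h, so B has compact
    support.\<close>
  define B where "B x = A x + (-1) * A (1 * x + (- h))" for x
  have A_smooth: "smooth_fun A" by (rule smooth_fun.antiderivative[OF smooth_bump A_deriv])
  have A_shift: "((\<lambda>x. A (1 * x + (- h))) has_real_derivative bump (a + h) (b + h) x) (at x)" for x
  proof -
    have "((\<lambda>x. 1 * x + (- h)) has_real_derivative 1) (at x)" by (auto intro!: derivative_eq_intros)
    from DERIV_chain2[OF A_deriv this] show ?thesis unfolding bump_shift by simp
  qed
  show ?thesis
  proof (rule that[of B])
    have "smooth_fun (\<lambda>x. A (1 * x + (- h)))"
      by (rule smooth_fun.antiderivative[OF smooth_bump A_shift])
    then show "smooth_fun B" unfolding B_def[abs_def] using A_smooth by (intro smooth_fun.add smooth_fun.mult smooth_fun.const)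
    show "(B has_real_derivative bump a b x - bump (a + h) (b + h) x) (at x)" for x
      unfolding B_def[abs_def] using DERIV_diff[OF A_deriv[of x] A_shift[of x]] by simp
    show "B x = 0" if "x \<notin> {a..b + h}" for x
      using that A0[of x] A0[of "x - h"] A_const[of x] A_const[of "x - h"] assms by (auto simp: B_def)
  qed
qed

text \<open>The difference of \<phi> and its translate has integral 0, so v may be replaced by v -
  m. On the support of \<phi> and on its translate the sign of v - m is opposite, as is the sign in
  the difference; the integrand thus has one sign and does not vanish where \<phi> > 0.\<close>

lemma translate_pairing_nonzero:
  fixes v \<phi> :: "real^2 \<Rightarrow> real"
  assumes "open \<Omega>" "continuous_on \<Omega> v" and \<phi>: "continuous_on UNIV \<phi>" "\<And>x. 0 \<le> \<phi> x"
    and S: "S \<subseteq> \<Omega>" "(\<lambda>x. x + e) ` S \<subseteq> \<Omega>" "bounded S" "\<And>x. x \<notin> S \<Longrightarrow> \<phi> x = 0"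
    and lt: "\<And>x. x \<in> S \<Longrightarrow> v x < m" "\<And>x. x \<in> S \<Longrightarrow> m < v (x + e)"
    and bnd: "\<And>x. x \<in> S \<Longrightarrow> \<bar>v x\<bar> \<le> C" "\<And>x. x \<in> S \<Longrightarrow> \<bar>v (x + e)\<bar> \<le> C"
    and ne: "\<phi> x0 > 0"
  shows "(LINT x:\<Omega>|lebesgue. v x * (\<phi> x - \<phi> (x - e))) \<noteq> 0"
proof
  assume zero: "(LINT x:\<Omega>|lebesgue. v x * (\<phi> x - \<phi> (x - e))) = 0"
  define d where "d x = \<phi> x - \<phi> (x - e)" for x
  define T where "T = S \<union> (\<lambda>x. x + e) ` S"
  have T: "x - e \<notin> S" "x \<notin> S" if "x \<notin> T" for x
    using that by (auto simp: T_def image_iff)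
  have d0: "d x = 0" if "x \<notin> T" for x using T[OF that] S(4) by (simp add: d_def)
  have T\<Omega>: "T \<subseteq> \<Omega>" using S by (simp add: T_def)
  have [measurable]: "\<phi> \<in> borel_measurable borel" using \<phi>(1) by (rule borel_measurable_continuous_onI)
  have d_meas [measurable]: "d \<in> borel_measurable borel" unfolding d_def[abs_def] by measurable
  have u_meas [measurable]: "(\<lambda>x. indicator \<Omega> x *\<^sub>R v x) \<in> borel_measurable borel"
    using assms(1,2) by (intro borel_measurable_continuous_on_indicator) auto
  have bT: "bounded T" using S(3) by (simp add: T_def bounded_translation_minus bounded_plus add.commute[of _ e] bounded_translation)
  have "compact (closure S)" using S(3) by simp
  then have "bounded (\<phi> ` closure S)"
    by (intro compact_imp_bounded compact_continuous_image continuous_on_subset[OF \<phi>(1)]) auto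
  then obtain D where "\<forall>y\<in>\<phi> ` closure S. \<bar>y\<bar> \<le> D" unfolding bounded_real by blast
  then have D: "\<phi> x \<le> max D 0" for x
    using closure_subset[of S] S(4)[of x] \<phi>(2)[of x] by (cases "x \<in> S") force+
  have d_bnd: "\<bar>d x\<bar> \<le> max D 0" for x
    using D[of x] D[of "x - e"] \<phi>(2)[of x] \<phi>(2)[of "x - e"] by (simp add: d_def abs_le_iff)
  have \<phi>_int: "integrable lborel \<phi>"
    by (rule integrable_bounded_support[OF _ S(3,4), where C = "max D 0"]) (use D \<phi>(2) in auto)
  have d_int: "integrable lborel d"
    by (rule integrable_bounded_support[OF d_meas bT d0 d_bnd])
  define C' where "C' = \<bar>C\<bar> * max D 0"
  have ud_int: "integrable lborel (\<lambda>x. indicator \<Omega> x *\<^sub>R v x * d x)"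
  proof (rule integrable_bounded_support[OF borel_measurable_times[OF u_meas d_meas] bT])
    show "\<bar>indicator \<Omega> x *\<^sub>R v x * d x\<bar> \<le> C'" for x
    proof (cases "x \<in> T")
      case True
      then have "\<bar>v x\<bar> \<le> \<bar>C\<bar>" using bnd by (force simp: T_def)
      moreover have "\<bar>indicator \<Omega> x *\<^sub>R v x\<bar> \<le> \<bar>v x\<bar>" by (simp add: indicator_def)
      ultimately show ?thesis unfolding C'_def abs_mult using d_bnd by (intro mult_mono) auto
    qed (simp add: d0 C'_def)
  qed (auto simp: d0)
  have "integral\<^sup>L lebesgue (\<lambda>x. - d x) = 0"
    using integral_difference_zero[of \<phi> "- e"] \<phi>_int by (simp add: d_def)
  moreover have "integral\<^sup>L lebesgue (\<lambda>x. - d x) = integral\<^sup>L lborel (\<lambda>x. - d x)"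
    using d_meas by (intro integral_completion) simp
  ultimately have "integral\<^sup>L lborel d = 0" by simp
  moreover have "integral\<^sup>L lborel (\<lambda>x. indicator \<Omega> x *\<^sub>R v x * d x) = 0"
  proof -
    have "(\<lambda>x. indicator \<Omega> x *\<^sub>R v x * d x) \<in> borel_measurable lborel"
      using borel_measurable_times[OF u_meas d_meas] by simp
    from integral_completion[OF this] show ?thesis
      using zero by (simp add: set_lebesgue_integral_def d_def mult.assoc)
  qed
  ultimately have "integral\<^sup>L lborel (\<lambda>x. m * d x - indicator \<Omega> x *\<^sub>R v x * d x) = 0"
    using ud_int d_int by simp
  moreover have \<psi>_nonneg: "0 \<le> m * d x - indicator \<Omega> x *\<^sub>R v x * d x" for x
  proof -
    have eq: "m * d x - indicator \<Omega> x *\<^sub>R v x * d x = (m - v x) * \<phi> x + (v x - m) * \<phi> (x - e)" if "x \<in> T"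
      using that T\<Omega> by (auto simp: d_def indicator_def algebra_simps)
    have "0 \<le> (m - v x) * \<phi> x"
      using lt(1)[of x] \<phi>(2)[of x] S(4)[of x] by (cases "x \<in> S") auto
    moreover have "0 \<le> (v x - m) * \<phi> (x - e)"
      using lt(2)[of "x - e"] \<phi>(2)[of "x - e"] S(4)[of "x - e"] by (cases "x - e \<in> S") auto
    ultimately show ?thesis using eq d0[of x] by (cases "x \<in> T") auto
  qed
  ultimately have AE: "AE x in lborel. m * d x - indicator \<Omega> x *\<^sub>R v x * d x = 0"
    using ud_int d_int by (subst (asm) integral_nonneg_eq_0_iff_AE) auto
  define P where "P = {x. \<phi> x > 0}"
  have "open P" unfolding P_def using \<phi>(1) by (intro open_Collect_less continuous_on_const)
  have pos: "m * d x - indicator \<Omega> x *\<^sub>R v x * d x \<noteq> 0" if "x \<in> P" for x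
  proof -
    have x: "x \<in> S" using that S(4)[of x] by (auto simp: P_def)
    then have "0 < (m - v x) * \<phi> x" using lt(1) that by (simp add: P_def)
    moreover have "0 \<le> (v x - m) * \<phi> (x - e)"
      using lt(2)[of "x - e"] \<phi>(2)[of "x - e"] S(4)[of "x - e"] by (cases "x - e \<in> S") auto
    moreover have "m * d x - indicator \<Omega> x *\<^sub>R v x * d x = (m - v x) * \<phi> x + (v x - m) * \<phi> (x - e)"
      using x S(1) by (auto simp: d_def indicator_def algebra_simps)
    ultimately show ?thesis by linarith
  qed
  have "AE x in lborel. x \<notin> P" using AE by eventually_elim (use pos in auto)
  then have "P \<in> null_sets lborel" using \<open>open P\<close> by (simp add: AE_iff_null_sets)
  then have "negligible P" using negligible_iff_null_sets null_sets_completionI by blast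
  then show False using open_not_negligible[OF \<open>open P\<close>] ne by (auto simp: P_def)
qed

definition square_bump :: "real^2 \<Rightarrow> real \<Rightarrow> real^2 \<Rightarrow> real" where
  "square_bump x r s = bump (x $ 1 - r) (x $ 1 + r) (s $ 1) * bump (x $ 2 - r) (x $ 2 + r) (s $ 2)"

lemma norm_le_component_sum_2: "norm (x :: real^2) \<le> \<bar>x $ 1\<bar> + \<bar>x $ 2\<bar>"
  using norm_le_l1_cart[of x] by (simp add: sum_2)

text \<open>If v were larger at x + e, small squares around the two points would be separated by the
  mean value m, and the pairing with a bump and its translate could not vanish.\<close>

lemma weak_translate_le:
  fixes v :: "real^2 \<Rightarrow> real"
  assumes "open \<Omega>" "continuous_on \<Omega> v" "x \<in> \<Omega>" "x + e \<in> \<Omega>" "r0 > 0"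
    and weak: "\<And>r. 0 < r \<Longrightarrow> r < r0 \<Longrightarrow>
      (LINT s:\<Omega>|lebesgue. v s * (square_bump x r s - square_bump x r (s - e))) = 0"
  shows "v (x + e) \<le> v x"
proof (rule ccontr)
  assume "\<not> ?thesis"
  then have lt: "v x < v (x + e)" by simp
  define m where "m = (v x + v (x + e)) / 2"
  have m: "v x < m" "m < v (x + e)" using lt by (auto simp: m_def)
  have cont: "isCont v x" "isCont v (x + e)"
    using assms(1-4) by (auto simp: continuous_on_eq_continuous_at)
  define C where "C = max \<bar>v x\<bar> \<bar>v (x + e)\<bar> + (v (x + e) - v x)"
  have "\<exists>d>0. \<forall>s. dist s x < d \<longrightarrow> dist (v s) (v x) < m - v x"
    using cont(1) m(1) unfolding continuous_at_eps_delta by simp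
  then obtain d1 where d1: "d1 > 0" "\<And>s. dist s x < d1 \<Longrightarrow> dist (v s) (v x) < m - v x" by blast
  have "\<exists>d>0. \<forall>s. dist s (x + e) < d \<longrightarrow> dist (v s) (v (x + e)) < v (x + e) - m"
    using cont(2) m(2) unfolding continuous_at_eps_delta by simp
  then obtain d2 where d2: "d2 > 0" "\<And>s. dist s (x + e) < d2 \<Longrightarrow> dist (v s) (v (x + e)) < v (x + e) - m" by blast
  obtain d3 where d3: "d3 > 0" "ball x d3 \<subseteq> \<Omega>" using assms(1,3) openE by blast
  obtain d4 where d4: "d4 > 0" "ball (x + e) d4 \<subseteq> \<Omega>" using assms(1,4) openE by blast
  \<comment> \<open>Points of S are within 2 r of x, so the divisor 3 leaves room below each of the
    radii.\<close>
  define r where "r = min (min (min d1 d2) (min d3 d4)) r0 / 3"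
  have r: "0 < r" "r < r0" "2 * r < d1" "2 * r < d2" "2 * r < d3" "2 * r < d4"
    using d1(1) d2(1) d3(1) d4(1) assms(5) by (auto simp: r_def)
  define S where "S = {s :: real^2. \<bar>s $ 1 - x $ 1\<bar> < r \<and> \<bar>s $ 2 - x $ 2\<bar> < r}"
  have near: "dist s x < 2 * r" "dist (s + e) (x + e) < 2 * r" if "s \<in> S" for s
    using norm_le_component_sum_2[of "s - x"] that by (auto simp: S_def dist_norm)
  have vS: "\<bar>v s - v x\<bar> < m - v x" "\<bar>v (s + e) - v (x + e)\<bar> < v (x + e) - m" if "s \<in> S" for s
    using d1(2)[of s] d2(2)[of "s + e"] near[OF that] r by (auto simp: dist_real_def)
  have "(LINT s:\<Omega>|lebesgue. v s * (square_bump x r s - square_bump x r (s - e))) \<noteq> 0"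
  proof (rule translate_pairing_nonzero[OF assms(1,2), where S = S and m = m and C = C and ?x0.0 = x])
    show "continuous_on UNIV (square_bump x r)"
      unfolding square_bump_def[abs_def]
      by (intro continuous_on_mult continuous_on_compose2[OF continuous_on_smooth_fun[OF smooth_bump]]
          continuous_intros) auto
    show "0 \<le> square_bump x r s" for s by (simp add: square_bump_def bump_nonneg)
    show "S \<subseteq> \<Omega>"
    proof
      fix s assume "s \<in> S"
      then have "s \<in> ball x d3" using near(1)[of s] r by (simp add: dist_commute)
      then show "s \<in> \<Omega>" using d3 by blast
    qed
    show "(\<lambda>s. s + e) ` S \<subseteq> \<Omega>"
    proof
      fix t assume "t \<in> (\<lambda>s. s + e) ` S"
      then have "t \<in> ball (x + e) d4" using near(2) r by (force simp: dist_commute)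
      then show "t \<in> \<Omega>" using d4 by blast
    qed
    have "S \<subseteq> ball x (2 * r)" using near(1) by (auto simp: dist_commute)
    then show "bounded S" using bounded_ball bounded_subset by blast
    show "square_bump x r s = 0" if "s \<notin> S" for s
      using that by (auto simp: S_def square_bump_def bump_eq_0 abs_if split: if_splits)
    show "v s < m" "m < v (s + e)" "\<bar>v s\<bar> \<le> C" "\<bar>v (s + e)\<bar> \<le> C" if "s \<in> S" for s
      using vS[OF that] m by (auto simp: C_def abs_if max_def split: if_splits)
    show "0 < square_bump x r x" using r by (simp add: square_bump_def bump_pos)
  qed
  then show False using weak[OF r(1,2)] by simp
qed

lemma weak_translate_eq:
  fixes v :: "real^2 \<Rightarrow> real"
  assumes "open \<Omega>" "continuous_on \<Omega> v" "x \<in> \<Omega>" "x + e \<in> \<Omega>" "r0 > 0"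
    and weak: "\<And>r. 0 < r \<Longrightarrow> r < r0 \<Longrightarrow>
      (LINT s:\<Omega>|lebesgue. v s * (square_bump x r s - square_bump x r (s - e))) = 0"
  shows "v (x + e) = v x"
proof (rule antisym)
  show "v (x + e) \<le> v x" by (rule weak_translate_le[OF assms])
  have "- v (x + e) \<le> - v x"
    using assms(2) weak
    by (intro weak_translate_le[OF assms(1) _ assms(3-5), of "\<lambda>x. - v x"])
       (auto intro: continuous_intros simp: set_lebesgue_integral_def)
  then show "v x \<le> v (x + e)" by simp
qed

text \<open>A square bump minus its translate along axis k is the k-th partial derivative of a
  product test function: the antiderivative B in the k-th variable times a bump in the other. Thus
  averages near x and near the translated point coincide.\<close>

lemma weakly_constant_on_box:
  fixes v :: "real^2 \<Rightarrow> real"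
  assumes \<Omega>: "open \<Omega>" "continuous_on \<Omega> v" and Q: "box p q \<subseteq> \<Omega>"
    and weak: "\<And>\<phi> k. \<phi> \<in> test_functions \<Omega> \<Longrightarrow> (LINT x:\<Omega>|lebesgue. v x * partial_deriv k \<phi> x) = 0"
    and x: "x \<in> box p q" "x + h *\<^sub>R axis k 1 \<in> box p q" and h: "0 \<le> h"
  shows "v (x + h *\<^sub>R axis k 1) = v x"
proof -
  have b: "p $ i < x $ i" "x $ i < q $ i" "x $ i + h * axis k 1 $ i < q $ i" for i
    using x by (auto simp: mem_box_cart)
  \<comment> \<open>The distance to the faces of the box that keeps the rectangle swept by the
    moving bump inside.\<close>
  define r0 where "r0 = Min ((\<lambda>i. x $ i - p $ i) ` UNIV \<union> (\<lambda>i. q $ i - (x $ i + h * axis k 1 $ i)) ` UNIV)"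
  have r0: "r0 > 0" unfolding r0_def using b by (subst Min_gr_iff) auto
  have r0_le: "r0 \<le> x $ i - p $ i" "r0 \<le> q $ i - (x $ i + h * axis k 1 $ i)" for i
    unfolding r0_def by (auto intro!: Min_le)
  show ?thesis
  proof (rule weak_translate_eq[OF \<Omega> _ _ r0])
    show "x \<in> \<Omega>" "x + h *\<^sub>R axis k 1 \<in> \<Omega>" using x Q by auto
    fix r assume r: "0 < r" "r < r0"
    let ?\<beta> = "\<lambda>i. bump (x $ i - r) (x $ i + r)"
    obtain B where B: "smooth_fun B"
      "\<And>t. (B has_real_derivative ?\<beta> k t - bump (x $ k - r + h) (x $ k + r + h) t) (at t)"
      "\<And>t. t \<notin> {x $ k - r..x $ k + r + h} \<Longrightarrow> B t = 0"
      by (rule bump_difference_antiderivative[of "x $ k - r" "x $ k + r" h]) (use r h in auto)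
    have shift: "?\<beta> k (t - h) = bump (x $ k - r + h) (x $ k + r + h) t" for t by (simp add: bump_shift)
    have "\<forall>i. \<exists>f'. \<forall>t. (?\<beta> i has_real_derivative f' t) (at t)"
      using smooth_fun_derivative[OF smooth_bump] by blast
    then obtain \<beta>' where \<beta>': "\<And>i t. (?\<beta> i has_real_derivative \<beta>' i t) (at t)" by metis
    have "k = 1 \<or> k = 2" using exhaust_2 by blast
    then show "(LINT s:\<Omega>|lebesgue. v s * (square_bump x r s - square_bump x r (s - h *\<^sub>R axis k 1))) = 0"
    proof
      assume k: "k = 1"
      define \<phi> where "\<phi> s = B (s $ 1) * ?\<beta> 2 (s $ 2)" for s :: "real^2"
      have "\<phi> \<in> test_functions \<Omega>"
        unfolding \<phi>_def[abs_def]
      proof (rule product_test_function[OF B(1) smooth_bump])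
        show "cbox (vector [x $ 1 - r, x $ 2 - r]) (vector [x $ 1 + r + h, x $ 2 + r]) \<subseteq> \<Omega>"
          using r r0_le[of 1] r0_le[of 2] k
          by (intro subset_trans[OF _ Q]) (auto simp: mem_box_cart forall_2 axis_def)
      qed (use B(3) k in \<open>auto simp: bump_eq_0\<close>)
      have c: "(s - h *\<^sub>R axis k 1) $ 1 = s $ 1 - h" "(s - h *\<^sub>R axis k 1) $ 2 = s $ 2" for s :: "real^2"
        by (simp_all add: k axis_def)
      have "square_bump x r s - square_bump x r (s - h *\<^sub>R axis k 1)
        = (?\<beta> 1 (s $ 1) - bump (x $ 1 - r + h) (x $ 1 + r + h) (s $ 1)) * ?\<beta> 2 (s $ 2)" for s
        by (simp only: square_bump_def c shift[unfolded k] left_diff_distrib)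
      with weak[OF \<open>\<phi> \<in> test_functions \<Omega>\<close>, of 1] show ?thesis
        unfolding \<phi>_def[abs_def] partial_deriv_product_fun[OF B(2)[unfolded k] \<beta>'] by simp
    next
      assume k: "k = 2"
      define \<phi> where "\<phi> s = ?\<beta> 1 (s $ 1) * B (s $ 2)" for s :: "real^2"
      have "\<phi> \<in> test_functions \<Omega>"
        unfolding \<phi>_def[abs_def]
      proof (rule product_test_function[OF smooth_bump B(1)])
        show "cbox (vector [x $ 1 - r, x $ 2 - r]) (vector [x $ 1 + r, x $ 2 + r + h]) \<subseteq> \<Omega>"
          using r r0_le[of 1] r0_le[of 2] k
          by (intro subset_trans[OF _ Q]) (auto simp: mem_box_cart forall_2 axis_def)
      qed (use B(3) k in \<open>auto simp: bump_eq_0\<close>)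
      have c: "(s - h *\<^sub>R axis k 1) $ 1 = s $ 1" "(s - h *\<^sub>R axis k 1) $ 2 = s $ 2 - h" for s :: "real^2"
        by (simp_all add: k axis_def)
      have "square_bump x r s - square_bump x r (s - h *\<^sub>R axis k 1)
        = ?\<beta> 1 (s $ 1) * (?\<beta> 2 (s $ 2) - bump (x $ 2 - r + h) (x $ 2 + r + h) (s $ 2))" for s
        by (simp only: square_bump_def c shift[unfolded k] right_diff_distrib)
      with weak[OF \<open>\<phi> \<in> test_functions \<Omega>\<close>, of 2] show ?thesis
        unfolding \<phi>_def[abs_def] partial_deriv_product_fun[OF \<beta>' B(2)[unfolded k]] by simp
    qed
  qed
qed

text \<open>Inside a box any two points are joined by two moves parallel to the axes, through the
  corner c. This gives local constancy, and connectedness does the rest.\<close>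

lemma weakly_constant_imp_constant:
  fixes v :: "real^2 \<Rightarrow> real"
  assumes \<Omega>: "open \<Omega>" "connected \<Omega>" "continuous_on \<Omega> v"
    and weak: "\<And>\<phi> k. \<phi> \<in> test_functions \<Omega> \<Longrightarrow> (LINT x:\<Omega>|lebesgue. v x * partial_deriv k \<phi> x) = 0"
    and "x \<in> \<Omega>" "y \<in> \<Omega>"
  shows "v x = v y"
proof (rule connected_local_const[OF \<Omega>(2) assms(5,6)], rule ballI)
  fix a assume a: "a \<in> \<Omega>"
  then obtain p q where Q: "a \<in> box p q" "box p q \<subseteq> \<Omega>"
    using \<Omega>(1) open_contains_box by metis
  have step: "v b = v c" if "b \<in> box p q" "c \<in> box p q" "\<And>i. i \<noteq> k \<Longrightarrow> b $ i = c $ i" "b $ k \<le> c $ k" for b c k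
  proof -
    have "c = b + (c $ k - b $ k) *\<^sub>R axis k 1"
      using that(3) by (auto simp: vec_eq_iff axis_def)
    then show ?thesis
      using weakly_constant_on_box[OF \<Omega>(1,3) Q(2) weak that(1), of "c $ k - b $ k" k] that(2,4) by simp
  qed
  have step': "v b = v c" if "b \<in> box p q" "c \<in> box p q" "\<And>i. i \<noteq> k \<Longrightarrow> b $ i = c $ i" for b c k
    using step[of b c k] step[of c b k] that by (cases "b $ k \<le> c $ k") auto
  have "v a = v b" if b: "b \<in> box p q" for b
  proof -
    define c where "c = (vector [b $ 1, a $ 2] :: real^2)"
    have c: "c \<in> box p q" using Q(1) b by (auto simp: c_def mem_box_cart forall_2)
    have "v a = v c" by (rule step'[OF Q(1) c, of 1]) (metis c_def exhaust_2 vector_2(2))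
    also have "v c = v b" by (rule step'[OF c b, of 2]) (metis c_def exhaust_2 vector_2(1))
    finally show ?thesis .
  qed
  then show "\<forall>\<^sub>F b in at a within \<Omega>. v a = v b"
    unfolding eventually_at_filter
    using eventually_nhds_in_open[OF open_box Q(1)] by (auto elim: eventually_mono)
qed

section \<open>Constancy on the collapsed edge\<close>

lemma integral_scale_2:
  fixes f :: "real^2 \<Rightarrow> real"
  assumes "f \<in> borel_measurable borel" "c > 0"
  shows "integral\<^sup>L lborel f = c\<^sup>2 * integral\<^sup>L lborel (\<lambda>x. f (c *\<^sub>R x))"
proof -
  have "integral\<^sup>L lborel f = integral\<^sup>L (density (distr lborel borel (\<lambda>x. 0 + c *\<^sub>R x)) (\<lambda>_. ennreal (\<bar>c\<bar> ^ DIM(real^2)))) f"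
    using lborel_affine[of c "0 :: real^2"] assms(2) by (simp add: ennreal_power)
  also have "\<dots> = integral\<^sup>L (distr lborel borel (\<lambda>x. 0 + c *\<^sub>R x)) (\<lambda>x. (\<bar>c\<bar> ^ DIM(real^2)) *\<^sub>R f x)"
    using assms by (intro integral_density) auto
  also have "\<dots> = integral\<^sup>L lborel (\<lambda>x. (\<bar>c\<bar> ^ DIM(real^2)) *\<^sub>R f (0 + c *\<^sub>R x))"
    using assms by (intro integral_distr) auto
  also have "\<dots> = c\<^sup>2 * integral\<^sup>L lborel (\<lambda>x. f (c *\<^sub>R x))"
    using assms(2) by simp
  finally show ?thesis .
qed

lemma partial_deriv_scale:
  assumes "\<psi> differentiable (at (a *\<^sub>R x))"
  shows "(\<lambda>x. c * \<psi> (a *\<^sub>R x)) differentiable (at x)"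
    and "partial_deriv k (\<lambda>x. c * \<psi> (a *\<^sub>R x)) x = (c * a) * partial_deriv k \<psi> (a *\<^sub>R x)"
proof -
  let ?D = "frechet_derivative \<psi> (at (a *\<^sub>R x))"
  have D: "(\<psi> has_derivative ?D) (at (a *\<^sub>R x))" using assms by (simp add: frechet_derivative_works)
  have "((\<lambda>x. a *\<^sub>R x) has_derivative (\<lambda>h. a *\<^sub>R h)) (at x)" by (auto intro!: derivative_eq_intros)
  then have "((\<lambda>x. \<psi> (a *\<^sub>R x)) has_derivative (\<lambda>h. ?D (a *\<^sub>R h))) (at x)"
    using D by (rule has_derivative_compose)
  then have *: "((\<lambda>x. c * \<psi> (a *\<^sub>R x)) has_derivative (\<lambda>h. c * ?D (a *\<^sub>R h))) (at x)"
    by (rule has_derivative_mult_right)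
  then show "(\<lambda>x. c * \<psi> (a *\<^sub>R x)) differentiable (at x)" by (auto simp: differentiable_def)
  have "?D (a *\<^sub>R axis k 1) = a * ?D (axis k 1)"
    using has_derivative_linear[OF D] linear_scale by fastforce
  then show "partial_deriv k (\<lambda>x. c * \<psi> (a *\<^sub>R x)) x = (c * a) * partial_deriv k \<psi> (a *\<^sub>R x)"
    unfolding partial_deriv_def frechet_derivative_at[OF *, symmetric] by simp
qed

lemma test_function_scale:
  assumes \<phi>: "\<phi> \<in> test_functions \<Omega>" and \<epsilon>: "\<epsilon> > 0" and star: "\<And>x. x \<in> \<Omega> \<Longrightarrow> \<epsilon> *\<^sub>R x \<in> \<Omega>"
  shows "(\<lambda>x. \<phi> ((1 / \<epsilon>) *\<^sub>R x)) \<in> test_functions \<Omega>"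
proof -
  have d: "foldr partial_deriv ks \<phi> differentiable (at x)" for ks x
    using \<phi> by (auto simp: test_functions_def)
  obtain K where K: "compact K" "K \<subseteq> \<Omega>" "\<And>x. x \<notin> K \<Longrightarrow> \<phi> x = 0"
    using \<phi> by (auto simp: test_functions_def)
  have eq: "foldr partial_deriv ks (\<lambda>x. \<phi> ((1 / \<epsilon>) *\<^sub>R x))
    = (\<lambda>x. (1 / \<epsilon>) ^ length ks * foldr partial_deriv ks \<phi> ((1 / \<epsilon>) *\<^sub>R x))" for ks
  proof (induction ks)
    case (Cons k ks)
    show ?case
      unfolding foldr.simps o_apply Cons
      by (rule ext, subst partial_deriv_scale(2)[OF d]) (simp add: mult.commute)
  qed simp
  have "foldr partial_deriv ks (\<lambda>x. \<phi> ((1 / \<epsilon>) *\<^sub>R x)) differentiable (at x)" for ks x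
    unfolding eq by (rule partial_deriv_scale(1)[OF d])
  moreover have "compact ((\<lambda>x. \<epsilon> *\<^sub>R x) ` K)" by (rule compact_scaling[OF K(1)])
  moreover have "(\<lambda>x. \<epsilon> *\<^sub>R x) ` K \<subseteq> \<Omega>" using K(2) star by auto
  moreover have "\<phi> ((1 / \<epsilon>) *\<^sub>R x) = 0" if "x \<notin> (\<lambda>x. \<epsilon> *\<^sub>R x) ` K" for x
  proof (rule K(3), rule notI)
    assume "(1 / \<epsilon>) *\<^sub>R x \<in> K"
    then have "\<epsilon> *\<^sub>R ((1 / \<epsilon>) *\<^sub>R x) \<in> (\<lambda>x. \<epsilon> *\<^sub>R x) ` K" by (rule imageI)
    then show False using that \<epsilon> by simp
  qed
  ultimately show ?thesis unfolding test_functions_def by blast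
qed

section \<open>Blow-up at the corner\<close>

context polar_map
begin

text \<open>F is homogeneous of degree 1 in \<zeta>1, so shrinking towards the corner acts on the
  first parameter alone.\<close>

lemma scaled_in_\<Omega>:
  assumes "x \<in> \<Omega>" "0 < \<epsilon>" "\<epsilon> < 1"
  shows "\<epsilon> *\<^sub>R x \<in> \<Omega>" "G (\<epsilon> *\<^sub>R x) = vector [\<epsilon> * G x $ 1, G x $ 2]"
proof -
  define \<zeta> where "\<zeta> = (vector [\<epsilon> * G x $ 1, G x $ 2] :: real^2)"
  have G: "G x $ 1 \<in> {0<..<1}" "G x $ 2 \<in> {0<..<1}"
    using G_box[OF assms(1)] by (auto simp: mem_open_unit_square)
  have "\<epsilon> * G x $ 1 < 1 * 1" using G assms by (intro mult_strict_mono) auto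
  then have \<zeta>: "\<zeta> \<in> box 0 1" using G assms by (auto simp: mem_open_unit_square \<zeta>_def)
  have "F \<zeta> = \<zeta> $ 1 *\<^sub>R \<gamma> (\<zeta> $ 2)" using \<zeta> box_subset_cbox[of 0 "1::real^2"] by (intro F_eq) auto
  also have "\<dots> = \<epsilon> *\<^sub>R (G x $ 1 *\<^sub>R \<gamma> (G x $ 2))" by (simp add: \<zeta>_def)
  also have "G x $ 1 *\<^sub>R \<gamma> (G x $ 2) = F (G x)"
    using G_box[OF assms(1)] box_subset_cbox[of 0 "1::real^2"] by (intro F_eq[symmetric]) auto
  finally have eq: "F \<zeta> = \<epsilon> *\<^sub>R x" by (simp add: F_G assms(1))
  show "\<epsilon> *\<^sub>R x \<in> \<Omega>" unfolding eq[symmetric] \<Omega>_eq using \<zeta> by (rule imageI)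
  show "G (\<epsilon> *\<^sub>R x) = vector [\<epsilon> * G x $ 1, G x $ 2]"
    unfolding eq[symmetric] G_F[OF \<zeta>] by (simp add: \<zeta>_def)
qed

lemma zero_notin_\<Omega>: "0 \<notin> \<Omega>"
proof
  assume "0 \<in> \<Omega>"
  then have "F (G 0) = 0" "G 0 \<in> box 0 1" by (simp_all add: F_G G_box)
  moreover have "G 0 $ 1 > 0" "G 0 $ 2 \<in> {0<..<1}"
    using \<open>G 0 \<in> box 0 1\<close> by (auto simp: mem_open_unit_square)
  moreover have "F (G 0) = G 0 $ 1 *\<^sub>R \<gamma> (G 0 $ 2)"
    using \<open>G 0 \<in> box 0 1\<close> box_subset_cbox[of 0 "1::real^2"] by (intro F_eq) auto
  ultimately have "\<gamma> (G 0 $ 2) = 0" "c1 / (4 * CL) \<le> norm (\<gamma> (G 0 $ 2))"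
    using \<gamma>_norm_ge[of "G 0 $ 2"] by auto
  then show False using c1 CL by (simp add: divide_le_0_iff)
qed

text \<open>The blow-up is done on the test functions: \<open>v\<close> is tested with \<open>\<phi> (x / \<epsilon>)\<close>, and the pairing of the
  weak derivative with it is \<open>o(\<epsilon>)\<close> because the square of the derivative is integrable.\<close>

lemma edge_constant:
  fixes u v :: "real^2 \<Rightarrow> real"
  assumes u: "continuous_on (cbox 0 1) u" and v: "\<And>x. x \<in> \<Omega> \<Longrightarrow> v x = u (G x)" and H1: "v \<in> H1 \<Omega>"
  shows "\<exists>c. \<forall>t\<in>{0..1}. u (vector [0, t]) = c"
proof -
  \<comment> \<open>The blow-up limit: the edge values of u, carried along the rays from the
    corner.\<close>
  define v0 where "v0 x = u (vector [0, G x $ 2])" for x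
  have Gc: "G x \<in> cbox 0 1" if "x \<in> \<Omega>" for x using G_box[OF that] box_subset_cbox by blast
  have v_cont: "continuous_on \<Omega> v"
  proof -
    have "continuous_on \<Omega> (\<lambda>x. u (G x))"
      by (rule continuous_on_compose2[OF u continuous_on_G]) (use Gc in auto)
    then show ?thesis by (rule continuous_on_eq) (simp add: v)
  qed
  have v0_cont: "continuous_on \<Omega> v0"
    unfolding v0_def[abs_def]
    by (intro continuous_on_compose2[OF u] continuous_intros continuous_on_G)
       (use Gc in \<open>auto simp: mem_unit_square\<close>)
  have "bounded (u ` cbox 0 1)" by (intro compact_imp_bounded compact_continuous_image u compact_cbox)
  then obtain B where B0: "\<forall>y\<in>u ` cbox 0 1. \<bar>y\<bar> \<le> B" unfolding bounded_real by blast
  have v_bnd: "\<bar>v x\<bar> \<le> B" if "x \<in> \<Omega>" for x using B0 Gc[OF that] v[OF that] by auto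
  have "connected \<Omega>"
    unfolding \<Omega>_eq by (intro connected_continuous_image continuous_on_F_box convex_connected) simp
  have weak0: "(LINT x:\<Omega>|lebesgue. v0 x * partial_deriv k \<phi> x) = 0" if \<phi>_test: "\<phi> \<in> test_functions \<Omega>" for \<phi> k
  proof -
    obtain g where g: "g \<in> L2 \<Omega>" "weak_partial_deriv \<Omega> k v g" using H1 unfolding H1_def by blast
    have g_meas: "(\<lambda>x. indicator \<Omega> x *\<^sub>R g x) \<in> borel_measurable lebesgue"
      and g_int: "integrable lebesgue (\<lambda>x. indicator \<Omega> x *\<^sub>R (g x)\<^sup>2)"
      using g(1) by (simp_all add: L2_def set_borel_measurable_def set_integrable_def)
    obtain K where K: "compact K" "K \<subseteq> \<Omega>" "\<And>x. x \<notin> K \<Longrightarrow> \<phi> x = 0"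
      and \<phi>: "\<And>x. \<phi> differentiable (at x)" "\<And>k. continuous_on UNIV (partial_deriv k \<phi>)"
        "\<And>k x. x \<notin> K \<Longrightarrow> partial_deriv k \<phi> x = 0" "continuous_on UNIV \<phi>"
      by (rule test_function_facts[OF \<phi>_test]) (rule that)
    have [measurable]: "\<phi> \<in> borel_measurable borel" "partial_deriv k \<phi> \<in> borel_measurable borel"
      using \<phi>(2,4) by (simp_all add: borel_measurable_continuous_onI)
    obtain C0 where C0: "C0 \<ge> 0" "\<And>x. \<bar>\<phi> x\<bar> \<le> C0"
      using continuous_support_bounded[OF \<phi>(4) K(1,3)] by blast
    obtain C1 where C1: "C1 \<ge> 0" "\<And>x. \<bar>partial_deriv k \<phi> x\<bar> \<le> C1"
      using continuous_support_bounded[OF \<phi>(2) K(1) \<phi>(3)] by blast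
    obtain \<rho> where \<rho>: "K \<subseteq> cball 0 \<rho>" using bounded_subset_cball_0[OF compact_imp_bounded[OF K(1)]] by blast
    define J where "J = integral\<^sup>L lborel (\<lambda>x. (\<phi> x)\<^sup>2)"
    have dv_meas [measurable]: "(\<lambda>x. indicator \<Omega> x *\<^sub>R v x) \<in> borel_measurable borel"
      "(\<lambda>x. indicator \<Omega> x *\<^sub>R v0 x) \<in> borel_measurable borel"
      by (rule borel_measurable_continuous_on_indicator[OF _ v_cont] borel_measurable_continuous_on_indicator[OF _ v0_cont];
          simp add: open_\<Omega>)+
    obtain \<epsilon> :: "nat \<Rightarrow> real" where \<epsilon>: "\<And>n. 0 < \<epsilon> n" "\<And>n. \<epsilon> n < 1" "\<epsilon> \<longlonglongrightarrow> 0"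
      by (rule null_sequence_below[OF zero_less_one]) (rule that)
    \<comment> \<open>Substituting x = \<epsilon> y, the pairing of v with the derivative of
      \<phi>(x / \<epsilon>) becomes \<epsilon> times \<open>b n\<close>. \<open>I n\<close> is the
      energy of the weak derivative in a ball that contains the support of \<phi>(x /
      \<epsilon>).\<close>
    define b where "b n = integral\<^sup>L lborel (\<lambda>y. indicator \<Omega> (\<epsilon> n *\<^sub>R y) *\<^sub>R v (\<epsilon> n *\<^sub>R y) * partial_deriv k \<phi> y)" for n
    define I where "I n = integral\<^sup>L lebesgue (\<lambda>x. indicator \<Omega> x *\<^sub>R (g x)\<^sup>2 * indicator (cball 0 (\<epsilon> n * \<rho>)) x)" for n
    have b_lim: "b \<longlonglongrightarrow> (LINT x:\<Omega>|lebesgue. v0 x * partial_deriv k \<phi> x)"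
    proof -
      have "b \<longlonglongrightarrow> integral\<^sup>L lborel (\<lambda>y. indicator \<Omega> y *\<^sub>R v0 y * partial_deriv k \<phi> y)"
        unfolding b_def[abs_def]
      proof (rule integral_dominated_convergence)
        show "(\<lambda>y. indicator \<Omega> y *\<^sub>R v0 y * partial_deriv k \<phi> y) \<in> borel_measurable lborel"
          using borel_measurable_times[OF dv_meas(2)] by simp
        show "(\<lambda>y. indicator \<Omega> (\<epsilon> n *\<^sub>R y) *\<^sub>R v (\<epsilon> n *\<^sub>R y) * partial_deriv k \<phi> y) \<in> borel_measurable lborel" for n
          using borel_measurable_times[OF measurable_compose[OF _ dv_meas(1), of "\<lambda>y. \<epsilon> n *\<^sub>R y" borel]] by simp
        have "integrable lborel (\<lambda>y. \<bar>B\<bar> * partial_deriv k \<phi> y)"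
          using integrable_bounded_support[OF _ compact_imp_bounded[OF K(1)], of "partial_deriv k \<phi>" C1] \<phi>(3) C1(2)
          by simp
        then show "integrable lborel (\<lambda>y. norm (\<bar>B\<bar> * partial_deriv k \<phi> y))" by (rule integrable_norm)
        show "AE y in lborel. norm (indicator \<Omega> (\<epsilon> n *\<^sub>R y) *\<^sub>R v (\<epsilon> n *\<^sub>R y) * partial_deriv k \<phi> y)
            \<le> norm (\<bar>B\<bar> * partial_deriv k \<phi> y)" for n
        proof (rule AE_I2)
          fix y
          have "\<bar>indicator \<Omega> (\<epsilon> n *\<^sub>R y) *\<^sub>R v (\<epsilon> n *\<^sub>R y)\<bar> \<le> \<bar>B\<bar>"
            using v_bnd[of "\<epsilon> n *\<^sub>R y"] by (auto simp: indicator_def)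
          then show "norm (indicator \<Omega> (\<epsilon> n *\<^sub>R y) *\<^sub>R v (\<epsilon> n *\<^sub>R y) * partial_deriv k \<phi> y)
            \<le> norm (\<bar>B\<bar> * partial_deriv k \<phi> y)"
            unfolding real_norm_def abs_mult by (intro mult_right_mono) auto
        qed
        show "AE y in lborel. (\<lambda>n. indicator \<Omega> (\<epsilon> n *\<^sub>R y) *\<^sub>R v (\<epsilon> n *\<^sub>R y) * partial_deriv k \<phi> y)
            \<longlonglongrightarrow> indicator \<Omega> y *\<^sub>R v0 y * partial_deriv k \<phi> y"
        proof (rule AE_I2)
          fix y
          show "(\<lambda>n. indicator \<Omega> (\<epsilon> n *\<^sub>R y) *\<^sub>R v (\<epsilon> n *\<^sub>R y) * partial_deriv k \<phi> y)
            \<longlonglongrightarrow> indicator \<Omega> y *\<^sub>R v0 y * partial_deriv k \<phi> y"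
          proof (cases "y \<in> \<Omega>")
            case True
            have e: "indicator \<Omega> (\<epsilon> n *\<^sub>R y) *\<^sub>R v (\<epsilon> n *\<^sub>R y) = u (vector [\<epsilon> n * G y $ 1, G y $ 2])" for n
              using scaled_in_\<Omega>[OF True \<epsilon>(1,2), of n] v by simp
            have Gy: "G y $ 1 \<in> {0..1}" "G y $ 2 \<in> {0..1}" using Gc[OF True] by (auto simp: mem_unit_square)
            have "continuous_on {0..1} (\<lambda>s. u (vector [s * G y $ 1, G y $ 2]))"
              by (intro continuous_on_compose2[OF u] continuous_intros)
                 (use Gy in \<open>auto simp: mem_unit_square intro: mult_le_one\<close>)
            then have "(\<lambda>n. u (vector [\<epsilon> n * G y $ 1, G y $ 2])) \<longlonglongrightarrow> u (vector [0 * G y $ 1, G y $ 2])"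
              using \<epsilon> less_imp_le by (intro continuous_on_tendsto_compose[where s = "{0..1}", OF _ \<epsilon>(3)]) (auto intro!: always_eventually)
            then show ?thesis unfolding e using True by (auto simp: v0_def intro!: tendsto_intros)
          next
            case False
            then have "partial_deriv k \<phi> y = 0" using K(2) \<phi>(3) by blast
            then show ?thesis by simp
          qed
        qed
      qed
      also have "integral\<^sup>L lborel (\<lambda>y. indicator \<Omega> y *\<^sub>R v0 y * partial_deriv k \<phi> y)
        = (LINT x:\<Omega>|lebesgue. v0 x * partial_deriv k \<phi> x)"
        unfolding set_lebesgue_integral_def
        using integral_completion[of "\<lambda>y. indicator \<Omega> y *\<^sub>R v0 y * partial_deriv k \<phi> y" lborel]
          borel_measurable_times[OF dv_meas(2)] by (simp add: mult.assoc)
      finally show ?thesis .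
    qed
    have I_lim: "I \<longlonglongrightarrow> 0"
    proof -
      have "I \<longlonglongrightarrow> integral\<^sup>L lebesgue (\<lambda>x::real^2. 0::real)"
        unfolding I_def[abs_def]
      proof (rule integral_dominated_convergence[OF _ _ g_int])
        show "(\<lambda>x. indicator \<Omega> x *\<^sub>R (g x)\<^sup>2 * indicator (cball 0 (\<epsilon> n * \<rho>)) x) \<in> borel_measurable lebesgue" for n
          by (intro borel_measurable_times borel_measurable_integrable[OF g_int] borel_measurable_indicator
              fmeasurableD[OF lmeasurable_cball])
        show "AE x in lebesgue. (\<lambda>n. indicator \<Omega> x *\<^sub>R (g x)\<^sup>2 * indicator (cball 0 (\<epsilon> n * \<rho>)) x) \<longlonglongrightarrow> 0"
        proof (rule AE_I2)
          fix x :: "real^2"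
          show "(\<lambda>n. indicator \<Omega> x *\<^sub>R (g x)\<^sup>2 * indicator (cball 0 (\<epsilon> n * \<rho>)) x) \<longlonglongrightarrow> 0"
          proof (cases "x \<in> \<Omega>")
            case True
            \<comment> \<open>The corner does not belong to \<Omega>, so every point of \<Omega>
              eventually leaves the shrinking balls.\<close>
            then have nx: "0 * \<rho> < norm x" using zero_notin_\<Omega> by auto
            have "(\<lambda>n. \<epsilon> n * \<rho>) \<longlonglongrightarrow> 0 * \<rho>" by (intro tendsto_intros \<epsilon>(3))
            from order_tendstoD(2)[OF this nx]
            have "\<forall>\<^sub>F n in sequentially. \<epsilon> n * \<rho> < norm x" .
            then show ?thesis
              by (intro tendsto_eventually, elim eventually_mono) (simp add: indicator_def)
          qed simp
        qed
        show "AE x in lebesgue. norm (indicator \<Omega> x *\<^sub>R (g x)\<^sup>2 * indicator (cball 0 (\<epsilon> n * \<rho>)) x) \<le> indicator \<Omega> x *\<^sub>R (g x)\<^sup>2" for n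
          by (rule AE_I2) (auto simp: indicator_def)
      qed simp
      then show ?thesis by simp
    qed
    have b_bnd: "\<bar>b n\<bar> \<le> \<tau> / 2 * I n + J / (2 * \<tau>)" if \<tau>: "\<tau> > 0" for n \<tau>
    proof -
      let ?e = "\<epsilon> n"
      define \<psi> where "\<psi> x = \<phi> ((1 / ?e) *\<^sub>R x)" for x
      have e: "0 < ?e" "?e < 1" using \<epsilon> by auto
      have \<psi>: "\<psi> \<in> test_functions \<Omega>"
        unfolding \<psi>_def[abs_def] using test_function_scale[OF \<phi>_test e(1)] scaled_in_\<Omega>(1)[OF _ e] by blast
      have [measurable]: "\<psi> \<in> borel_measurable borel" unfolding \<psi>_def[abs_def] by measurable
      have d\<psi>: "partial_deriv k \<psi> x = 1 / ?e * partial_deriv k \<phi> ((1 / ?e) *\<^sub>R x)" for x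
        using partial_deriv_scale(2)[OF \<phi>(1), where c = 1 and a = "1 / ?e" and x = x and k = k] by (simp add: \<psi>_def[abs_def])
      have f_meas: "(\<lambda>x. indicator \<Omega> x *\<^sub>R v x * (1 / ?e * partial_deriv k \<phi> ((1 / ?e) *\<^sub>R x))) \<in> borel_measurable borel"
        by (rule borel_measurable_times[OF dv_meas(1)]) measurable
      have "(LINT x:\<Omega>|lebesgue. v x * partial_deriv k \<psi> x)
        = integral\<^sup>L lborel (\<lambda>x. indicator \<Omega> x *\<^sub>R v x * (1 / ?e * partial_deriv k \<phi> ((1 / ?e) *\<^sub>R x)))"
        unfolding set_lebesgue_integral_def d\<psi> using f_meas
        by (subst integral_completion[symmetric]) (simp_all add: mult.assoc)
      also have "\<dots> = ?e\<^sup>2 * integral\<^sup>L lborel (\<lambda>y. indicator \<Omega> (?e *\<^sub>R y) *\<^sub>R v (?e *\<^sub>R y) *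
          (1 / ?e * partial_deriv k \<phi> ((1 / ?e) *\<^sub>R (?e *\<^sub>R y))))"
        by (rule integral_scale_2[OF f_meas e(1)])
      also have "(\<lambda>y. indicator \<Omega> (?e *\<^sub>R y) *\<^sub>R v (?e *\<^sub>R y) *
          (1 / ?e * partial_deriv k \<phi> ((1 / ?e) *\<^sub>R (?e *\<^sub>R y))))
        = (\<lambda>y. 1 / ?e * (indicator \<Omega> (?e *\<^sub>R y) *\<^sub>R v (?e *\<^sub>R y) * partial_deriv k \<phi> y))"
        using e(1) by (intro ext) simp
      also have "?e\<^sup>2 * integral\<^sup>L lborel \<dots> = ?e\<^sup>2 * (1 / ?e * b n)"
        by (simp only: integral_mult_right_zero b_def)
      also have "\<dots> = ?e * b n" using e(1) by (simp add: power2_eq_square)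
      finally have lhs: "(LINT x:\<Omega>|lebesgue. v x * partial_deriv k \<psi> x) = ?e * b n" .
      have \<psi>2_int: "integrable lborel (\<lambda>x. (\<psi> x)\<^sup>2)"
      proof (rule integrable_bounded_support[where C = "C0\<^sup>2"])
        show "bounded (cball (0::real^2) \<rho>)" by simp
        show "(\<psi> x)\<^sup>2 = 0" if "x \<notin> cball 0 \<rho>" for x
        proof -
          have "norm x \<le> norm ((1 / ?e) *\<^sub>R x)" using e by (simp add: divide_simps mult_left_le)
          then have "(1 / ?e) *\<^sub>R x \<notin> K" using that \<rho> by auto
          then show ?thesis using K(3) by (simp add: \<psi>_def)
        qed
        show "\<bar>(\<psi> x)\<^sup>2\<bar> \<le> C0\<^sup>2" for x using power_mono[OF C0(2)[of "(1 / ?e) *\<^sub>R x"], of 2] by (simp add: \<psi>_def)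
      qed measurable
      have J: "integral\<^sup>L lborel (\<lambda>x. (\<psi> x)\<^sup>2) = ?e\<^sup>2 * J"
        using integral_scale_2[of "\<lambda>x. (\<psi> x)\<^sup>2" ?e] e(1) by (simp add: \<psi>_def J_def)
      have \<psi>2_leb: "integrable lebesgue (\<lambda>x. (\<psi> x)\<^sup>2)" "integral\<^sup>L lebesgue (\<lambda>x. (\<psi> x)\<^sup>2) = ?e\<^sup>2 * J"
        using \<psi>2_int J by (simp_all add: integrable_completion integral_completion)
      \<comment> \<open>Young's inequality with weight \<tau> \<epsilon>. The integral of \<psi>^2
        is \<epsilon>^2 J, so both terms of the integral of H carry exactly one factor \<epsilon>,
        which cancels against the one in front of \<open>b n\<close>.\<close>
      define H where "H x = \<tau> * ?e / 2 * (indicator \<Omega> x *\<^sub>R (g x)\<^sup>2 * indicator (cball 0 (?e * \<rho>)) x)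
        + 1 / (2 * \<tau> * ?e) * (\<psi> x)\<^sup>2" for x
      have gI_int: "integrable lebesgue (\<lambda>x. indicator \<Omega> x *\<^sub>R (g x)\<^sup>2 * indicator (cball 0 (?e * \<rho>)) x)"
      proof (rule Bochner_Integration.integrable_bound[OF g_int])
        show "(\<lambda>x. indicator \<Omega> x *\<^sub>R (g x)\<^sup>2 * indicator (cball 0 (?e * \<rho>)) x) \<in> borel_measurable lebesgue"
          by (intro borel_measurable_times borel_measurable_integrable[OF g_int] borel_measurable_indicator
              fmeasurableD[OF lmeasurable_cball])
      qed (auto simp: indicator_def)
      have H_int: "integrable lebesgue H"
        unfolding H_def[abs_def] using gI_int \<psi>2_leb(1) by simp
      have H_integral: "integral\<^sup>L lebesgue H = ?e * (\<tau> / 2 * I n + J / (2 * \<tau>))"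
        unfolding H_def[abs_def] using gI_int \<psi>2_leb e(1) \<tau>
        by (simp add: I_def power2_eq_square field_simps)
      have le: "\<bar>indicator \<Omega> x *\<^sub>R (g x * \<psi> x)\<bar> \<le> H x" for x
      proof (cases "x \<in> \<Omega> \<and> \<psi> x \<noteq> 0")
        case True
        then have "(1 / ?e) *\<^sub>R x \<in> K" using K(3) by (auto simp: \<psi>_def)
        then have "norm ((1 / ?e) *\<^sub>R x) \<le> \<rho>" using \<rho> by auto
        then have "norm x \<le> ?e * \<rho>" using e(1) by (simp add: divide_le_eq mult.commute)
        moreover have "2 * (\<bar>g x\<bar> * \<bar>\<psi> x\<bar>) \<le> \<tau> * ?e * (g x)\<^sup>2 + 1 / (\<tau> * ?e) * (\<psi> x)\<^sup>2"
        proof -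
          define s where "s = \<tau> * ?e"
          have s: "s > 0" using \<tau> e(1) by (simp add: s_def)
          have "0 \<le> (s * \<bar>g x\<bar> - \<bar>\<psi> x\<bar>)\<^sup>2 / s" using s by simp
          also have "\<dots> = s * (g x)\<^sup>2 + 1 / s * (\<psi> x)\<^sup>2 - 2 * (\<bar>g x\<bar> * \<bar>\<psi> x\<bar>)"
            using s by (simp add: power2_diff power_mult_distrib field_simps power2_eq_square)
          finally show ?thesis by (simp add: s_def)
        qed
        ultimately show ?thesis using True by (simp add: H_def abs_mult)
      next
        case False
        have "0 \<le> H x" unfolding H_def using \<tau> e(1) by (intro add_nonneg_nonneg mult_nonneg_nonneg) (auto simp: indicator_def)
        then show ?thesis using False by (auto simp: indicator_def)
      qed
      have g\<psi>_meas: "(\<lambda>x. indicator \<Omega> x *\<^sub>R (g x * \<psi> x)) \<in> borel_measurable lebesgue"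
      proof -
        have "\<psi> \<in> borel_measurable lebesgue" by (simp add: measurable_completion)
        from borel_measurable_times[OF g_meas this] show ?thesis by (simp add: mult.assoc)
      qed
      have "\<bar>LINT x:\<Omega>|lebesgue. g x * \<psi> x\<bar> \<le> integral\<^sup>L lebesgue (\<lambda>x. \<bar>indicator \<Omega> x *\<^sub>R (g x * \<psi> x)\<bar>)"
        unfolding set_lebesgue_integral_def by (rule integral_abs_bound)
      also have "\<dots> \<le> integral\<^sup>L lebesgue H"
      proof (rule integral_mono)
        show "integrable lebesgue (\<lambda>x. \<bar>indicator \<Omega> x *\<^sub>R (g x * \<psi> x)\<bar>)"
          by (rule integrable_abs, rule Bochner_Integration.integrable_bound[OF H_int g\<psi>_meas], rule AE_I2)
             (use le in \<open>auto intro: order_trans[OF _ abs_ge_self]\<close>)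
      qed (use H_int le in auto)
      finally have "\<bar>?e * b n\<bar> \<le> ?e * (\<tau> / 2 * I n + J / (2 * \<tau>))"
        using g(2) \<psi> unfolding weak_partial_deriv_def lhs[symmetric] H_integral by simp
      then have "?e * \<bar>b n\<bar> \<le> ?e * (\<tau> / 2 * I n + J / (2 * \<tau>))" using e(1) by (simp add: abs_mult)
      then show ?thesis using e(1) by (simp only: mult_le_cancel_left_pos)
    qed
    define L where "L = (LINT x:\<Omega>|lebesgue. v0 x * partial_deriv k \<phi> x)"
    have L_le: "\<bar>L\<bar> \<le> J / (2 * \<tau>)" if \<tau>: "\<tau> > 0" for \<tau>
    proof -
      have "(\<lambda>n. \<tau> / 2 * I n + J / (2 * \<tau>)) \<longlonglongrightarrow> \<tau> / 2 * 0 + J / (2 * \<tau>)"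
        by (intro tendsto_intros I_lim)
      moreover have "(\<lambda>n. \<bar>b n\<bar>) \<longlonglongrightarrow> \<bar>L\<bar>" using b_lim unfolding L_def by (rule tendsto_rabs)
      ultimately show ?thesis using b_bnd[OF \<tau>] by (intro LIMSEQ_le[of "\<lambda>n. \<bar>b n\<bar>"]) auto
    qed
    have "L = 0"
    proof (rule ccontr)
      assume "L \<noteq> 0"
      \<comment> \<open>After the limit in n any large \<tau> contradicts L \<noteq> 0. This choice
        turns the bound into 2 (|J| + 1) \<le> J.\<close>
      then have "\<bar>L\<bar> \<le> J / (2 * ((\<bar>J\<bar> + 1) / \<bar>L\<bar>))" by (intro L_le) simp
      then have "\<bar>L\<bar> * (2 * (\<bar>J\<bar> + 1)) \<le> J * \<bar>L\<bar>" using \<open>L \<noteq> 0\<close> by (simp add: field_simps)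
      then have "2 * (\<bar>J\<bar> + 1) \<le> J" using \<open>L \<noteq> 0\<close> by (simp add: mult.commute)
      then show False using abs_ge_self[of J] abs_ge_zero[of J] by argo
    qed
    then show ?thesis by (simp add: L_def)
  qed
  \<comment> \<open>F(1/2, t) has second parameter t, so v0 takes the edge value of u at t there;
    any radius strictly between 0 and 1 would serve.\<close>
  define x1 where "x1 = F (vector [1/2, 1/2])"
  have in\<Omega>: "F (vector [1/2, t]) \<in> \<Omega>" "v0 (F (vector [1/2, t])) = u (vector [0, t])" if "t \<in> {0<..<1}" for t
  proof -
    have "vector [1/2, t] \<in> box (0::real^2) 1" using that by (simp add: mem_open_unit_square)
    then show "F (vector [1/2, t]) \<in> \<Omega>" "v0 (F (vector [1/2, t])) = u (vector [0, t])"
      by (auto simp: \<Omega>_eq v0_def G_F)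
  qed
  define c where "c = v0 x1"
  have c: "u (vector [0, t]) = c" if "t \<in> {0<..<1}" for t
    using weakly_constant_imp_constant[OF open_\<Omega> \<open>connected \<Omega>\<close> v0_cont weak0, of "F (vector [1/2, t])" x1]
      in\<Omega>[OF that] in\<Omega>(1)[of "1/2"] by (simp add: c_def x1_def)
  have "continuous_on (closure {0<..<1}) (\<lambda>t. u (vector [0, t]))"
    by (intro continuous_on_compose2[OF u] continuous_intros) (auto simp: mem_unit_square)
  then have "u (vector [0, t]) = c" if "t \<in> closure {0<..<1}" for t
    by (rule continuous_constant_on_closure[OF _ _ that]) (rule c)
  then show ?thesis by auto
qed

end

section \<open>The projector\<close>

lemma pullback_eq:
  assumes "continuous_on (cbox 0 1) u" "\<And>\<zeta>. \<zeta> \<in> box 0 1 \<Longrightarrow> u \<zeta> = v (F \<zeta>)" "\<zeta> \<in> cbox 0 1"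
  shows "pullback F v \<zeta> = u \<zeta>"
proof -
  have "\<zeta> islimpt box 0 1"
  proof (cases "\<zeta> \<in> box 0 1")
    case True
    then show ?thesis by (intro interior_limit_point) (simp add: interior_open open_box)
  next
    case False
    have "\<zeta> \<in> closure (box 0 1)"
      using assms(3) by (subst closure_box) (auto simp: box_ne_empty inner_axis Basis_vec_def)
    then show ?thesis using False by (simp add: closure_def)
  qed
  then have nt: "\<not> trivial_limit (at \<zeta> within box 0 1)" by (simp add: trivial_limit_within)
  have "(u \<longlongrightarrow> u \<zeta>) (at \<zeta> within cbox 0 1)"
    using assms(1,3) by (simp add: continuous_on_def)
  then have "(u \<longlongrightarrow> u \<zeta>) (at \<zeta> within box 0 1)"
    by (rule tendsto_within_subset[OF _ box_subset_cbox])
  then have "((v \<circ> F) \<longlongrightarrow> u \<zeta>) (at \<zeta> within box 0 1)"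
    by (rule Lim_transform_eventually) (auto simp: eventually_at_filter assms(2))
  then show ?thesis unfolding pullback_def by (rule tendsto_Lim[OF nt])
qed

lemma lipschitz_on_sum_ex:
  fixes f :: "'i \<Rightarrow> 'a::metric_space \<Rightarrow> 'b::real_normed_vector"
  assumes "\<And>i. i \<in> A \<Longrightarrow> \<exists>C. C-lipschitz_on S (f i)"
  shows "\<exists>C. C-lipschitz_on S (\<lambda>x. \<Sum>i\<in>A. f i x)"
  using assms
proof (induction A rule: infinite_finite_induct)
  case (insert i A)
  then obtain C D where "C-lipschitz_on S (f i)" "D-lipschitz_on S (\<lambda>x. \<Sum>i\<in>A. f i x)" by blast
  then have "(C + D)-lipschitz_on S (\<lambda>x. f i x + (\<Sum>i\<in>A. f i x))" by (rule lipschitz_on_add)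
  then show ?case using insert.hyps by auto
qed (auto intro: exI[of _ 0] lipschitz_on_constant)

lemma lipschitz_on_scaleR_const_ex:
  assumes "\<exists>C. C-lipschitz_on S f"
  shows "\<exists>C. C-lipschitz_on S (\<lambda>x. f x *\<^sub>R (b :: 'b::real_normed_vector))"
proof -
  obtain C where C: "C-lipschitz_on S f" using assms by blast
  have "(C * norm b)-lipschitz_on S (\<lambda>x. f x *\<^sub>R b)"
  proof (rule lipschitz_onI)
    fix x y assume "x \<in> S" "y \<in> S"
    then have "\<bar>f x - f y\<bar> * norm b \<le> C * dist x y * norm b"
      using lipschitz_onD[OF C] by (intro mult_right_mono) (auto simp: dist_real_def)
    then show "dist (f x *\<^sub>R b) (f y *\<^sub>R b) \<le> C * norm b * dist x y"
      by (simp add: dist_norm mult_ac flip: scaleR_diff_left)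
  qed (use lipschitz_on_nonneg[OF C] in simp)
  then show ?thesis ..
qed

text \<open>Because f(0) = 0, the factor |f s| \<le> C s accompanies the increment of r; this is the
  weight with which the polar map controls the second parameter.\<close>

lemma product_increment_le:
  fixes f r :: "real \<Rightarrow> real"
  assumes f: "C-lipschitz_on {0..1} f" "f 0 = 0" and r: "D-lipschitz_on {0..1} r" "\<And>t. t \<in> {0..1} \<Longrightarrow> \<bar>r t\<bar> \<le> E"
    and m: "s \<in> {0..1}" "s' \<in> {0..1}" "t \<in> {0..1}" "t' \<in> {0..1}"
  shows "\<bar>f s * r t - f s' * r t'\<bar> \<le> (C * D + C * E) * (\<bar>s - s'\<bar> + s * \<bar>t - t'\<bar>)"
proof -
  have CD: "0 \<le> C" "0 \<le> D" using f(1) r(1) lipschitz_on_nonneg by blast+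
  have E: "0 \<le> E" using r(2)[of 0] by simp
  have "f s * r t - f s' * r t' = f s * (r t - r t') + (f s - f s') * r t'" by (simp add: algebra_simps)
  then have "\<bar>f s * r t - f s' * r t'\<bar> \<le> \<bar>f s\<bar> * \<bar>r t - r t'\<bar> + \<bar>f s - f s'\<bar> * \<bar>r t'\<bar>"
    by (metis abs_mult abs_triangle_ineq)
  also have "\<dots> \<le> (C * s) * (D * \<bar>t - t'\<bar>) + (C * \<bar>s - s'\<bar>) * E"
  proof (intro add_mono mult_mono)
    show "\<bar>f s\<bar> \<le> C * s" using lipschitz_onD[OF f(1) m(1), of 0] f(2) m(1) by (simp add: dist_real_def)
    show "\<bar>r t - r t'\<bar> \<le> D * \<bar>t - t'\<bar>" using lipschitz_onD[OF r(1) m(3,4)] by (simp add: dist_real_def)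
    show "\<bar>f s - f s'\<bar> \<le> C * \<bar>s - s'\<bar>" using lipschitz_onD[OF f(1) m(1,2)] by (simp add: dist_real_def)
  qed (use r(2) m CD in auto)
  also have "\<dots> \<le> (C * D + C * E) * (\<bar>s - s'\<bar> + s * \<bar>t - t'\<bar>)"
  proof -
    have "0 \<le> C * D * \<bar>s - s'\<bar>" "0 \<le> C * E * (s * \<bar>t - t'\<bar>)" using CD E m by auto
    then show ?thesis by (simp add: algebra_simps)
  qed
  finally show ?thesis .
qed

lemma bspline_linear: "t \<in> {0..1} \<Longrightarrow> bspline [0, 0, 1, 1] 2 1 t = t"
  by (auto simp: knot_def)

section \<open>Increments and derivatives of NURBS quotients\<close>

context weighted_tensor_knots
begin

lemma W2_lipschitz: "\<exists>C. C-lipschitz_on {0..1} W2"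
proof -
  have "\<exists>C. C-lipschitz_on {0..1} (\<lambda>t. \<Sum>k=1..K2.n. bspline \<Xi>2 k p2 t *\<^sub>R w (1, k))"
    by (intro lipschitz_on_sum_ex lipschitz_on_scaleR_const_ex K2.bspline_lipschitz) auto
  then show ?thesis by (simp add: W2_def[abs_def] mult.commute)
qed

lemma W2_differentiable:
  assumes "0 < t" "t < 1" "t \<notin> set \<Xi>2"
  shows "\<exists>D. (W2 has_real_derivative D) (at t)"
proof -
  have "\<forall>k\<in>{1..K2.n}. \<exists>D. (bspline \<Xi>2 k p2 has_real_derivative D) (at t)"
    using K2.bspline_differentiable assms by auto
  then obtain D where "\<And>k. k \<in> {1..K2.n} \<Longrightarrow> (bspline \<Xi>2 k p2 has_real_derivative D k) (at t)" by metis
  then have "(W2 has_real_derivative (\<Sum>k=1..K2.n. w (1, k) * D k)) (at t)"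
    unfolding W2_def[abs_def] by (intro DERIV_sum DERIV_cmult) auto
  then show ?thesis ..
qed

definition spline_quotient :: "nat \<Rightarrow> real \<Rightarrow> real" where
  "spline_quotient k t = bspline \<Xi>2 k p2 t / W2 t"

lemma nurbs_eq:
  "\<zeta> \<in> cbox 0 1 \<Longrightarrow> tensor_bspline \<Xi>1 p1 \<Xi>2 p2 i \<zeta> / W \<zeta> = bspline \<Xi>1 (fst i) p1 (\<zeta> $ 1) * spline_quotient (snd i) (\<zeta> $ 2)"
  by (simp add: tensor_bspline_def spline_quotient_def W_eq_W2)

text \<open>In the first direction every B-spline but the first vanishes at 0, so
  \<open>product_increment_le\<close> applies to it and the quotient in the second
  direction.\<close>

lemma spline_increment:
  assumes "i \<in> I" "fst i \<noteq> 1"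
  shows "\<exists>L\<ge>0. \<forall>\<zeta>\<in>cbox 0 1. \<forall>\<eta>\<in>cbox 0 1.
    \<bar>tensor_bspline \<Xi>1 p1 \<Xi>2 p2 i \<zeta> / W \<zeta> - tensor_bspline \<Xi>1 p1 \<Xi>2 p2 i \<eta> / W \<eta>\<bar>
      \<le> L * (\<bar>\<zeta> $ 1 - \<eta> $ 1\<bar> + \<zeta> $ 1 * \<bar>\<zeta> $ 2 - \<eta> $ 2\<bar>)"
proof -
  note i = assms(1)[unfolded index_iff]
  obtain C where C: "C-lipschitz_on {0..1} (bspline \<Xi>1 (fst i) p1)" using K1.bspline_lipschitz i by blast
  obtain C2 where C2: "C2-lipschitz_on {0..1} (bspline \<Xi>2 (snd i) p2)" using K2.bspline_lipschitz i by blast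
  obtain C3 where C3: "C3-lipschitz_on {0..1} W2" using W2_lipschitz by blast
  obtain D where D: "D-lipschitz_on {0..1} (spline_quotient (snd i))"
    using lipschitz_on_divide[OF C2 C3 W2_pos] unfolding spline_quotient_def[abs_def] by blast
  have "bounded (spline_quotient (snd i) ` {0..1})"
    by (intro compact_imp_bounded compact_continuous_image lipschitz_on_continuous_on[OF D]) simp
  then obtain E where "\<forall>y\<in>spline_quotient (snd i) ` {0..1}. \<bar>y\<bar> \<le> E" unfolding bounded_real by blast
  then have E: "\<And>t. t \<in> {0..1} \<Longrightarrow> \<bar>spline_quotient (snd i) t\<bar> \<le> E" by blast
  have "0 \<le> E" using E[of 0] by simp
  then have "0 \<le> C * D + C * E" using lipschitz_on_nonneg[OF C] lipschitz_on_nonneg[OF D] by simp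
  moreover have "bspline \<Xi>1 (fst i) p1 0 = 0" using K1.bspline_0 i assms(2) by simp
  ultimately show ?thesis
    using product_increment_le[OF C _ D E]
    by (intro exI[of _ "C * D + C * E"]) (simp add: nurbs_eq mem_unit_square)
qed

lemma nurbs_differentiable:
  assumes i: "i \<in> I" and \<zeta>: "\<zeta> \<in> box 0 1" "\<zeta> $ 1 \<notin> set \<Xi>1" "\<zeta> $ 2 \<notin> set \<Xi>2"
  shows "(\<lambda>\<zeta>. tensor_bspline \<Xi>1 p1 \<Xi>2 p2 i \<zeta> / W \<zeta>) differentiable (at \<zeta>)"
proof -
  note i' = i[unfolded index_iff]
  have m: "\<zeta> $ 1 \<in> {0<..<1}" "\<zeta> $ 2 \<in> {0<..<1}" using \<zeta>(1) by (auto simp: mem_open_unit_square)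
  obtain D1 where D1: "(bspline \<Xi>1 (fst i) p1 has_real_derivative D1) (at (\<zeta> $ 1))"
    using K1.bspline_differentiable[of "fst i" "\<zeta> $ 1"] i' m \<zeta> by auto
  obtain D2 where D2: "(bspline \<Xi>2 (snd i) p2 has_real_derivative D2) (at (\<zeta> $ 2))"
    using K2.bspline_differentiable[of "snd i" "\<zeta> $ 2"] i' m \<zeta> by auto
  obtain D3 where D3: "(W2 has_real_derivative D3) (at (\<zeta> $ 2))" using W2_differentiable[of "\<zeta> $ 2"] m \<zeta> by auto
  have comp: "(\<lambda>\<zeta>::real^2. f (\<zeta> $ k)) differentiable (at \<zeta>)" if "(f has_real_derivative D) (at (\<zeta> $ k))" for f D k
    using has_derivative_compose[OF bounded_linear_imp_has_derivative[OF bounded_linear_vec_nth] that[unfolded has_field_derivative_def]]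
    by (auto simp: differentiable_def)
  have "W2 (\<zeta> $ 2) \<noteq> 0" using W2_pos[of "\<zeta> $ 2"] m by auto
  then have "(\<lambda>\<zeta>. bspline \<Xi>1 (fst i) p1 (\<zeta> $ 1) * (bspline \<Xi>2 (snd i) p2 (\<zeta> $ 2) / W2 (\<zeta> $ 2))) differentiable (at \<zeta>)"
    by (intro differentiable_mult differentiable_divide comp[OF D1] comp[OF D2] comp[OF D3])
  then obtain D where "((\<lambda>\<zeta>. bspline \<Xi>1 (fst i) p1 (\<zeta> $ 1) * (bspline \<Xi>2 (snd i) p2 (\<zeta> $ 2) / W2 (\<zeta> $ 2))) has_derivative D) (at \<zeta>)"
    by (auto simp: differentiable_def)
  then have "((\<lambda>\<zeta>. tensor_bspline \<Xi>1 p1 \<Xi>2 p2 i \<zeta> / W \<zeta>) has_derivative D) (at \<zeta>)"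
  proof (rule has_derivative_transform_within_open[OF _ open_box \<zeta>(1)])
    fix \<eta> :: "real^2" assume "\<eta> \<in> box 0 1"
    then have "\<eta> \<in> cbox 0 1" using box_subset_cbox by blast
    then show "bspline \<Xi>1 (fst i) p1 (\<eta> $ 1) * (bspline \<Xi>2 (snd i) p2 (\<eta> $ 2) / W2 (\<eta> $ 2)) = tensor_bspline \<Xi>1 p1 \<Xi>2 p2 i \<eta> / W \<eta>"
      by (simp add: nurbs_eq spline_quotient_def)
  qed
  then show ?thesis by (auto simp: differentiable_def)
qed

lemma continuous_on_nurbs: "i \<in> I \<Longrightarrow> continuous_on (cbox 0 1) (\<lambda>\<zeta>. tensor_bspline \<Xi>1 p1 \<Xi>2 p2 i \<zeta> / W \<zeta>)"
  by (intro continuous_on_divide continuous_on_tensor_bspline continuous_on_W) (auto dest: W_pos)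

end

text \<open>The control points of the first row are all at the corner 0, so only the second row
  remains, and its linear B-spline is \<zeta>1.\<close>

lemma nurbs_map_polar:
  assumes c_polar: "\<And>i2. (1, i2) \<in> initial_index M p \<Longrightarrow> c (1, i2) = 0" and "\<zeta> \<in> cbox 0 1"
  shows "nurbs_map M p w c \<zeta> = \<zeta> $ 1 *\<^sub>R ((1 / weight_fun M p w \<zeta>) *\<^sub>R
    (\<Sum>k=1..num_bsplines (initial_knots M p) p. bspline (initial_knots M p) k p (\<zeta> $ 2) *\<^sub>R (w (2, k) *\<^sub>R c (2, k))))"
proof -
  let ?m = "num_bsplines (initial_knots M p) p"
  have idx: "tensor_index [0, 0, 1, 1] 1 (initial_knots M p) p = {1..2} \<times> {1..?m}"
    by (simp add: tensor_index_def num_bsplines_def numeral_2_eq_2)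
  have "tensor_spline [0, 0, 1, 1] 1 (initial_knots M p) p (\<lambda>i. w i *\<^sub>R c i) \<zeta>
    = (\<Sum>j=1..2. \<Sum>k=1..?m. tensor_bspline [0, 0, 1, 1] 1 (initial_knots M p) p (j, k) \<zeta> *\<^sub>R (w (j, k) *\<^sub>R c (j, k)))"
    unfolding tensor_spline_def idx by (simp add: sum.cartesian_product case_prod_unfold)
  also have "\<dots> = (\<Sum>j\<in>{2}. \<Sum>k=1..?m. tensor_bspline [0, 0, 1, 1] 1 (initial_knots M p) p (j, k) \<zeta> *\<^sub>R (w (j, k) *\<^sub>R c (j, k)))"
  proof (rule sum.mono_neutral_right)
    show "\<forall>j\<in>{1..2} - {2}. (\<Sum>k=1..?m. tensor_bspline [0, 0, 1, 1] 1 (initial_knots M p) p (j, k) \<zeta> *\<^sub>R (w (j, k) *\<^sub>R c (j, k))) = 0"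
    proof
      fix j :: nat assume "j \<in> {1..2} - {2}"
      then have "j = 1" by auto
      moreover have "c (1, k) = 0" if "k \<in> {1..?m}" for k
        using that by (intro c_polar) (unfold initial_index_def idx, simp)
      ultimately show "(\<Sum>k=1..?m. tensor_bspline [0, 0, 1, 1] 1 (initial_knots M p) p (j, k) \<zeta> *\<^sub>R (w (j, k) *\<^sub>R c (j, k))) = 0"
        by (intro sum.neutral) auto
    qed
  qed auto
  also have "\<dots> = \<zeta> $ 1 *\<^sub>R (\<Sum>k=1..?m. bspline (initial_knots M p) k p (\<zeta> $ 2) *\<^sub>R (w (2, k) *\<^sub>R c (2, k)))"
    using assms(2) bspline_linear[of "\<zeta> $ 1"]
    by (simp add: tensor_bspline_def mem_unit_square scaleR_sum_right mult.assoc del: bspline.simps)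
  finally show ?thesis by (simp add: nurbs_map_def)
qed

text \<open>Division, \<open>integral\<close> and \<open>Lim\<close> are total, so well-definedness
  is stated explicitly: W has no zero, the function to which the functionals are applied is
  continuous, all integrals exist, and \<open>Vh_pol\<close> lies in the domain of the
  operator.\<close>

theorem lemma4p1:
  fixes M p20 p1 p2 N1 N2 :: nat
    and \<mu> \<omega> :: real
    and w0 w :: "nat \<times> nat \<Rightarrow> real"
    and c :: "nat \<times> nat \<Rightarrow> real^2"
    and W :: "real^2 \<Rightarrow> real"
    and F :: "real^2 \<Rightarrow> real^2"
    and \<Omega> :: "(real^2) set"
    and \<Xi>1 \<Xi>2 :: "real list"
  assumes M: "M \<ge> 1" and p20: "p20 \<ge> 1"
    and w0_pos: "\<And>i. i \<in> initial_index M p20 \<Longrightarrow> w0 i > 0"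
    and c_polar: "\<And>i2. (1, i2) \<in> initial_index M p20 \<Longrightarrow> c (1, i2) = 0"
    and w0_polar: "\<And>i2. (1, i2) \<in> initial_index M p20 \<Longrightarrow> w0 (1, i2) = w0 (2, i2)"
    and W: "W = weight_fun M p20 w0"
    and F: "F = nurbs_map M p20 w0 c"
    and bij: "bij_betw F (box 0 1) \<Omega>"
    and jac: "polar_jacobian M F"
    and corner: "corner_with_angle \<Omega> 0 \<omega>"
    and mu: "0 < \<mu>" "\<mu> \<le> 1"
    and p1: "p1 \<ge> 1" and p2: "p2 \<ge> p20"
    and N: "N1 > 1" "N2 > 1" "M dvd N2 - 1"
    and Xi1: "\<Xi>1 = graded_knots N1 p1 \<mu>"
    and Xi2: "refined_knots M N2 p2 \<Xi>2"
    and w_pos: "\<And>i. i \<in> tensor_index \<Xi>1 p1 \<Xi>2 p2 \<Longrightarrow> w i > 0"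
    and w_indep: "\<And>i1 j1 i2. (i1, i2) \<in> tensor_index \<Xi>1 p1 \<Xi>2 p2 \<Longrightarrow>
                    (j1, i2) \<in> tensor_index \<Xi>1 p1 \<Xi>2 p2 \<Longrightarrow> w (i1, i2) = w (j1, i2)"
    and w_refined: "\<And>\<zeta>. \<zeta> \<in> cbox 0 1 \<Longrightarrow> W \<zeta> = tensor_spline \<Xi>1 p1 \<Xi>2 p2 w \<zeta>"
  shows "(\<forall>\<zeta>\<in>cbox 0 1. W \<zeta> \<noteq> 0) \<and>
    (\<forall>v\<in>continuous_closure F.
       continuous_on (cbox 0 1) (\<lambda>\<zeta>. W \<zeta> * pullback F v \<zeta>) \<and>
       (\<forall>i\<in>tensor_index \<Xi>1 p1 \<Xi>2 p2.
          tensor_defined \<Xi>1 p1 \<Xi>2 p2 i (\<lambda>\<zeta>. W \<zeta> * pullback F v \<zeta>))) \<and>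
    Vh_pol \<Xi>1 p1 \<Xi>2 p2 W w F \<Omega> \<subseteq> continuous_closure F \<and>
    (\<forall>v\<in>continuous_closure F.
       Pi_Vh_pol \<Xi>1 p1 \<Xi>2 p2 W F v \<in> Vh_pol \<Xi>1 p1 \<Xi>2 p2 W w F \<Omega>) \<and>
    (\<forall>v\<in>Vh_pol \<Xi>1 p1 \<Xi>2 p2 W w F \<Omega>. \<forall>x\<in>\<Omega>.
       Pi_Vh_pol \<Xi>1 p1 \<Xi>2 p2 W F v x = v x)"
proof -
  let ?\<Xi>0 = "initial_knots M p20"
  let ?I = "tensor_index \<Xi>1 p1 \<Xi>2 p2"
  let ?B = "tensor_bspline \<Xi>1 p1 \<Xi>2 p2"
  have p2_pos: "p2 \<ge> 1" using p2 p20 by simp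
  interpret K0: open_knots ?\<Xi>0 p20 by (rule open_knots_initial[OF M p20])
  have K1: "open_knots \<Xi>1 p1" unfolding Xi1 using p1 N(1) mu(1) by (rule open_knots_graded)
  have K2: "open_knots \<Xi>2 p2" using Xi2 p2_pos N(2) by (rule open_knots_refined)
  interpret T: weighted_tensor_knots \<Xi>1 p1 \<Xi>2 p2 w W
    using K1 K2 w_pos w_indep w_refined
    by (intro weighted_tensor_knots.intro tensor_knots.intro weighted_tensor_knots_axioms.intro)
  \<comment> \<open>The curve F^(2) of the conical form of F. The weight function is unchanged by
    refinement, so the denominator may be taken from the refined B-splines while the numerator uses
    the initial ones.\<close>
  define \<gamma> where "\<gamma> t = (\<Sum>k=1..K0.n. (bspline ?\<Xi>0 k p20 t / T.W2 t) *\<^sub>R (w0 (2, k) *\<^sub>R c (2, k)))" for t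
  have F_eq: "F \<zeta> = \<zeta> $ 1 *\<^sub>R \<gamma> (\<zeta> $ 2)" if "\<zeta> \<in> cbox 0 1" for \<zeta>
  proof -
    have "F \<zeta> = \<zeta> $ 1 *\<^sub>R ((1 / W \<zeta>) *\<^sub>R (\<Sum>k=1..K0.n. bspline ?\<Xi>0 k p20 (\<zeta> $ 2) *\<^sub>R (w0 (2, k) *\<^sub>R c (2, k))))"
      unfolding F W K0.n_def using c_polar that by (rule nurbs_map_polar)
    then show ?thesis
      by (simp add: T.W_eq_W2[OF that] \<gamma>_def scaleR_sum_right divide_inverse mult_ac)
  qed
  have "\<exists>C. C-lipschitz_on {0..1} \<gamma>"
    unfolding \<gamma>_def
  proof (intro lipschitz_on_sum_ex lipschitz_on_scaleR_const_ex)
    fix k assume "k \<in> {1..K0.n}"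
    then obtain C where "C-lipschitz_on {0..1} (bspline ?\<Xi>0 k p20)" using K0.bspline_lipschitz[of k] by auto
    moreover obtain D where "D-lipschitz_on {0..1} T.W2" using T.W2_lipschitz by blast
    ultimately show "\<exists>C. C-lipschitz_on {0..1} (\<lambda>t. bspline ?\<Xi>0 k p20 t / T.W2 t)"
      using T.W2_pos by (rule lipschitz_on_divide)
  qed
  then obtain C0 where C0: "C0-lipschitz_on {0..1} \<gamma>" by blast
  define CL where "CL = C0 + 1"
  have CL: "CL-lipschitz_on {0..1} \<gamma>" "CL > 0"
    using lipschitz_on_le[OF C0, of CL] lipschitz_on_nonneg[OF C0] by (auto simp: CL_def)
  \<comment> \<open>The knots are the points where the numerator or the denominator of \<gamma> may
    fail to be differentiable; the values k / M are added because the Jacobian bound is assumed only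
    off these lines.\<close>
  define Z where "Z = set ?\<Xi>0 \<union> set \<Xi>2 \<union> (\<lambda>k. real k / real M) ` {..M}"
  define \<gamma>' where "\<gamma>' t = vector_derivative \<gamma> (at t)" for t
  have \<gamma>_diff: "(\<gamma> has_vector_derivative \<gamma>' t) (at t)" if t: "t \<in> {0<..<1} - Z" for t
  proof -
    obtain E where E: "(T.W2 has_real_derivative E) (at t)" using T.W2_differentiable[of t] t by (auto simp: Z_def)
    have "(\<lambda>t. bspline ?\<Xi>0 k p20 t / T.W2 t) differentiable (at t)" if k: "k \<in> {1..K0.n}" for k
    proof -
      obtain D where "(bspline ?\<Xi>0 k p20 has_real_derivative D) (at t)"
        using K0.bspline_differentiable[of k t] t k by (auto simp: Z_def)
      then show ?thesis
        using E T.W2_pos[of t] t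
        by (intro differentiable_divide) (auto simp: real_differentiable_def intro: less_imp_neq[symmetric])
    qed
    then have "\<gamma> differentiable (at t)"
      unfolding \<gamma>_def
      by (intro differentiable_sum finite_atLeastAtMost ballI differentiable_scaleR differentiable_const)
    then show ?thesis unfolding \<gamma>'_def by (simp add: vector_derivative_works)
  qed
  obtain c1 where c1: "c1 > 0" and det: "\<And>\<zeta>. \<zeta> \<in> box 0 1 \<Longrightarrow> (\<forall>k\<le>M. \<zeta> $ 2 \<noteq> real k / real M) \<Longrightarrow>
      c1 * \<zeta> $ 1 \<le> det (matrix (frechet_derivative F (at \<zeta>)))"
    using jac unfolding polar_jacobian_def by blast
  have cross: "c1 \<le> cross2 (\<gamma> t) (\<gamma>' t)" if t: "t \<in> {0<..<1} - Z" for t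
  proof -
    \<comment> \<open>At radius 1/2 both the determinant and its lower bound contain the factor 1/2,
      so the radius drops out.\<close>
    define \<zeta> where "\<zeta> = (vector [1 / 2, t] :: real^2)"
    have \<zeta>: "\<zeta> \<in> box 0 1" "\<zeta> $ 2 = t" "\<zeta> $ 1 = 1 / 2" using t by (auto simp: \<zeta>_def mem_open_unit_square)
    let ?D = "\<lambda>h::real^2. h $ 1 *\<^sub>R \<gamma> t + (1 / 2 * h $ 2) *\<^sub>R \<gamma>' t"
    have "(F has_derivative ?D) (at \<zeta>)"
      using polar_has_derivative[OF F_eq \<zeta>(1)] \<gamma>_diff[OF t] \<zeta>(2,3) by simp
    then have "frechet_derivative F (at \<zeta>) = ?D" by (rule frechet_derivative_at[symmetric])
    moreover have "det (matrix ?D) = 1 / 2 * cross2 (\<gamma> t) (\<gamma>' t)"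
      by (simp add: det_2 matrix_def axis_def cross2_def algebra_simps)
    moreover have "c1 * (1 / 2) \<le> det (matrix (frechet_derivative F (at \<zeta>)))"
      using det[OF \<zeta>(1)] t unfolding \<zeta>(2,3) by (auto simp: Z_def)
    ultimately show ?thesis by simp
  qed
  interpret P: polar_map \<gamma> \<gamma>' F Z CL c1 \<Omega>
    using F_eq CL c1 \<gamma>_diff cross bij by unfold_locales (auto simp: Z_def bij_betw_def)
  have sub: "box (0::real^2) 1 \<subseteq> cbox 0 1" by (rule box_subset_cbox)
  have W0: "W \<zeta> \<noteq> 0" if "\<zeta> \<in> cbox 0 1" for \<zeta> using T.W_pos[OF that] by simp

  have cont: "continuous_on (cbox 0 1) (\<lambda>\<zeta>. W \<zeta> * pullback F v \<zeta>)" if v: "v \<in> continuous_closure F" for v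
  proof -
    obtain u where u: "continuous_on (cbox 0 1) u" "\<And>\<zeta>. \<zeta> \<in> box 0 1 \<Longrightarrow> u \<zeta> = v (F \<zeta>)"
      using v unfolding continuous_closure_def by blast
    have "continuous_on (cbox 0 1) (\<lambda>\<zeta>. W \<zeta> * u \<zeta>)"
      by (intro continuous_on_mult T.continuous_on_W u)
    then show ?thesis by (rule continuous_on_eq) (simp add: pullback_eq[where u = u and v = v and F = F, OF u])
  qed

  have nurbs: "\<exists>a u. continuous_on (cbox 0 1) u \<and> (\<forall>\<zeta>. u \<zeta> = (\<Sum>i\<in>?I. a i * w i * (?B i \<zeta> / W \<zeta>))) \<and>
      (\<forall>x\<in>\<Omega>. v x = u (P.G x)) \<and> (\<exists>vP. \<forall>t\<in>{0..1}. u (vector [0, t]) = vP)"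
    if v: "v \<in> Vh_pol \<Xi>1 p1 \<Xi>2 p2 W w F \<Omega>" for v
  proof -
    obtain a where a: "\<forall>x\<in>\<Omega>. v x = (\<Sum>i\<in>?I. a i * nurbs_basis \<Xi>1 p1 \<Xi>2 p2 W w i (P.G x))"
      using v unfolding Vh_pol_def Vh_def by blast
    define u where "u \<zeta> = (\<Sum>i\<in>?I. a i * w i * (?B i \<zeta> / W \<zeta>))" for \<zeta>
    have u_cont: "continuous_on (cbox 0 1) u"
      unfolding u_def by (intro continuous_on_sum continuous_on_mult continuous_on_const T.continuous_on_nurbs)
    have vu: "v x = u (P.G x)" if "x \<in> \<Omega>" for x
      using a that by (simp add: u_def nurbs_basis_def mult.assoc)
    \<comment> \<open>Continuity on the closed square holds for all of \<open>Vh\<close>; equality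
      of the edge values is what membership in \<open>H1\<close> provides.\<close>
    have "\<exists>vP. \<forall>t\<in>{0..1}. u (vector [0, t]) = vP"
      using P.edge_constant[OF u_cont vu] v by (simp add: Vh_pol_def)
    then show ?thesis
      using u_cont vu u_def by (intro exI[of _ a] exI[of _ u] conjI) auto
  qed
  have vF: "u \<zeta> = v (F \<zeta>)" if "\<forall>x\<in>\<Omega>. v x = u (P.G x)" "\<zeta> \<in> box 0 1" for u :: "real^2 \<Rightarrow> real" and v \<zeta>
    using that P.G_F[OF that(2)] by (simp add: P.\<Omega>_eq)

  have in_closure: "v \<in> continuous_closure F" if v: "v \<in> Vh_pol \<Xi>1 p1 \<Xi>2 p2 W w F \<Omega>" for v
  proof -
    obtain u where u: "continuous_on (cbox 0 1) u" "\<forall>x\<in>\<Omega>. v x = u (P.G x)"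
      "\<exists>vP. \<forall>t\<in>{0..1}. u (vector [0, t]) = vP"
      using nurbs[OF v] by blast
    then show ?thesis
      unfolding continuous_closure_def using vF[OF u(2)] by blast
  qed

  have reproduce: "Pi_Vh_pol \<Xi>1 p1 \<Xi>2 p2 W F v x = v x"
    if v: "v \<in> Vh_pol \<Xi>1 p1 \<Xi>2 p2 W w F \<Omega>" and x: "x \<in> \<Omega>" for v x
  proof -
    obtain a u where u: "continuous_on (cbox 0 1) u" "\<forall>x\<in>\<Omega>. v x = u (P.G x)"
      and u_eq: "\<forall>\<zeta>. u \<zeta> = (\<Sum>i\<in>?I. a i * w i * (?B i \<zeta> / W \<zeta>))"
      using nurbs[OF v] by blast
    \<comment> \<open>Multiplication by W turns the NURBS function into the spline with coefficients
      a_i w_i, which the functionals reproduce.\<close>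
    have "tensor_functional \<Xi>1 p1 \<Xi>2 p2 i (\<lambda>\<zeta>. W \<zeta> * pullback F v \<zeta>) = a i * w i" if "i \<in> ?I" for i
    proof (rule T.tensor_functional_spline[OF that])
      fix \<zeta> :: "real^2" assume \<zeta>: "\<zeta> \<in> cbox 0 1"
      have "pullback F v \<zeta> = u \<zeta>" using u(1) vF[OF u(2)] \<zeta> by (rule pullback_eq)
      then show "W \<zeta> * pullback F v \<zeta> = (\<Sum>k\<in>?I. a k * w k * ?B k \<zeta>)"
        using W0[OF \<zeta>] by (simp add: u_eq sum_distrib_left)
    qed
    then have "Pi_pol \<Xi>1 p1 \<Xi>2 p2 (\<lambda>\<zeta>. W \<zeta> * pullback F v \<zeta>) \<zeta> / W \<zeta> = u \<zeta>" for \<zeta>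
      by (simp add: Pi_pol_def u_eq sum_divide_distrib)
    then show ?thesis using u(2) x by (simp add: Pi_Vh_pol_def)
  qed

  have in_Vh: "Pi_Vh_pol \<Xi>1 p1 \<Xi>2 p2 W F v \<in> Vh_pol \<Xi>1 p1 \<Xi>2 p2 W w F \<Omega>" if v: "v \<in> continuous_closure F" for v
  proof -
    obtain u vP where u: "continuous_on (cbox 0 1) u" "\<And>\<zeta>. \<zeta> \<in> box 0 1 \<Longrightarrow> u \<zeta> = v (F \<zeta>)"
      "\<And>t. t \<in> {0..1} \<Longrightarrow> u (vector [0, t]) = vP"
      using v unfolding continuous_closure_def by blast
    define l where "l i = tensor_functional \<Xi>1 p1 \<Xi>2 p2 i (\<lambda>\<zeta>. W \<zeta> * pullback F v \<zeta>)" for i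
    \<comment> \<open>Since W has the coefficients w_i, the constant vP corresponds to the
      coefficients vP w_i. The remainder d vanishes for i1 = 1, so only products that vanish at
      \<zeta>1 = 0 are left.\<close>
    define d where "d i = l i - vP * w i" for i
    define U where "U \<zeta> = Pi_pol \<Xi>1 p1 \<Xi>2 p2 (\<lambda>\<zeta>. W \<zeta> * pullback F v \<zeta>) \<zeta> / W \<zeta>" for \<zeta>
    have d0: "d i = 0" if "i \<in> ?I" "fst i = 1" for i
    proof -
      have "l i = vP * w i"
        unfolding l_def
      proof (rule T.tensor_functional_edge[OF that])
        fix t :: real assume t: "t \<in> {0..1}"
        then have "vector [0, t] \<in> cbox (0::real^2) 1" by (simp add: mem_unit_square)
        then show "W (vector [0, t]) * pullback F v (vector [0, t]) = vP * W (vector [0, t])"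
          using u(3)[OF t] by (simp add: pullback_eq[where u = u and v = v and F = F, OF u(1,2)])
      qed
      then show ?thesis by (simp add: d_def)
    qed
    have U_eq: "U \<zeta> = vP + (\<Sum>i\<in>?I. d i * (?B i \<zeta> / W \<zeta>))" if "\<zeta> \<in> cbox 0 1" for \<zeta>
    proof -
      have "U \<zeta> = (\<Sum>i\<in>?I. d i * ?B i \<zeta> + vP * (w i * ?B i \<zeta>)) / W \<zeta>"
        unfolding U_def Pi_pol_def by (intro arg_cong2[of _ _ _ _ "(/)"] sum.cong refl) (simp add: d_def l_def algebra_simps)
      also have "\<dots> = (\<Sum>i\<in>?I. d i * ?B i \<zeta>) / W \<zeta> + vP"
        using W0[OF that] by (simp add: sum.distrib add_divide_distrib sum_distrib_left[symmetric] T.W_sum[OF that, symmetric])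
      finally show ?thesis by (simp add: sum_divide_distrib)
    qed
    have "U \<circ> P.G \<in> H1 \<Omega>"
    proof -
      have "\<exists>L\<ge>0. \<forall>\<zeta>\<in>cbox 0 1. \<forall>\<eta>\<in>cbox 0 1. \<bar>d i * (?B i \<zeta> / W \<zeta>) - d i * (?B i \<eta> / W \<eta>)\<bar>
          \<le> L * (\<bar>\<zeta> $ 1 - \<eta> $ 1\<bar> + \<zeta> $ 1 * \<bar>\<zeta> $ 2 - \<eta> $ 2\<bar>)" if i: "i \<in> ?I" for i
      proof (cases "fst i = 1")
        case True
        then show ?thesis using d0[OF i] by (intro exI[of _ 0]) simp
      next
        case False
        obtain L where L: "L \<ge> 0" "\<And>\<zeta> \<eta>. \<zeta> \<in> cbox 0 1 \<Longrightarrow> \<eta> \<in> cbox 0 1 \<Longrightarrow>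
          \<bar>?B i \<zeta> / W \<zeta> - ?B i \<eta> / W \<eta>\<bar> \<le> L * (\<bar>\<zeta> $ 1 - \<eta> $ 1\<bar> + \<zeta> $ 1 * \<bar>\<zeta> $ 2 - \<eta> $ 2\<bar>)"
          using T.spline_increment[OF i False] by blast
        show ?thesis
        proof (intro exI[of _ "\<bar>d i\<bar> * L"] conjI ballI)
          fix \<zeta> \<eta> :: "real^2" assume "\<zeta> \<in> cbox 0 1" "\<eta> \<in> cbox 0 1"
          from mult_left_mono[OF L(2)[OF this], of "\<bar>d i\<bar>"]
          show "\<bar>d i * (?B i \<zeta> / W \<zeta>) - d i * (?B i \<eta> / W \<eta>)\<bar>
            \<le> \<bar>d i\<bar> * L * (\<bar>\<zeta> $ 1 - \<eta> $ 1\<bar> + \<zeta> $ 1 * \<bar>\<zeta> $ 2 - \<eta> $ 2\<bar>)"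
            by (simp only: right_diff_distrib[symmetric] abs_mult mult.assoc)
        qed (use L(1) in simp)
      qed
      then obtain L where L: "\<And>i. i \<in> ?I \<Longrightarrow> L i \<ge> 0"
        "\<And>i \<zeta> \<eta>. i \<in> ?I \<Longrightarrow> \<zeta> \<in> cbox 0 1 \<Longrightarrow> \<eta> \<in> cbox 0 1 \<Longrightarrow> \<bar>d i * (?B i \<zeta> / W \<zeta>) - d i * (?B i \<eta> / W \<eta>)\<bar>
          \<le> L i * (\<bar>\<zeta> $ 1 - \<eta> $ 1\<bar> + \<zeta> $ 1 * \<bar>\<zeta> $ 2 - \<eta> $ 2\<bar>)"
        by metis
      have U_cont: "continuous_on (cbox 0 1) U"
      proof -
        have "continuous_on (cbox 0 1) (\<lambda>\<zeta>. vP + (\<Sum>i\<in>?I. d i * (?B i \<zeta> / W \<zeta>)))"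
          by (intro continuous_on_add continuous_on_sum continuous_on_mult continuous_on_const T.continuous_on_nurbs)
        then show ?thesis by (rule continuous_on_eq) (simp add: U_eq)
      qed
      have "bounded (U ` cbox 0 1)" by (intro compact_imp_bounded compact_continuous_image U_cont compact_cbox)
      then obtain C where "\<forall>y\<in>U ` cbox 0 1. \<bar>y\<bar> \<le> C" unfolding bounded_real by blast
      then have C: "\<bar>U \<zeta>\<bar> \<le> C" if "\<zeta> \<in> box 0 1" for \<zeta> using that sub by blast
      show ?thesis
      proof (rule P.H1_pullback[where ?L0.0 = "\<Sum>i\<in>?I. L i" and B = C and ?Z1.0 = "set \<Xi>1" and ?Z2.0 = "set \<Xi>2"])
        fix \<zeta> \<eta> :: "real^2" assume "\<zeta> \<in> box 0 1" "\<eta> \<in> box 0 1"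
        then have m: "\<zeta> \<in> cbox 0 1" "\<eta> \<in> cbox 0 1" using sub by auto
        have "\<bar>U \<zeta> - U \<eta>\<bar> = \<bar>\<Sum>i\<in>?I. d i * (?B i \<zeta> / W \<zeta>) - d i * (?B i \<eta> / W \<eta>)\<bar>"
          by (simp add: U_eq m sum_subtractf)
        also have "\<dots> \<le> (\<Sum>i\<in>?I. L i * (\<bar>\<zeta> $ 1 - \<eta> $ 1\<bar> + \<zeta> $ 1 * \<bar>\<zeta> $ 2 - \<eta> $ 2\<bar>))"
          by (intro order_trans[OF sum_abs] sum_mono L m)
        finally show "\<bar>U \<zeta> - U \<eta>\<bar> \<le> (\<Sum>i\<in>?I. L i) * (\<bar>\<zeta> $ 1 - \<eta> $ 1\<bar> + \<zeta> $ 1 * \<bar>\<zeta> $ 2 - \<eta> $ 2\<bar>)"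
          by (simp add: sum_distrib_right)
      next
        fix \<zeta> :: "real^2" assume \<zeta>: "\<zeta> \<in> box 0 1" "\<zeta> $ 1 \<notin> set \<Xi>1" "\<zeta> $ 2 \<notin> set \<Xi>2"
        have "(\<lambda>\<zeta>. vP + (\<Sum>i\<in>?I. d i * (?B i \<zeta> / W \<zeta>))) differentiable (at \<zeta>)"
          using T.finite_index
          by (intro differentiable_add differentiable_const differentiable_sum differentiable_mult
              T.nurbs_differentiable \<zeta> ballI)
        then obtain D where "((\<lambda>\<zeta>. vP + (\<Sum>i\<in>?I. d i * (?B i \<zeta> / W \<zeta>))) has_derivative D) (at \<zeta>)"
          by (auto simp: differentiable_def)
        then have "(U has_derivative D) (at \<zeta>)"
          by (rule has_derivative_transform_within_open[OF _ open_box \<zeta>(1)]) (use sub U_eq in auto)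
        then show "U differentiable (at \<zeta>)" by (auto simp: differentiable_def)
      qed (use C L(1) in \<open>auto intro: sum_nonneg\<close>)
    qed
    moreover have "Pi_Vh_pol \<Xi>1 p1 \<Xi>2 p2 W F v = U \<circ> P.G"
      by (simp add: Pi_Vh_pol_def U_def[abs_def])
    moreover have "U \<circ> P.G \<in> Vh \<Xi>1 p1 \<Xi>2 p2 W w F \<Omega>"
    proof -
      have "U \<zeta> = (\<Sum>i\<in>?I. (l i / w i) * nurbs_basis \<Xi>1 p1 \<Xi>2 p2 W w i \<zeta>)" for \<zeta>
        unfolding U_def Pi_pol_def sum_divide_distrib
      proof (intro sum.cong refl)
        fix i assume "i \<in> ?I"
        then have "w i \<noteq> 0" using w_pos[of i] by simp
        then show "tensor_functional \<Xi>1 p1 \<Xi>2 p2 i (\<lambda>\<zeta>. W \<zeta> * pullback F v \<zeta>) * ?B i \<zeta> / W \<zeta>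
          = (l i / w i) * nurbs_basis \<Xi>1 p1 \<Xi>2 p2 W w i \<zeta>"
          by (simp add: nurbs_basis_def l_def)
      qed
      then show ?thesis unfolding Vh_def by (auto intro: exI[of _ "\<lambda>i. l i / w i"])
    qed
    ultimately show ?thesis by (simp add: Vh_pol_def)
  qed

  show ?thesis
    using W0 cont T.tensor_defined[OF cont] in_closure in_Vh reproduce by blast
qed

end
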